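(* Let $q$ be a prime power and let $I\subseteq \mathrm{Irr}(q)$ be a finite set. Then the generating function for the $I$-cycle index of the matrix algebras $\mathrm{M}(n,q)$ satisfies \[\prod_{h\in I}x_{h,()}+\sum_{n=1}^{\infty} Z_{\mathrm{M}(n,q)}^{(I)}(\mathbf{x})\,u^n = \prod_{h\in \mathrm{Irr}(q)\setminus I} \left(1+\sum_{\lambda\neq ()} x_{h,\lambda}\frac{u^{|\lambda|\deg h}}{c(\lambda,\deg h,q)} \right)\cdot\prod_{h\in I} \left(x_{h,()}+\sum_{\lambda\neq ()} x_{h,\lambda}\frac{u^{|\lambda|\deg h}}{c(\lambda,\deg h,q)} \right),\] where the sums on the right hand side are over all partitions $\lambda\neq ()$ of positive integers (an identity of formal power series in the indeterminates).
   Context: $F=\mathrm{GF}(q)$; $\mathrm{Irr}(q)$ is the set of all monic irreducible polynomials in $F[t]$ (including $t$). To each pair $(h,\lambda)$ with $h\in\mathrm{Irr}(q)$ and $\lambda$ a partition of a nonnegative integer $|\lambda|$ (the empty partition being written $()$) an indeterminate $x_{h,\lambda}$ is assigned; $\mathbf{x}$ is the collection of these indeterminates. For $X\in \mathrm{M}(n,q)$ acting on $V=F^n$ and $h\in\mathrm{Irr}(q)$, let $V_h=\ker h(X)^n$ be the $h$-primary component. It decomposes as a direct sum of cyclic $FX$-submodules $V_h=V_{\lambda_1}\oplus\cdots\oplus V_{\lambda_r}$ such that $X|_{V_{\lambda_i}}$ has minimal polynomial $h^{\lambda_i}$ and $\lambda_1\ge\lambda_2\ge\cdots\ge\lambda_r\ge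 1$; the $\lambda_i$ are uniquely determined. Put $\lambda(X,h)=(\lambda_1,\dots,\lambda_r)$, with $\lambda(X,h)=()$ if $V_h=0$; so $|\lambda(X,h)|$ is the multiplicity of $h$ in the characteristic polynomial of $X$. $\mathrm{Div}\,X$ is the set of $h\in\mathrm{Irr}(q)$ dividing the characteristic polynomial of $X$. The $I$-cycle index of $\mathrm{M}(n,q)$ is \[Z_{\mathrm{M}(n,q)}^{(I)}(\mathbf{x}) = \frac{1}{|\mathrm{GL}(n,q)|}\sum_{X\in \mathrm{M}(n,q)}\ \prod_{h\in (\mathrm{Div}\,X) \cup I} x_{h,\lambda(X,h)}.\] For a partition $\lambda\ne()$ and $h\in \mathrm{Irr}(q)$, with $s=|\lambda|\deg h$, $c(\lambda,\deg h,q)$ is the order of the centralizer $C_{\mathrm{GL}(s,q)}(X)$ of any matrix $X\in \mathrm{M}(s,q)$ with characteristic polynomial $h^{|\lambda|}$ and $\lambda(X,h)=\lambda$ (this depends only on $\lambda$, $\deg h$ and $q$); and $c((),\deg h,q)=1$. *)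

theory Defs
  imports
    "HOL-Analysis.Infinite_Sum"
    "HOL-Library.Poly_Mapping"
    "HOL-Library.FuncSet"
    "HOL-Computational_Algebra.Polynomial_Factorial"
    "Jordan_Normal_Form.Char_Poly"
    "Jordan_Normal_Form.Matrix_Kernel"
begin

text \<open>
  The field \<open>GF(q)\<close> is an arbitrary type \<open>'a\<close> of class \<open>{field, finite}\<close>, with \<open>q = CARD('a)\<close>.
\<close>

subsection \<open>Partitions, irreducible polynomials, general linear groups\<close>

definition partitions :: "nat list set" where
  "partitions = {\<mu>. sorted_wrt (\<ge>) \<mu> \<and> (\<forall>k\<in>set \<mu>. 1 \<le> k)}"

definition Irr :: "'a::field poly set" where
  "Irr = {h. monic h \<and> irreducible h}"

definition GL :: "nat \<Rightarrow> 'a::field mat set" where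
  "GL n = {A \<in> carrier_mat n n. invertible_mat A}"

definition Div :: "'a::field mat \<Rightarrow> 'a poly set" where
  "Div X = {h \<in> Irr. h dvd char_poly X}"

subsection \<open>The partition attached to a matrix and an irreducible polynomial\<close>

text \<open>The matrix \<open>p(X)\<close>, for a square matrix \<open>X\<close>.\<close>

definition poly_mat :: "'a::field poly \<Rightarrow> 'a mat \<Rightarrow> 'a mat" where
  "poly_mat p X = mat (dim_row X) (dim_row X)
     (\<lambda>(i, j). \<Sum>k\<le>degree p. coeff p k * ((X ^\<^sub>m k) $$ (i, j)))"

definition primary_component :: "'a::field mat \<Rightarrow> 'a poly \<Rightarrow> 'a vec set" where
  "primary_component X h = mat_kernel (poly_mat h X ^\<^sub>m dim_row X)"

text \<open>\<open>F[t]\<close> acts on column vectors by \<open>p \<cdot> v = p(X) v\<close>; these are the submodules generated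
  by one vector.\<close>

definition cyclic_submodule :: "'a::field mat \<Rightarrow> 'a vec set \<Rightarrow> bool" where
  "cyclic_submodule X W \<longleftrightarrow>
     (\<exists>v\<in>carrier_vec (dim_row X). W = {poly_mat p X *\<^sub>v v | p. True})"

definition is_min_poly_on :: "'a::field mat \<Rightarrow> 'a vec set \<Rightarrow> 'a poly \<Rightarrow> bool" where
  "is_min_poly_on X W m \<longleftrightarrow>
     monic m \<and>
     (\<forall>w\<in>W. poly_mat m X *\<^sub>v w = 0\<^sub>v (dim_row X)) \<and>
     (\<forall>p. (\<forall>w\<in>W. poly_mat p X *\<^sub>v w = 0\<^sub>v (dim_row X)) \<longrightarrow> m dvd p)"

text \<open>Internal direct sum of the subspaces \<open>W 0, \<dots>, W (r - 1)\<close>: every vector of \<open>V\<close> is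
  uniquely a sum of vectors taken from the \<open>W i\<close>.  For \<open>r = 0\<close> this says \<open>V = 0\<close>.\<close>

definition is_direct_sum :: "nat \<Rightarrow> nat \<Rightarrow> (nat \<Rightarrow> 'a::field vec set) \<Rightarrow> 'a vec set \<Rightarrow> bool" where
  "is_direct_sum n r W V \<longleftrightarrow>
     bij_betw (\<lambda>w. finsum_vec TYPE('a) n w {..<r}) (\<Pi>\<^sub>E i\<in>{..<r}. W i) V"

definition has_primary_type :: "'a::field mat \<Rightarrow> 'a poly \<Rightarrow> nat list \<Rightarrow> bool" where
  "has_primary_type X h \<mu> \<longleftrightarrow>
     \<mu> \<in> partitions \<and>
     (\<exists>W. (\<forall>i<length \<mu>. cyclic_submodule X (W i) \<and> is_min_poly_on X (W i) (h ^ (\<mu> ! i))) \<and>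
          is_direct_sum (dim_row X) (length \<mu>) W (primary_component X h))"

definition primary_type :: "'a::field mat \<Rightarrow> 'a poly \<Rightarrow> nat list" where
  "primary_type X h = (THE \<mu>. has_primary_type X h \<mu>)"

subsection \<open>Centralizer orders\<close>

definition centralizer_GL :: "nat \<Rightarrow> 'a::field mat \<Rightarrow> 'a mat set" where
  "centralizer_GL n X = {A \<in> GL n. A * X = X * A}"

text \<open>\<open>cent_order TYPE('a) \<mu> d\<close> is \<open>c(\<mu>, d, q)\<close> with \<open>q = CARD('a)\<close>: the common value, over all
  monic irreducible \<open>h\<close> of degree \<open>d\<close> and all \<open>X\<close> with the stated properties, of the
  order of the centralizer of \<open>X\<close>.\<close>

definition cent_order :: "'a::{field,finite} itself \<Rightarrow> nat list \<Rightarrow> nat \<Rightarrow> nat" where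
  "cent_order _ \<mu> d =
     (if \<mu> = [] then 1
      else THE c. \<exists>h\<in>(Irr :: 'a poly set). \<exists>X\<in>carrier_mat (sum_list \<mu> * d) (sum_list \<mu> * d).
             degree h = d \<and> char_poly X = h ^ sum_list \<mu> \<and> primary_type X h = \<mu> \<and>
             c = card (centralizer_GL (sum_list \<mu> * d) X))"

subsection \<open>The indeterminates and the cycle index\<close>

text \<open>
  Rational polynomials in the indeterminates \<open>x\<^bsub>h,\<mu>\<^esub>\<close>: finitely supported maps from monomials to
  coefficients, a monomial being a finitely supported map from indeterminates to exponents.
  (The index type also has pairs with \<open>h \<notin> Irr\<close> or \<open>\<mu> \<notin> partitions\<close>; they are not used.)
\<close>

type_synonym 'a xpoly = "(('a poly \<times> nat list) \<Rightarrow>\<^sub>0 nat) \<Rightarrow>\<^sub>0 rat"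

definition xvar :: "'a::field poly \<Rightarrow> nat list \<Rightarrow> 'a xpoly" where
  "xvar h \<mu> = Poly_Mapping.single (Poly_Mapping.single (h, \<mu>) 1) 1"

definition xconst :: "rat \<Rightarrow> 'a::field xpoly" where
  "xconst r = Poly_Mapping.single 0 r"

definition cycle_index :: "'a::{field,finite} poly set \<Rightarrow> nat \<Rightarrow> 'a xpoly" where
  "cycle_index I n =
     xconst (1 / of_nat (card (GL n :: 'a mat set))) *
     (\<Sum>X\<in>carrier_mat n n. \<Prod>h\<in>Div X \<union> I. xvar h (primary_type X h))"

subsection \<open>Formal power series in \<open>u\<close>\<close>

text \<open>
  The series live in \<open>'a xpoly fps\<close>, with \<open>u\<close> being \<^term>\<open>fps_X\<close>.  Infinite sums and products are
  unordered limits in the topology of \<open>fps\<close> (coefficientwise stabilization).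
\<close>

definition fps_has_prod :: "('i \<Rightarrow> 'b::comm_ring_1 fps) \<Rightarrow> 'i set \<Rightarrow> 'b fps \<Rightarrow> bool" where
  "fps_has_prod f A P \<longleftrightarrow> (prod f \<longlongrightarrow> P) (finite_subsets_at_top A)"

definition type_series :: "'a::{field,finite} poly \<Rightarrow> 'a xpoly fps" where
  "type_series h =
     (\<Sum>\<^sub>\<infinity>\<mu>\<in>partitions - {[]}.
        fps_const (xvar h \<mu> * xconst (1 / of_nat (cent_order TYPE('a) \<mu> (degree h)))) *
        fps_X ^ (sum_list \<mu> * degree h))"

text \<open>The infinite sums used here converge, so \<^const>\<open>infsum\<close> never takes its default value.\<close>

lemma has_sum_fps_monomials:
  fixes a :: "'i \<Rightarrow> 'b::comm_ring_1" and e :: "'i \<Rightarrow> nat"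
  assumes fin: "\<And>n. finite {i \<in> A. e i = n}"
  shows "((\<lambda>i. fps_const (a i) * fps_X ^ e i) has_sum
           Abs_fps (\<lambda>n. \<Sum>i\<in>{i \<in> A. e i = n}. a i)) A"
    (is "(?f has_sum ?S) A")
  unfolding has_sum_def tendsto_fps_iff
proof
  fix n
  have nth: "fps_nth (?f i) m = (if e i = m then a i else 0)" for i m
    by (simp add: fps_X_power_iff)
  have "eventually (\<lambda>B. finite B \<and> {i \<in> A. e i = n} \<subseteq> B \<and> B \<subseteq> A) (finite_subsets_at_top A)"
    using fin[of n] by (auto simp: eventually_finite_subsets_at_top)
  then show "eventually (\<lambda>B. fps_nth (sum ?f B) n = fps_nth ?S n) (finite_subsets_at_top A)"
  proof eventually_elim
    case (elim B)
    have "fps_nth (sum ?f B) n = (\<Sum>i\<in>B. if e i = n then a i else 0)"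
      by (simp only: fps_sum_nth nth)
    also have "\<dots> = (\<Sum>i\<in>{i \<in> A. e i = n}. a i)"
      using elim by (intro sum.mono_neutral_cong_right) auto
    finally show ?case by simp
  qed
qed

lemma finite_partitions: "finite {\<mu> \<in> partitions. sum_list \<mu> = m}"
proof -
  have "length \<mu> \<le> sum_list \<mu>" if "\<forall>k\<in>set \<mu>. 1 \<le> k" for \<mu> :: "nat list"
    using that by (induction \<mu>) auto
  then have "{\<mu> \<in> partitions. sum_list \<mu> = m} \<subseteq> {\<mu>. set \<mu> \<subseteq> {..m} \<and> length \<mu> \<le> m}"
    by (auto simp: partitions_def dest: member_le_sum_list)
  then show ?thesis
    by (rule finite_subset) (rule finite_lists_length_le, simp)
qed

lemma type_series_summable:
  fixes h :: "'a::{field,finite} poly" and a :: "nat list \<Rightarrow> 'a xpoly"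
  assumes "h \<in> Irr"
  shows "(\<lambda>\<mu>. fps_const (a \<mu>) * fps_X ^ (sum_list \<mu> * degree h)) summable_on (partitions - {[]})"
proof -
  have d: "degree h > 0"
    using assms by (auto simp: Irr_def irreducible_def is_unit_iff_degree intro!: Nat.gr0I)
  have "finite {\<mu> \<in> partitions - {[]}. sum_list \<mu> * degree h = n}" for n
    by (rule finite_subset[OF _ finite_partitions[of "n div degree h"]]) (use d in auto)
  from has_sum_fps_monomials[OF this] show ?thesis
    unfolding summable_on_def by blast
qed

lemma cycle_index_series_summable:
  fixes a :: "nat \<Rightarrow> 'b::comm_ring_1"
  shows "(\<lambda>n. fps_const (a n) * fps_X ^ n) summable_on {1..}"
  using has_sum_fps_monomials[of "{1..}" "\<lambda>n. n" a] unfolding summable_on_def by fastforce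

end

theory Submission
  imports Defs "HOL-Library.Cardinality" "HOL-Library.Function_Algebras"
begin

text \<open>
  A matrix \<open>X\<close> turns \<open>F\<^sup>n\<close> into a finite \<open>F[t]\<close>-module.  For a list of prime powers \<open>(h, k)\<close>, sorted
  by decreasing exponents for each \<open>h\<close>, the families of vectors \<open>v\<close> that generate independent copies
  of the modules \<open>F[t]/(h ^ k)\<close> can be counted one vector at a time, and their number depends only on
  the list and on the cardinalities of the kernels of \<open>h(X) ^ k\<close>.  Conversely these cardinalities
  determine the primary types.

  If \<open>C\<close> is a fixed matrix with prescribed types, then the invertible \<open>g\<close> with \<open>X g = g C\<close> correspond
  to such families for \<open>X\<close>.  Counting the pairs \<open>(X, g)\<close> in two ways, the class of matrices with types
  \<open>\<tau>\<close> has \<open>|GL(n,q)| / \<Prod>h. c(\<tau>(h), deg h, q)\<close> elements; taking \<open>X = C\<close> primary identifies the factors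
  with centralizer orders.  Comparing coefficients of \<open>u ^ n\<close>, where only the finitely many \<open>h\<close> in
  \<open>I\<close> or of degree at most \<open>n\<close> matter, gives the theorem.
\<close>

subsection \<open>Irreducible polynomials over a finite field\<close>

text \<open>No closed formula for a centralizer order enters. The size of a class and
  \<open>cent_order\<close> are both expressed through the number \<open>aut_count\<close>, which is
  never evaluated; it matters only that it depends on the type and on
  \<open>CARD('a) ^ degree h\<close> alone. The obstacle is that \<open>primary_type\<close> and
  \<open>cent_order\<close> are definite descriptions: the former denotes only if every primary
  component has exactly one type, the latter only if all irreducible polynomials of one degree and
  all admissible matrices give the same count, and one such matrix exists. Finiteness replaces much
  structure theory: generation, injectivity and directness of sums are often read off from equal
  cardinalities. In \<open>good\<close> a single excluded multiple of the new vector forces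
  independence, because its annihilator modulo a submodule is generated by a power of
  \<open>h\<close>. Adjoining smaller exponents later makes the number of admissible vectors
  independent of the earlier choices.\<close>

definition lowdeg :: "nat \<Rightarrow> 'a::zero poly set" where
  "lowdeg m = {p. \<forall>i\<ge>m. coeff p i = 0}"

lemma lowdeg_iff: "p \<in> lowdeg m \<longleftrightarrow> p = 0 \<or> degree p < m"
proof
  assume p: "p \<in> lowdeg m"
  then have "lead_coeff p = 0" if "m \<le> degree p"
    using that unfolding lowdeg_def by blast
  then show "p = 0 \<or> degree p < m" by (metis leading_coeff_0_iff linorder_not_less)
qed (auto simp: lowdeg_def coeff_eq_0)

lemma lowdeg_diff: "p \<in> lowdeg m \<Longrightarrow> r \<in> lowdeg m \<Longrightarrow> p - r \<in> lowdeg m"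
  for p :: "'a::ab_group_add poly"
  by (auto simp: lowdeg_def)

lemma zero_in_lowdeg [simp]: "0 \<in> lowdeg m"
  by (simp add: lowdeg_def)

lemma lowdeg_Suc: "lowdeg (Suc m) = (\<lambda>(a, p). pCons a p) ` (UNIV \<times> lowdeg m)"
proof -
  have "pCons a p \<in> lowdeg (Suc m) \<longleftrightarrow> p \<in> lowdeg m" for a and p :: "'a poly"
    unfolding lowdeg_def mem_Collect_eq
    by (metis Suc_le_D Suc_le_mono coeff_pCons_Suc)
  then show ?thesis
    by (auto simp: image_iff) (metis pCons_cases)
qed

lemma finite_card_lowdeg:
  "finite (lowdeg m :: 'a::{zero,finite} poly set) \<and> card (lowdeg m :: 'a poly set) = CARD('a) ^ m"
proof (induction m)
  case 0
  have "(lowdeg 0 :: 'a poly set) = {0}" by (auto simp: lowdeg_def poly_eq_iff)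
  then show ?case by simp
next
  case (Suc m)
  have "inj_on (\<lambda>(a :: 'a, p). pCons a p) (UNIV \<times> lowdeg m)"
    by (auto simp: inj_on_def)
  with Suc show ?case
    by (simp add: lowdeg_Suc card_image card_cartesian_product)
qed

lemmas finite_lowdeg = finite_card_lowdeg[THEN conjunct1]
  and card_lowdeg = finite_card_lowdeg[THEN conjunct2]

lemma mod_in_lowdeg: "g \<noteq> 0 \<Longrightarrow> p mod g \<in> lowdeg (degree g)" for g :: "'a::field poly"
  using degree_mod_less[of g p] by (auto simp: lowdeg_iff)

lemma lowdeg_dvd_imp_zero: "p \<in> lowdeg (degree g) \<Longrightarrow> g dvd p \<Longrightarrow> p = 0"
  for g :: "'a::field poly"
  by (auto simp: lowdeg_iff dest: dvd_imp_degree_le)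

lemma Irr_nonzero: "h \<in> Irr \<Longrightarrow> h \<noteq> 0"
  and Irr_prime_elem: "h \<in> Irr \<Longrightarrow> prime_elem h"
  by (auto simp: Irr_def field_poly_irreducible_imp_prime)

lemma Irr_degree_pos: "h \<in> Irr \<Longrightarrow> 0 < degree h"
  by (auto simp: Irr_def irreducible_def is_unit_iff_degree intro!: Nat.gr0I)

lemma degree_Irr_power: "h \<in> Irr \<Longrightarrow> degree (h ^ k) = k * degree h"
  by (simp add: degree_power_eq Irr_nonzero)

lemma Irr_dvd_Irr: "g \<in> Irr \<Longrightarrow> h \<in> Irr \<Longrightarrow> g dvd h \<Longrightarrow> g = h"
proof -
  assume g: "g \<in> Irr" and h: "h \<in> Irr" and "g dvd h"
  then obtain c where c: "h = g * c" by (elim dvdE)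
  have "\<not> is_unit g" using g by (auto simp: Irr_def irreducible_def)
  then have "is_unit c" using h c by (auto simp: Irr_def dest: irreducibleD)
  then have "degree c = 0" using c h by (auto simp: is_unit_iff_degree Irr_nonzero)
  then obtain a where a: "c = [:a:]" by (rule degree_eq_zeroE)
  have "lead_coeff h = lead_coeff g * lead_coeff c" by (simp add: c lead_coeff_mult)
  then have "a = 1" using g h a by (simp add: Irr_def)
  then show "g = h" using c a by (simp add: one_pCons)
qed

text \<open>Over a finite field, multiplication by \<open>g\<close> modulo \<open>h ^ e\<close> is an injective map of a finite
  set into itself, so it hits the residue 1.\<close>

lemma bezout_Irr_power:
  fixes h :: "'a::{field,finite} poly"
  assumes h: "h \<in> Irr" and g: "\<not> h dvd g"
  obtains a b where "a * h ^ e + b * g = 1"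
proof (cases "e = 0")
  case True
  then show ?thesis using that[of 1 0] by simp
next
  case False
  have nz: "h ^ e \<noteq> 0" using h by (simp add: Irr_nonzero)
  let ?L = "lowdeg (degree (h ^ e)) :: 'a poly set" and ?f = "\<lambda>c. g * c mod h ^ e"
  have "inj_on ?f ?L"
  proof (rule inj_onI)
    fix c d assume c: "c \<in> ?L" "d \<in> ?L" "?f c = ?f d"
    then have "h ^ e dvd g * (c - d)" by (simp add: mod_eq_dvd_iff right_diff_distrib)
    then have "h ^ e dvd c - d"
      using prime_power_dvd_multD[OF Irr_prime_elem[OF h], of e g "c - d"] False g by simp
    then show "c = d" using lowdeg_dvd_imp_zero[OF lowdeg_diff[OF c(1,2)]] by simp
  qed
  moreover have "?f ` ?L \<subseteq> ?L" using mod_in_lowdeg[OF nz] by auto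
  ultimately have "?f ` ?L = ?L" by (intro endo_inj_surj finite_lowdeg)
  moreover have "1 \<in> ?L" using False h by (auto simp: lowdeg_iff degree_Irr_power Irr_degree_pos)
  ultimately obtain c where "g * c mod h ^ e = 1" by (metis (no_types, lifting) imageE)
  then have "g * c = g * c div h ^ e * h ^ e + 1"
    using div_mult_mod_eq[of "g * c" "h ^ e"] by simp
  then have "(- (g * c div h ^ e)) * h ^ e + c * g = 1"
    unfolding mult.commute[of c g] by (simp only: minus_mult_left[symmetric]) (metis add_minus_cancel add.commute)
  then show ?thesis by (rule that)
qed

text \<open>Dividing by \<open>h ^ e\<close> gives the count. Read modulo
  \<open>h ^ (e + k)\<close>, these multiples represent the elements of a cyclic module that are
  killed by \<open>h ^ k\<close>; \<open>card_span_ker\<close> uses the count in this form.\<close>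

lemma card_lowdeg_multiples:
  fixes h :: "'a::{field,finite} poly"
  assumes h: "h \<in> Irr"
  shows "card {p \<in> lowdeg ((e + k) * degree h). h ^ e dvd p} = CARD('a) ^ (k * degree h)"
proof -
  have "degree (h ^ e * r) = e * degree h + degree r" if "r \<noteq> 0" for r
    using that h by (simp add: degree_mult_eq Irr_nonzero degree_Irr_power)
  then have "h ^ e * r \<in> lowdeg ((e + k) * degree h) \<longleftrightarrow> r \<in> lowdeg (k * degree h)" for r
    using h by (cases "r = 0") (simp_all add: lowdeg_iff algebra_simps Irr_nonzero)
  then have "{p \<in> lowdeg ((e + k) * degree h). h ^ e dvd p} = (*) (h ^ e) ` lowdeg (k * degree h)"
    by (auto elim!: dvdE)
  moreover have "inj_on ((*) (h ^ e)) (lowdeg (k * degree h))"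
    using h by (auto simp: inj_on_def Irr_nonzero)
  ultimately show ?thesis by (simp add: card_image card_lowdeg)
qed

subsection \<open>Counting independent families in a finite module\<close>

lemma power_eq_mult_pred: "1 \<le> k \<Longrightarrow> a ^ k = a * a ^ (k - 1)"
  by (cases k) simp_all

text \<open>Lists are built from the right: the head is the cyclic summand adjoined last, so for each \<open>h\<close>
  the exponents increase along the list.\<close>

fun valid_shape :: "('a::field poly \<times> nat) list \<Rightarrow> bool" where
  "valid_shape [] \<longleftrightarrow> True"
| "valid_shape ((h, k) # L) \<longleftrightarrow>
     h \<in> Irr \<and> 1 \<le> k \<and> (\<forall>j. (h, j) \<in> set L \<longrightarrow> k \<le> j) \<and> valid_shape L"

text \<open>In the direct sum of the modules F[t]/(g ^ j) this is the composition length of the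
  kernel of \<open>h ^ k\<close>; each composition factor has \<open>CARD('a) ^ degree h\<close>
  elements.\<close>

definition ker_len :: "('a poly \<times> nat) list \<Rightarrow> 'a::zero poly \<Rightarrow> nat \<Rightarrow> nat" where
  "ker_len L h k = (\<Sum>(g, j)\<leftarrow>L. if g = h then min j k else 0)"

definition shape_degree :: "('a::zero poly \<times> nat) list \<Rightarrow> nat" where
  "shape_degree L = (\<Sum>(g, j)\<leftarrow>L. j * degree g)"

text \<open>With \<open>a h k\<close> the cardinality of the kernel of \<open>h ^ k\<close>, the last factor counts the \<open>v\<close> with
  \<open>h ^ k v = 0\<close> such that \<open>h ^ (k - 1) v\<close> avoids the \<open>h\<close>-socle of the module already generated.\<close>

fun family_count :: "('a::{field,finite} poly \<Rightarrow> nat \<Rightarrow> nat) \<Rightarrow> ('a poly \<times> nat) list \<Rightarrow> nat" where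
  "family_count a [] = 1"
| "family_count a ((h, k) # L) =
     family_count a L * (a h k - CARD('a) ^ (degree h * ker_len L h 1) * a h (k - 1))"

lemma ker_len_Nil [simp]: "ker_len [] h k = 0"
  and ker_len_Cons: "ker_len ((g, j) # L) h k = (if g = h then min j k else 0) + ker_len L h k"
  and ker_len_append: "ker_len (L @ L') h k = ker_len L h k + ker_len L' h k"
  by (simp_all add: ker_len_def)

lemma shape_degree_Nil [simp]: "shape_degree [] = 0"
  and shape_degree_Cons: "shape_degree ((g, j) # L) = j * degree g + shape_degree L"
  and shape_degree_append: "shape_degree (L @ L') = shape_degree L + shape_degree L'"
  by (simp_all add: shape_degree_def)

locale finite_poly_module = Modules.module scale
  for scale :: "'a::{field,finite} poly \<Rightarrow> 'b::ab_group_add \<Rightarrow> 'b" (infixr \<open>*s\<close> 75) +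
  fixes V :: "'b set"
  assumes subspace_V: "subspace V" and finite_V: "finite V"
begin

text \<open>The head of the list is the vector adjoined last.  If \<open>k\<close> does not exceed the exponents of
  \<open>h\<close> occurring earlier, the last condition says that the cyclic module generated by \<open>v\<close> is
  isomorphic to \<open>F[t]/(h ^ k)\<close> and independent of the earlier ones.\<close>

fun good :: "('a poly \<times> nat) list \<Rightarrow> 'b list \<Rightarrow> bool" where
  "good [] [] \<longleftrightarrow> True"
| "good ((h, k) # L) (v # vs) \<longleftrightarrow>
     v \<in> V \<and> h ^ k *s v = 0 \<and> h ^ (k - 1) *s v \<notin> span (set vs) \<and> good L vs"
| "good _ _ \<longleftrightarrow> False"

definition ker :: "'a poly \<Rightarrow> nat \<Rightarrow> 'b set" where
  "ker h k = {v \<in> V. h ^ k *s v = 0}"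

lemma good_length: "good L vs \<Longrightarrow> length vs = length L"
  by (induction L vs rule: good.induct) auto

lemma good_subset: "good L vs \<Longrightarrow> set vs \<subseteq> V"
  by (induction L vs rule: good.induct) auto

lemma good_span_subset: "good L vs \<Longrightarrow> span (set vs) \<subseteq> V"
  using good_subset span_minimal subspace_V by blast

lemma good_distinct: "good L vs \<Longrightarrow> distinct vs"
proof (induction L vs rule: good.induct)
  case (2 h k L v vs)
  have "v \<notin> set vs"
  proof
    assume "v \<in> set vs"
    then have "h ^ (k - 1) *s v \<in> span (set vs)" by (simp add: span_base span_scale)
    with 2 show False by simp
  qed
  with 2 show ?case by simp
qed auto

lemma good_ConsE:
  assumes "good ((h, k) # L) ws"
  obtains v vs where "ws = v # vs" "v \<in> V" "h ^ k *s v = 0"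
    "h ^ (k - 1) *s v \<notin> span (set vs)" "good L vs"
  using assms by (cases ws) auto

lemma scale_eq_0_if_dvd: "p *s v = 0 \<Longrightarrow> p dvd r \<Longrightarrow> r *s v = 0"
proof -
  assume p: "p *s v = 0" and "p dvd r"
  then obtain c where "r = p * c" by (elim dvdE)
  then show "r *s v = 0" using p scale_scale[of c p v] by (simp add: mult.commute)
qed

text \<open>Modulo \<open>S\<close>, the annihilator of \<open>v\<close> contains
  \<open>h ^ k\<close>. A further annihilator \<open>p\<close> that is no multiple of
  \<open>h ^ k\<close> has the form \<open>h ^ (n - 1) * u\<close> with \<open>n \<le> k\<close> and
  \<open>u\<close> prime to \<open>h\<close>; inverting \<open>u\<close> modulo \<open>h\<close>
  shows that \<open>h ^ (k - 1)\<close> annihilates \<open>v\<close> as well.\<close>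

lemma power_scale_mem:
  assumes h: "h \<in> Irr" and S: "subspace S" and k: "h ^ k *s v \<in> S" and p: "p *s v \<in> S"
    and nd: "\<not> h ^ k dvd p"
  shows "h ^ (k - 1) *s v \<in> S"
proof -
  define n where "n = (LEAST n. \<not> h ^ n dvd p)"
  have n: "\<not> h ^ n dvd p" "n \<le> k"
    unfolding n_def using nd by (rule LeastI, rule Least_le)
  have "n \<noteq> 0" using n(1) by (intro notI) simp
  then have "h ^ (n - 1) dvd p"
    using not_less_Least[of "n - 1" "\<lambda>n. \<not> h ^ n dvd p"] by (simp flip: n_def)
  then obtain u where u: "p = h ^ (n - 1) * u" by (elim dvdE)
  have "\<not> h dvd u"
  proof
    assume "h dvd u"
    then have "h ^ (n - 1) * h dvd p" unfolding u by (rule mult_dvd_mono[OF dvd_refl])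
    then show False using n(1) \<open>n \<noteq> 0\<close> by (simp only: power_minus_mult neq0_conv)
  qed
  then obtain a b where ab: "a * h ^ 1 + b * u = 1" by (rule bezout_Irr_power[OF h])
  have e: "k - 1 = (k - n) + (n - 1)" "Suc (k - 1) = k" using \<open>n \<noteq> 0\<close> n(2) by auto
  \<comment> \<open>The Bezout identity is multiplied by \<open>h ^ (k - 1)\<close>: the first term
    then contains \<open>h ^ k\<close>, the second contains \<open>p\<close>.\<close>
  have "h ^ (k - 1) = (a * h ^ 1 + b * u) * h ^ (k - 1)" unfolding ab by simp
  also have "\<dots> = a * h ^ Suc (k - 1) + b * u * h ^ (k - 1)" by (simp add: algebra_simps)
  also have "b * u * h ^ (k - 1) = b * h ^ (k - n) * p" by (simp only: e(1) power_add u mult_ac)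
  finally have "h ^ (k - 1) *s v = a *s (h ^ k *s v) + (b * h ^ (k - n)) *s (p *s v)"
    by (metis e(2) scale_left_distrib scale_scale)
  then show ?thesis using k p S by (metis subspace_add subspace_scale)
qed

text \<open>\<open>good\<close> keeps one multiple of \<open>v\<close> out of the span of the tail.
  By \<open>power_scale_mem\<close> this keeps out every multiple by a \<open>p\<close> outside the
  ideal of \<open>h ^ k\<close>, which makes the sum direct.\<close>

lemma good_Cons_dvd:
  assumes "good ((h, k) # L) (v # vs)" "h \<in> Irr" "p *s v \<in> span (set vs)"
  shows "h ^ k dvd p"
  using power_scale_mem[OF assms(2) subspace_span, of k v "set vs" p] assms span_zero by auto

text \<open>Normal form by division with remainder modulo \<open>h ^ k\<close>;
  \<open>good_Cons_dvd\<close> makes the remainder unique. Counts in the span thus reduce to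
  polynomials of bounded degree and the span of the tail.\<close>

lemma good_Cons_bij:
  assumes g: "good ((h, k) # L) (v # vs)" and h: "h \<in> Irr"
  shows "bij_betw (\<lambda>(p, s). p *s v + s) (lowdeg (k * degree h) \<times> span (set vs)) (span (set (v # vs)))"
  unfolding bij_betw_def
proof (intro conjI inj_onI equalityI subsetI)
  fix x y
  assume "x \<in> lowdeg (k * degree h) \<times> span (set vs)" "y \<in> lowdeg (k * degree h) \<times> span (set vs)"
    and "(case x of (p, s) \<Rightarrow> p *s v + s) = (case y of (p, s) \<Rightarrow> p *s v + s)"
  then obtain p s p' s' where x: "x = (p, s)" "y = (p', s')"
    and p: "p \<in> lowdeg (k * degree h)" "p' \<in> lowdeg (k * degree h)"
    and s: "s \<in> span (set vs)" "s' \<in> span (set vs)" and eq: "p *s v + s = p' *s v + s'"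
    by auto
  have "(p - p') *s v = s' - s" using eq by (simp add: algebra_simps)
  then have "h ^ k dvd p - p'" using good_Cons_dvd[OF g h, of "p - p'"] s by (simp add: span_diff)
  then have "p = p'"
    using lowdeg_dvd_imp_zero[of "p - p'" "h ^ k"] lowdeg_diff[OF p] h by (simp add: degree_Irr_power)
  then show "x = y" using eq x by simp
next
  fix x assume "x \<in> span (set (v # vs))"
  then obtain c where c: "x - c *s v \<in> span (set vs)" by (auto simp: span_breakdown_eq)
  have "c *s v = (c div h ^ k * h ^ k + c mod h ^ k) *s v" by (simp only: div_mult_mod_eq)
  also have "\<dots> = (c div h ^ k) *s (h ^ k *s v) + (c mod h ^ k) *s v"
    by (simp add: scale_left_distrib del: div_mult_mod_eq)
  also have "h ^ k *s v = 0" using g by simp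
  finally have "x = (c mod h ^ k) *s v + (x - c *s v)" by simp
  moreover have "c mod h ^ k \<in> lowdeg (k * degree h)"
    using mod_in_lowdeg[of "h ^ k" c] h by (simp add: Irr_nonzero degree_Irr_power)
  ultimately show "x \<in> (\<lambda>(p, s). p *s v + s) ` (lowdeg (k * degree h) \<times> span (set vs))"
    using c by (intro image_eqI[of _ _ "(c mod h ^ k, x - c *s v)"]) auto
next
  fix x assume "x \<in> (\<lambda>(p, s). p *s v + s) ` (lowdeg (k * degree h) \<times> span (set vs))"
  then obtain p s where x: "x = p *s v + s" and s: "s \<in> span (set vs)" by auto
  then have "x - p *s v \<in> span (set vs)" by simp
  then show "x \<in> span (set (v # vs))" by (auto simp: span_breakdown_eq)
qed

lemma card_span_good: "good L vs \<Longrightarrow> valid_shape L \<Longrightarrow> card (span (set vs)) = CARD('a) ^ shape_degree L"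
proof (induction L vs rule: good.induct)
  case (2 h k L v vs)
  have "card (span (set (v # vs))) = card ((lowdeg (k * degree h) :: 'a poly set) \<times> span (set vs))"
    using good_Cons_bij[OF 2(2)] 2(3) by (simp add: bij_betw_same_card)
  also have "\<dots> = CARD('a) ^ shape_degree ((h, k) # L)"
    using 2 by (simp add: card_cartesian_product card_lowdeg shape_degree_Cons power_add)
  finally show ?case .
qed auto

text \<open>In the normal form of \<open>good_Cons_bij\<close>, being killed by \<open>h ^ e\<close>
  splits into a condition on \<open>p\<close> and one on \<open>s\<close>, so the cardinality is
  multiplicative along the list.\<close>

lemma card_span_ker:
  assumes "good L vs" "valid_shape L" "h \<in> Irr"
  shows "card {x \<in> span (set vs). h ^ e *s x = 0} = CARD('a) ^ (degree h * ker_len L h e)"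
  using assms
proof (induction L vs rule: good.induct)
  case 1
  have "{x \<in> {0}. h ^ e *s x = 0} = {0}" by auto
  then show ?case by simp
next
  case (2 g k L v vs)
  let ?D = "lowdeg (k * degree g) :: 'a poly set"
  \<comment> \<open>The residues modulo \<open>g ^ k\<close> killed by \<open>h ^ e\<close>: for
    \<open>g \<noteq> h\<close> only 0, since \<open>h ^ e\<close> is a unit modulo
    \<open>g ^ k\<close>. The minimum covers \<open>e \<ge> k\<close>, where for
    \<open>g = h\<close> everything is killed.\<close>
  let ?C = "{p \<in> ?D. if g = h then h ^ (k - min k e) dvd p else p = 0}"
  let ?S = "{s \<in> span (set vs). h ^ e *s s = 0}"
  let ?f = "\<lambda>(p, s). p *s v + s"
  have g: "g \<in> Irr" using 2 by simp
  have bij: "bij_betw ?f (?D \<times> span (set vs)) (span (set (v # vs)))"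
    using good_Cons_bij[OF 2(2) g] .
  have key: "h ^ e *s (p *s v + s) = 0 \<longleftrightarrow>
      (if g = h then h ^ (k - min k e) dvd p else p = 0) \<and> h ^ e *s s = 0"
    if p: "p \<in> ?D" and s: "s \<in> span (set vs)" for p s
  proof -
    have *: "(if g = h then h ^ (k - min k e) dvd p else p = 0) \<longleftrightarrow> g ^ k dvd h ^ e * p"
    proof (cases "g = h")
      case True
      show ?thesis
      proof (cases "k \<le> e")
        case True
        then have "g ^ k dvd h ^ e * p" using \<open>g = h\<close> by (simp add: le_imp_power_dvd)
        then show ?thesis using True \<open>g = h\<close> by simp
      next
        case False
        then have "h ^ k = h ^ e * h ^ (k - e)" by (simp flip: power_add)
        then show ?thesis using True False \<open>h \<in> Irr\<close> by (simp add: Irr_nonzero min_def)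
      qed
    next
      case False
      have "\<not> g dvd h ^ e"
        using False g \<open>h \<in> Irr\<close> by (metis Irr_dvd_Irr Irr_prime_elem prime_elem_dvd_power)
      then have "g ^ k dvd h ^ e * p \<Longrightarrow> g ^ k dvd p"
        using prime_power_dvd_multD[OF Irr_prime_elem[OF g], of k "h ^ e" p] 2 by auto
      then show ?thesis
        using False p lowdeg_dvd_imp_zero[of p "g ^ k"] g by (auto simp: degree_Irr_power)
    qed
    show ?thesis unfolding *
    proof
      assume z: "h ^ e *s (p *s v + s) = 0"
      then have "(h ^ e * p) *s v = - (h ^ e *s s)"
        by (simp add: scale_right_distrib add_eq_0_iff2)
      then have "(h ^ e * p) *s v \<in> span (set vs)" using s by (simp add: span_neg span_scale)
      then have d: "g ^ k dvd h ^ e * p" using good_Cons_dvd[OF 2(2) g] by blast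
      then have "(h ^ e * p) *s v = 0" using scale_eq_0_if_dvd[of "g ^ k" v] 2(2) by simp
      then show "g ^ k dvd h ^ e * p \<and> h ^ e *s s = 0"
        using d z by (simp add: scale_right_distrib)
    next
      assume z: "g ^ k dvd h ^ e * p \<and> h ^ e *s s = 0"
      then have "(h ^ e * p) *s v = 0" using scale_eq_0_if_dvd[of "g ^ k" v] 2(2) by simp
      then show "h ^ e *s (p *s v + s) = 0" using z by (simp add: scale_right_distrib)
    qed
  qed
  have "bij_betw ?f (?C \<times> ?S) {x \<in> span (set (v # vs)). h ^ e *s x = 0}"
  proof (rule bij_betw_subset[OF bij])
    show "?f ` (?C \<times> ?S) = {x \<in> span (set (v # vs)). h ^ e *s x = 0}"
    proof (intro equalityI subsetI)
      fix x assume "x \<in> ?f ` (?C \<times> ?S)"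
      then obtain p s where ps: "p \<in> ?C" "s \<in> ?S" "x = p *s v + s" by auto
      then have "x \<in> span (set (v # vs))"
        using bij_betw_imp_surj_on[OF bij] by (auto simp: image_iff)
      then show "x \<in> {x \<in> span (set (v # vs)). h ^ e *s x = 0}" using ps key by auto
    next
      fix x assume x: "x \<in> {x \<in> span (set (v # vs)). h ^ e *s x = 0}"
      then have "x \<in> ?f ` (?D \<times> span (set vs))" using bij_betw_imp_surj_on[OF bij] by simp
      then obtain p s where "p \<in> ?D" "s \<in> span (set vs)" "x = p *s v + s" by auto
      then show "x \<in> ?f ` (?C \<times> ?S)" using x key by (intro image_eqI[of _ _ "(p, s)"]) auto
    qed
  qed auto
  then have "card {x \<in> span (set (v # vs)). h ^ e *s x = 0} = card ?C * card ?S"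
    by (simp add: bij_betw_same_card[symmetric] card_cartesian_product)
  moreover have "card ?C = CARD('a) ^ (degree h * (if g = h then min k e else 0))"
  proof (cases "g = h")
    case True
    have "k - min k e + min k e = k" by simp
    with card_lowdeg_multiples[OF \<open>h \<in> Irr\<close>, of "k - min k e" "min k e"] show ?thesis
      using True by (simp add: mult.commute)
  next
    case False
    then have "?C = {0}" by auto
    then show ?thesis using False by simp
  qed
  ultimately show ?case
    using 2 by (simp add: ker_len_Cons power_add distrib_left)
qed auto

text \<open>In F[t]/(h ^ m) the elements killed by \<open>h\<close> are the multiples of
  \<open>h ^ (m - 1)\<close>, hence of \<open>h ^ (k - 1)\<close> once \<open>k \<le> m\<close>;
  summands for other irreducible polynomials contain no such element except 0. Here the order of the
  exponents enters: a new exponent must not exceed the earlier ones.\<close>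

lemma socle_divisible:
  assumes "good L vs" "valid_shape L" "h \<in> Irr" "\<And>j. (h, j) \<in> set L \<Longrightarrow> k \<le> j" "1 \<le> k"
    "x \<in> span (set vs)" "h *s x = 0"
  shows "\<exists>y\<in>span (set vs). h ^ (k - 1) *s y = x"
  using assms
proof (induction L vs arbitrary: x rule: good.induct)
  case 1
  then show ?case by auto
next
  case (2 g m L v vs)
  have g: "g \<in> Irr" using 2 by simp
  obtain p s where ps: "p \<in> lowdeg (m * degree g)" "s \<in> span (set vs)" "x = p *s v + s"
    using 2(7) unfolding bij_betw_imp_surj_on[OF good_Cons_bij[OF 2(2) g], symmetric] by auto
  have "(h * p) *s v = - (h *s s)" using 2(8) ps(3) by (simp add: scale_right_distrib add_eq_0_iff2)
  then have "(h * p) *s v \<in> span (set vs)" using ps(2) by (simp add: span_neg span_scale)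
  then have d: "g ^ m dvd h * p" using good_Cons_dvd[OF 2(2) g] by blast
  then have "(h * p) *s v = 0" using scale_eq_0_if_dvd[of "g ^ m" v] 2(2) by simp
  then have "h *s s = 0" using 2(8) ps(3) by (simp add: scale_right_distrib)
  then obtain y where y: "y \<in> span (set vs)" "h ^ (k - 1) *s y = s"
    using 2 ps(2) by (metis good.simps(2) list.set_intros(2) valid_shape.simps(2))
  have sub: "span (set vs) \<subseteq> span (set (v # vs))" by (rule span_mono) auto
  obtain r where r: "p = h ^ (k - 1) * r"
  proof (cases "g = h")
    case True
    have "k \<le> m" using 2(5) True by simp
    have "h * h ^ (m - 1) dvd h * p" using d True 2(3) power_eq_mult_pred[of m h] by simp
    then have "h ^ (m - 1) dvd p" using \<open>h \<in> Irr\<close> by (simp add: Irr_nonzero)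
    then have "h ^ (k - 1) dvd p" using \<open>k \<le> m\<close> by (meson diff_le_mono dvd_trans le_imp_power_dvd)
    then show ?thesis using that by auto
  next
    case False
    have "\<not> g dvd h" using False g \<open>h \<in> Irr\<close> Irr_dvd_Irr by blast
    then have "g ^ m dvd p"
      using prime_power_dvd_multD[OF Irr_prime_elem[OF g] d] 2(3) by auto
    then have "p = 0" using lowdeg_dvd_imp_zero[of p "g ^ m"] ps(1) g by (simp add: degree_Irr_power)
    then show ?thesis using that[of 0] by simp
  qed
  have "h ^ (k - 1) *s (r *s v + y) = x" using r y ps(3) by (simp add: scale_right_distrib)
  moreover have "r *s v + y \<in> span (set (v # vs))"
    using span_add[OF span_scale[OF span_base] subsetD[OF sub y(1)], of v r] by simp
  ultimately show ?case by blast
qed auto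

text \<open>The vectors to discard are those with \<open>h ^ (k - 1) *s v\<close> in
  \<open>S\<close>. On them \<open>h ^ (k - 1)\<close> maps onto the \<open>h\<close>-socle of
  \<open>S\<close>, by \<open>div\<close>, and each fibre is a coset of
  \<open>ker h (k - 1)\<close>.\<close>

lemma card_extensions:
  assumes S: "subspace S" "S \<subseteq> V" and k: "1 \<le> k"
    and div: "\<And>x. x \<in> S \<Longrightarrow> h *s x = 0 \<Longrightarrow> \<exists>y\<in>S. h ^ (k - 1) *s y = x"
  shows "card {v \<in> ker h k. h ^ (k - 1) *s v \<notin> S} =
    card (ker h k) - card {x \<in> S. h *s x = 0} * card (ker h (k - 1))"
proof -
  let ?B = "{v \<in> ker h k. h ^ (k - 1) *s v \<in> S}" and ?T = "{x \<in> S. h *s x = 0}"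
  have fin: "finite (ker h j)" for j by (simp add: ker_def finite_V)
  have hk: "h ^ k = h * h ^ (k - 1)" using k by (rule power_eq_mult_pred)
  \<comment> \<open>An arbitrary section of \<open>h ^ (k - 1)\<close> over the socle. It need not
    be additive, since only a bijection of sets is wanted.\<close>
  define y where "y = (\<lambda>x. SOME y. y \<in> S \<and> h ^ (k - 1) *s y = x)"
  have y: "y x \<in> S" "h ^ (k - 1) *s y x = x" if "x \<in> ?T" for x
    using someI_ex[of "\<lambda>y. y \<in> S \<and> h ^ (k - 1) *s y = x"] div[of x] that unfolding y_def by auto
  have "bij_betw (\<lambda>(x, w). y x + w) (?T \<times> ker h (k - 1)) ?B"
    unfolding bij_betw_def
  proof (intro conjI inj_onI equalityI subsetI)
    fix a b assume "a \<in> ?T \<times> ker h (k - 1)" "b \<in> ?T \<times> ker h (k - 1)"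
      and eq: "(case a of (x, w) \<Rightarrow> y x + w) = (case b of (x, w) \<Rightarrow> y x + w)"
    then obtain x w x' w' where ab: "a = (x, w)" "b = (x', w')" "x \<in> ?T" "x' \<in> ?T"
      "w \<in> ker h (k - 1)" "w' \<in> ker h (k - 1)" by blast
    then have "h ^ (k - 1) *s (y x + w) = x" "h ^ (k - 1) *s (y x' + w') = x'"
      using y by (simp_all add: scale_right_distrib ker_def)
    then show "a = b" using eq ab by auto
  next
    fix v assume "v \<in> (\<lambda>(x, w). y x + w) ` (?T \<times> ker h (k - 1))"
    then obtain x w where xw: "x \<in> ?T" "w \<in> ker h (k - 1)" "v = y x + w" by auto
    have "h ^ (k - 1) *s v = x" using xw y by (simp add: scale_right_distrib ker_def)
    moreover from this have "h ^ k *s v = 0" using xw(1) by (metis (mono_tags, lifting) hk mem_Collect_eq scale_scale)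
    moreover have "v \<in> V" using xw y(1)[of x] S subspace_V by (auto simp: ker_def subspace_add)
    ultimately show "v \<in> ?B" using xw by (auto simp: ker_def)
  next
    fix v assume v: "v \<in> ?B"
    define x where "x = h ^ (k - 1) *s v"
    have x: "x \<in> ?T" using v by (simp add: x_def ker_def hk)
    have "h ^ (k - 1) *s (v - y x) = 0" using y(2)[OF x] by (simp add: scale_right_diff_distrib x_def)
    then have "v - y x \<in> ker h (k - 1)"
      using v y(1)[OF x] S subspace_V by (auto simp: ker_def subspace_diff)
    then show "v \<in> (\<lambda>(x, w). y x + w) ` (?T \<times> ker h (k - 1))"
      using x by (intro image_eqI[of _ _ "(x, v - y x)"]) auto
  qed
  then have B: "card ?B = card ?T * card (ker h (k - 1))"
    by (simp add: bij_betw_same_card[symmetric] card_cartesian_product)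
  have "{v \<in> ker h k. h ^ (k - 1) *s v \<notin> S} = ker h k - ?B" by auto
  then show ?thesis using fin B by (simp add: card_Diff_subset)
qed

text \<open>For a fixed shape every tail admits the same number of heads, by
  \<open>card_extensions\<close> and \<open>card_span_ker\<close>; so the sum over tails becomes a
  product.\<close>

lemma card_good:
  "valid_shape L \<Longrightarrow> finite {vs. good L vs} \<and>
    card {vs. good L vs} = family_count (\<lambda>h k. card (ker h k)) L"
proof (induction L)
  case Nil
  have "{vs. good [] vs} = {[]}" by (auto elim: good.elims)
  then show ?case by simp
next
  case (Cons hk L)
  obtain h k where hk: "hk = (h, k)" by force
  have h: "h \<in> Irr" and k: "1 \<le> k" and L: "valid_shape L"
    and le: "\<And>j. (h, j) \<in> set L \<Longrightarrow> k \<le> j"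
    using Cons.prems hk by auto
  let ?E = "\<lambda>vs. {v \<in> ker h k. h ^ (k - 1) *s v \<notin> span (set vs)}"
  have eq: "{ws. good (hk # L) ws} = (\<lambda>(vs, v). v # vs) ` (SIGMA vs:{vs. good L vs}. ?E vs)"
    unfolding hk by (force simp: ker_def elim!: good_ConsE)
  have cardE: "card (?E vs) = card (ker h k) - CARD('a) ^ (degree h * ker_len L h 1) * card (ker h (k - 1))"
    if "good L vs" for vs
    using card_extensions[OF subspace_span good_span_subset[OF that] k, of h]
      socle_divisible[OF that L h le k] card_span_ker[OF that L h, of 1] by simp
  have finE: "finite (?E vs)" for vs by (simp add: ker_def finite_V)
  have "inj_on (\<lambda>(vs, v). v # vs) (SIGMA vs:{vs. good L vs}. ?E vs)" by (auto simp: inj_on_def)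
  then have "card {ws. good (hk # L) ws} = (\<Sum>vs\<in>{vs. good L vs}. card (?E vs))"
    unfolding eq using Cons L finE by (simp add: card_image card_SigmaI)
  also have "\<dots> = family_count (\<lambda>h k. card (ker h k)) (hk # L)"
    using Cons.IH L cardE by (simp add: hk)
  finally show ?case unfolding eq using Cons L finE by simp
qed

text \<open>Multiplication by \<open>m\<close> removes the part of a relation that comes from
  \<open>vs'\<close>. The remaining relation for \<open>vs\<close> makes \<open>h ^ k\<close> divide
  \<open>m * h ^ (k - 1)\<close>, against \<open>\<not> h dvd m\<close>.\<close>

lemma good_append:
  assumes "good L vs" "valid_shape L" "good L' vs'"
    and "\<And>x. x \<in> span (set vs') \<Longrightarrow> m *s x = 0" "\<And>h k. (h, k) \<in> set L \<Longrightarrow> \<not> h dvd m"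
  shows "good (L @ L') (vs @ vs')"
  using assms
proof (induction L vs rule: good.induct)
  case (2 h k L v vs)
  have "h ^ (k - 1) *s v \<notin> span (set vs \<union> set vs')"
  proof
    assume "h ^ (k - 1) *s v \<in> span (set vs \<union> set vs')"
    then obtain s s' where s: "h ^ (k - 1) *s v = s + s'" "s \<in> span (set vs)" "s' \<in> span (set vs')"
      by (auto simp: span_Un)
    have "(m * h ^ (k - 1)) *s v = m *s s + m *s s'"
      by (metis s(1) scale_right_distrib scale_scale)
    then have "(m * h ^ (k - 1)) *s v \<in> span (set vs)" using 2(5) s by (simp add: span_scale)
    then have "h ^ k dvd m * h ^ (k - 1)" using good_Cons_dvd[OF 2(2)] 2(3) by auto
    then have "h * h ^ (k - 1) dvd m * h ^ (k - 1)" using 2(3) power_eq_mult_pred[of k h] by simp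
    then have "h dvd m" using 2(3) by (simp add: Irr_nonzero)
    then show False using 2(6) by auto
  qed
  with 2 show ?case by auto
qed auto

text \<open>Greedy construction: families with exponents above \<open>k\<close> are extended by as many summands
  of exponent \<open>k\<close> as possible, after which every element of order \<open>h ^ k\<close> is congruent to a
  generated one modulo the kernel of \<open>h ^ (k - 1)\<close>.\<close>

lemma primary_good_exists_above:
  assumes h: "h \<in> Irr" and M: "subspace M" "M \<subseteq> V" "\<And>x. x \<in> M \<Longrightarrow> h ^ N *s x = 0" and k: "k \<le> N"
  shows "\<exists>\<mu> vs. sorted \<mu> \<and> (\<forall>j\<in>set \<mu>. k < j) \<and> good (map (Pair h) \<mu>) vs \<and> set vs \<subseteq> M \<and>
    (\<forall>j>k. \<forall>x\<in>M. h ^ j *s x = 0 \<longrightarrow> (\<exists>y\<in>span (set vs). h ^ (j - 1) *s (x - y) = 0))"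
  using k
proof (induction rule: inc_induct)
  case base
  \<comment> \<open>The empty family serves with \<open>y = 0\<close>: for \<open>j > N\<close>
    already \<open>h ^ (j - 1)\<close> kills \<open>M\<close>.\<close>
  have "h ^ (j - 1) *s (x - 0) = 0" if "N < j" "x \<in> M" for j x
  proof -
    have "h ^ (j - 1) = h ^ (j - 1 - N) * h ^ N" using that by (simp flip: power_add)
    then show ?thesis using M(3)[OF that(2)] by (metis diff_zero scale_scale scale_zero_right)
  qed
  then show ?case by (intro exI[of _ "[]"]) (auto intro: span_zero)
next
  case (step k)
  define P where "P vs \<longleftrightarrow> (\<exists>\<mu>. sorted \<mu> \<and> (\<forall>j\<in>set \<mu>. k < j) \<and> good (map (Pair h) \<mu>) vs \<and> set vs \<subseteq> M \<and>
    (\<forall>j>Suc k. \<forall>x\<in>M. h ^ j *s x = 0 \<longrightarrow> (\<exists>y\<in>span (set vs). h ^ (j - 1) *s (x - y) = 0)))" for vs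
  from step.IH obtain \<mu>0 vs0 where "sorted \<mu>0 \<and> (\<forall>j\<in>set \<mu>0. Suc k < j) \<and> good (map (Pair h) \<mu>0) vs0 \<and>
    set vs0 \<subseteq> M \<and> (\<forall>j>Suc k. \<forall>x\<in>M. h ^ j *s x = 0 \<longrightarrow> (\<exists>y\<in>span (set vs0). h ^ (j - 1) *s (x - y) = 0))"
    by blast
  then have "P vs0" unfolding P_def by (intro exI[of _ \<mu>0]) auto
  \<comment> \<open>Members of a good family are distinct elements of the finite set
    \<open>V\<close>, so a longest family exists; a vector violating \<open>top\<close> could be
    prepended to it with exponent \<open>Suc k\<close>.\<close>
  moreover have "\<forall>vs. P vs \<longrightarrow> length vs < Suc (card V)"
    unfolding P_def by (metis card_mono distinct_card finite_V good_distinct good_subset less_Suc_eq_le)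
  ultimately obtain vs where vs: "P vs" and max: "\<And>ws. P ws \<Longrightarrow> length ws \<le> length vs"
    using ex_has_greatest_nat[of P vs0 length "Suc (card V)"] by blast
  from vs obtain \<mu> where \<mu>: "sorted \<mu>" "\<forall>j\<in>set \<mu>. k < j" "good (map (Pair h) \<mu>) vs" "set vs \<subseteq> M"
    and above: "\<forall>j>Suc k. \<forall>x\<in>M. h ^ j *s x = 0 \<longrightarrow> (\<exists>y\<in>span (set vs). h ^ (j - 1) *s (x - y) = 0)"
    unfolding P_def by blast
  have valid: "valid_shape (map (Pair h) \<mu>)"
    using \<mu>(1,2) h by (induction \<mu>) auto
  have top: "\<exists>y\<in>span (set vs). h ^ k *s (x - y) = 0" if x: "x \<in> M" "h ^ Suc k *s x = 0" for x
  proof -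
    have "h ^ k *s x \<in> span (set vs)"
    proof (rule ccontr)
      assume n: "h ^ k *s x \<notin> span (set vs)"
      have sub: "span (set vs) \<subseteq> span (set (x # vs))" by (rule span_mono) auto
      have "P (x # vs)"
        unfolding P_def
      proof (intro exI[of _ "Suc k # \<mu>"] conjI)
        show "good (map (Pair h) (Suc k # \<mu>)) (x # vs)" using \<mu> x n M(2) by auto
        show "\<forall>j>Suc k. \<forall>z\<in>M. h ^ j *s z = 0 \<longrightarrow> (\<exists>y\<in>span (set (x # vs)). h ^ (j - 1) *s (z - y) = 0)"
          using above sub by blast
      qed (use \<mu> x in \<open>auto simp: Suc_le_eq\<close>)
      then show False using max[of "x # vs"] by simp
    qed
    moreover have "h *s (h ^ k *s x) = 0" using x by simp
    ultimately obtain y where "y \<in> span (set vs)" "h ^ k *s y = h ^ k *s x"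
      using socle_divisible[OF \<mu>(3) valid h, of "Suc k" "h ^ k *s x"] \<mu>(2) by (auto simp: Suc_le_eq)
    then show ?thesis by (intro bexI[of _ y]) (simp_all add: scale_right_diff_distrib)
  qed
  have "\<exists>y\<in>span (set vs). h ^ (j - 1) *s (x - y) = 0" if "k < j" "x \<in> M" "h ^ j *s x = 0" for j x
    using that above top by (cases "j = Suc k") auto
  with \<mu> show ?case by blast
qed

text \<open>Descent on the order of \<open>x\<close>: subtracting a suitable generated element
  lowers the exponent \<open>j\<close> with \<open>h ^ j *s x = 0\<close>, until 0 is
  reached.\<close>

lemma primary_good_exists:
  assumes h: "h \<in> Irr" and M: "subspace M" "M \<subseteq> V" "\<And>x. x \<in> M \<Longrightarrow> h ^ N *s x = 0"
  obtains \<mu> vs where "sorted \<mu>" "\<forall>j\<in>set \<mu>. 1 \<le> j" "good (map (Pair h) \<mu>) vs" "span (set vs) = M"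
proof -
  obtain \<mu> vs where \<mu>: "sorted \<mu>" "\<forall>j\<in>set \<mu>. 0 < j" "good (map (Pair h) \<mu>) vs" "set vs \<subseteq> M"
    and above: "\<And>j x. 0 < j \<Longrightarrow> x \<in> M \<Longrightarrow> h ^ j *s x = 0 \<Longrightarrow>
      (\<exists>y\<in>span (set vs). h ^ (j - 1) *s (x - y) = 0)"
    using primary_good_exists_above[OF assms, of 0] by auto
  have sub: "span (set vs) \<subseteq> M" using \<mu>(4) M(1) by (rule span_minimal)
  have "x \<in> span (set vs)" if "x \<in> M" "h ^ j *s x = 0" for j x
    using that
  proof (induction j arbitrary: x)
    case 0
    then show ?case by (simp add: span_zero)
  next
    case (Suc j)
    then obtain y where y: "y \<in> span (set vs)" "h ^ j *s (x - y) = 0" using above[of "Suc j" x] by auto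
    then have "x - y \<in> span (set vs)" using Suc sub M(1) by (auto intro: subspace_diff)
    then show ?case using y(1) by (metis diff_add_cancel span_add)
  qed
  then have "span (set vs) = M" using sub M(3) by auto
  then show ?thesis using \<mu> by (intro that[of \<mu> vs]) auto
qed

end

section \<open>Families generating the whole module, and their transport\<close>

context finite_poly_module
begin

lemma good_full:
  assumes "good L vs" "valid_shape L" "card V = CARD('a) ^ shape_degree L"
  shows "span (set vs) = V"
  using card_span_good[OF assms(1,2)] assms(3) good_span_subset[OF assms(1)]
  by (intro card_subset_eq[OF finite_V]) auto

lemma card_ker_full:
  assumes "good L vs" "valid_shape L" "span (set vs) = V" "h \<in> Irr"
  shows "card (ker h k) = CARD('a) ^ (degree h * ker_len L h k)"
  using card_span_ker[OF assms(1,2,4), of k] assms(3) by (simp add: ker_def)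

end

text \<open>Spans map onto spans, so injectivity on \<open>V1\<close> carries the nonmembership
  over. This serves both for embedding a block into a block matrix and for conjugation.\<close>

lemma good_hom:
  fixes s1 :: "'a::{field,finite} poly \<Rightarrow> 'b::ab_group_add \<Rightarrow> 'b"
    and s2 :: "'a poly \<Rightarrow> 'c::ab_group_add \<Rightarrow> 'c"
  assumes "finite_poly_module s1 V1" "finite_poly_module s2 V2"
    and "Modules.module_hom s1 s2 f" and inj: "inj_on f V1" and im: "f ` V1 \<subseteq> V2"
    and good: "finite_poly_module.good s1 V1 L vs"
  shows "finite_poly_module.good s2 V2 L (map f vs)"
proof -
  interpret A: finite_poly_module s1 V1 by fact
  interpret B: finite_poly_module s2 V2 by fact
  interpret Modules.module_hom s1 s2 f by fact
  show ?thesis using good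
  proof (induction L vs rule: A.good.induct)
    case (2 h k L v vs)
    have v: "v \<in> V1" using 2(2) by simp
    have "s2 (h ^ (k - 1)) (f v) \<notin> B.span (set (map f vs))"
    proof
      assume "s2 (h ^ (k - 1)) (f v) \<in> B.span (set (map f vs))"
      then have "f (s1 (h ^ (k - 1)) v) \<in> f ` A.span (set vs)"
        by (simp add: span_image scale)
      then obtain y where y: "y \<in> A.span (set vs)" "f (s1 (h ^ (k - 1)) v) = f y" by auto
      moreover have "y \<in> V1" using y 2(2) A.good_span_subset by auto
      moreover have "s1 (h ^ (k - 1)) v \<in> V1" using v A.subspace_V A.subspace_scale by blast
      ultimately have "s1 (h ^ (k - 1)) v \<in> A.span (set vs)" using inj by (auto dest: inj_onD)
      then show False using 2(2) by simp
    qed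
    moreover have "s2 (h ^ k) (f v) = 0" using 2(2) by (simp add: scale[symmetric] zero)
    ultimately show ?case using 2 im by auto
  qed auto
qed

text \<open>The isomorphism is obtained as the submodule of the product generated by the pairs of
  corresponding vectors: by counting, this submodule is the graph of a bijection.\<close>

lemma good_iso:
  fixes s1 :: "'a::{field,finite} poly \<Rightarrow> 'b::ab_group_add \<Rightarrow> 'b"
    and s2 :: "'a poly \<Rightarrow> 'c::ab_group_add \<Rightarrow> 'c"
  assumes "finite_poly_module s1 V1" "finite_poly_module s2 V2" and L: "valid_shape L"
    and g1: "finite_poly_module.good s1 V1 L ws" and g2: "finite_poly_module.good s2 V2 L vs"
  obtains f where "bij_betw f (Modules.module.span s1 (set ws)) (Modules.module.span s2 (set vs))"
    "\<And>x y. x \<in> Modules.module.span s1 (set ws) \<Longrightarrow> y \<in> Modules.module.span s1 (set ws) \<Longrightarrow>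
       f (x + y) = f x + f y"
    "\<And>p x. x \<in> Modules.module.span s1 (set ws) \<Longrightarrow> f (s1 p x) = s2 p (f x)"
    "map f ws = vs"
proof -
  interpret A: finite_poly_module s1 V1 by fact
  interpret B: finite_poly_module s2 V2 by fact
  define s where "s = (\<lambda>p (z :: 'b \<times> 'c). (s1 p (fst z), s2 p (snd z)))"
  interpret M: Modules.module s
    by unfold_locales
      (auto simp: s_def A.scale_right_distrib A.scale_left_distrib B.scale_right_distrib B.scale_left_distrib)
  have "M.subspace (V1 \<times> V2)"
    using A.subspace_V B.subspace_V
    unfolding M.subspace_def by (auto simp: A.subspace_def B.subspace_def s_def zero_prod_def)
  then interpret C: finite_poly_module s "V1 \<times> V2"
    using A.finite_V B.finite_V by unfold_locales auto
  interpret p1: Modules.module_hom s s1 fst by unfold_locales (auto simp: s_def)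
  interpret p2: Modules.module_hom s s2 snd by unfold_locales (auto simp: s_def)
  have len: "length ws = length vs" using A.good_length[OF g1] B.good_length[OF g2] by simp
  have good: "C.good L (zip ws vs)"
    using g1 g2 L
  proof (induction L ws arbitrary: vs rule: A.good.induct)
    case (2 h k L w ws)
    then obtain v vs' where vs: "vs = v # vs'" by (cases vs) auto
    have len: "length ws = length vs'"
      using A.good_length[of L ws] B.good_length[of L vs'] 2 vs by simp
    have "s (h ^ (k - 1)) (w, v) \<notin> M.span (set (zip ws vs'))"
    proof
      assume "s (h ^ (k - 1)) (w, v) \<in> M.span (set (zip ws vs'))"
      then have "fst (s (h ^ (k - 1)) (w, v)) \<in> fst ` M.span (set (zip ws vs'))" by (rule imageI)
      then have "s1 (h ^ (k - 1)) w \<in> A.span (fst ` set (zip ws vs'))"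
        by (simp add: p1.span_image[symmetric]) (simp add: s_def)
      then show False using 2(2) len by (simp flip: set_map)
    qed
    moreover have "s (h ^ k) (w, v) = 0" using 2 vs by (simp add: s_def zero_prod_def)
    ultimately show ?case using 2 vs by auto
  qed auto
  let ?G = "M.span (set (zip ws vs))"
  have G1: "fst ` ?G = A.span (set ws)" and G2: "snd ` ?G = B.span (set vs)"
    using len by (simp_all add: p1.span_image[symmetric] p2.span_image[symmetric] flip: set_map)
  have finG: "finite ?G" using finite_subset[OF C.good_span_subset[OF good] C.finite_V] .
  have inj1: "inj_on fst ?G"
    using C.card_span_good[OF good L] A.card_span_good[OF g1 L] G1 finG by (intro eq_card_imp_inj_on) auto
  have inj2: "inj_on snd ?G"
    using C.card_span_good[OF good L] B.card_span_good[OF g2 L] G2 finG by (intro eq_card_imp_inj_on) auto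
  define f where "f = snd \<circ> inv_into ?G fst"
  have f: "f x = y" if "(x, y) \<in> ?G" for x y
    using inv_into_f_f[OF inj1 that] by (simp add: f_def)
  have ex: "(x, f x) \<in> ?G" if "x \<in> A.span (set ws)" for x
    using that f unfolding G1[symmetric] by auto
  have "bij_betw (inv_into ?G fst) (A.span (set ws)) ?G"
    using inj1 G1 by (intro bij_betw_inv_into) (simp add: bij_betw_def)
  moreover have "bij_betw snd ?G (B.span (set vs))" using inj2 G2 by (simp add: bij_betw_def)
  ultimately have bij: "bij_betw f (A.span (set ws)) (B.span (set vs))"
    unfolding f_def by (rule bij_betw_trans)
  show thesis
  proof (rule that[OF bij])
    show "f (x + y) = f x + f y" if "x \<in> A.span (set ws)" "y \<in> A.span (set ws)" for x y
      using M.span_add[OF ex[OF that(1)] ex[OF that(2)]] by (intro f) simp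
    show "f (s1 p x) = s2 p (f x)" if "x \<in> A.span (set ws)" for p x
      using M.span_scale[OF ex[OF that], of p] by (intro f) (simp add: s_def)
    show "map f ws = vs"
    proof (rule nth_equalityI)
      fix i assume "i < length (map f ws)"
      then have "(ws ! i, vs ! i) \<in> set (zip ws vs)" using len by (auto simp: set_zip)
      then show "map f ws ! i = vs ! i" using f[OF M.span_base] \<open>i < length (map f ws)\<close> by simp
    qed (use len in simp)
  qed
qed

subsection \<open>Partitions and types\<close>

text \<open>The sum of the first \<open>k\<close> parts of the conjugate partition.\<close>

definition conj_sum :: "nat list \<Rightarrow> nat \<Rightarrow> nat" where
  "conj_sum \<mu> k = (\<Sum>j\<leftarrow>\<mu>. min j k)"

text \<open>First differences of \<open>conj_sum\<close> count the parts larger than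
  \<open>k\<close>; second differences then give the multiplicity of each part.\<close>

lemma partition_eqI:
  assumes \<mu>: "\<mu> \<in> partitions" and \<nu>: "\<nu> \<in> partitions" and eq: "\<And>k. conj_sum \<mu> k = conj_sum \<nu> k"
  shows "\<mu> = \<nu>"
proof -
  have "conj_sum \<nu>' (Suc k) = conj_sum \<nu>' k + length (filter ((<) k) \<nu>')" for \<nu>' k
    by (induction \<nu>') (auto simp: conj_sum_def)
  then have len: "length (filter ((<) k) \<mu>) = length (filter ((<) k) \<nu>)" for k
    using eq[of k] eq[of "Suc k"] by simp
  have cnt: "length (filter ((<) k) \<nu>') = count (mset \<nu>') (Suc k) + length (filter ((<) (Suc k)) \<nu>')" for \<nu>' k
    by (induction \<nu>') auto
  have "count (mset \<mu>) (Suc k) = count (mset \<nu>) (Suc k)" for k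
    using len[of k] len[of "Suc k"] cnt[where k = k and \<nu>' = \<mu>] cnt[where k = k and \<nu>' = \<nu>]
    by linarith
  moreover have "count (mset \<nu>') 0 = 0" if "\<nu>' \<in> partitions" for \<nu>'
    using that by (auto simp: partitions_def count_eq_zero_iff)
  ultimately have "mset \<mu> = mset \<nu>"
    using \<mu> \<nu> by (intro multiset_eqI) (metis not0_implies_Suc)
  then have "mset (rev \<mu>) = mset (rev \<nu>)" by simp
  moreover have "sorted (rev \<nu>')" if "\<nu>' \<in> partitions" for \<nu>'
    using that by (simp add: partitions_def sorted_wrt_rev)
  ultimately have "rev \<mu> = rev \<nu>" using \<mu> \<nu> by (metis properties_for_sort)
  then show ?thesis by simp
qed

lemma rev_sorted_in_partitions:
  "sorted \<mu> \<Longrightarrow> \<forall>j\<in>set \<mu>. 1 \<le> j \<Longrightarrow> rev \<mu> \<in> partitions"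
  by (simp add: partitions_def sorted_wrt_rev)

text \<open>Partitions decrease, whereas \<open>valid_shape\<close> wants the exponents of one
  \<open>h\<close> to increase along the list; hence \<open>rev\<close>. Polynomials of empty type
  contribute nothing.\<close>

definition type_shape :: "('a poly \<Rightarrow> nat list) \<Rightarrow> 'a poly list \<Rightarrow> ('a::zero poly \<times> nat) list" where
  "type_shape \<tau> hs = concat (map (\<lambda>h. map (Pair h) (rev (\<tau> h))) hs)"

lemma type_shape_Nil [simp]: "type_shape \<tau> [] = []"
  and type_shape_Cons: "type_shape \<tau> (h # hs) = map (Pair h) (rev (\<tau> h)) @ type_shape \<tau> hs"
  by (simp_all add: type_shape_def)

lemma set_type_shape: "set (type_shape \<tau> hs) = {(h, k). h \<in> set hs \<and> k \<in> set (\<tau> h)}"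
  by (auto simp: type_shape_def)

lemma valid_shape_block:
  assumes "valid_shape L" "h \<in> Irr" "h \<notin> fst ` set L" "sorted \<mu>" "\<forall>j\<in>set \<mu>. 1 \<le> j"
  shows "valid_shape (map (Pair h) \<mu> @ L)"
  using assms(4,5)
proof (induction \<mu>)
  case (Cons k \<mu>)
  have "(h, j) \<notin> set L" for j using assms(3) by force
  with Cons assms(2) show ?case by auto
qed (use assms in simp)

lemma valid_type_shape:
  assumes "distinct hs" "set hs \<subseteq> Irr" "\<And>h. h \<in> set hs \<Longrightarrow> \<tau> h \<in> partitions"
  shows "valid_shape (type_shape \<tau> hs)"
  using assms
proof (induction hs)
  case (Cons h hs)
  have "valid_shape (map (Pair h) (rev (\<tau> h)) @ type_shape \<tau> hs)"
  proof (rule valid_shape_block)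
    show "h \<notin> fst ` set (type_shape \<tau> hs)" using Cons.prems(1) by (auto simp: set_type_shape)
    show "sorted (rev (\<tau> h))" "\<forall>j\<in>set (rev (\<tau> h)). 1 \<le> j"
      using Cons.prems(3)[of h] by (auto simp: partitions_def sorted_wrt_rev)
  qed (use Cons in auto)
  then show ?case by (simp add: type_shape_Cons)
qed simp

lemma shape_degree_block: "shape_degree (map (Pair h) \<mu>) = sum_list \<mu> * degree h"
  by (induction \<mu>) (simp_all add: shape_degree_Cons distrib_right)

lemma shape_degree_type_shape:
  "distinct hs \<Longrightarrow> shape_degree (type_shape \<tau> hs) = (\<Sum>h\<in>set hs. sum_list (\<tau> h) * degree h)"
  by (induction hs) (simp_all add: type_shape_Cons shape_degree_append shape_degree_block)

lemma ker_len_block: "ker_len (map (Pair g) \<mu>) h k = (if g = h then conj_sum \<mu> k else 0)"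
  by (induction \<mu>) (simp_all add: ker_len_Cons conj_sum_def)

lemma conj_sum_rev: "conj_sum (rev \<mu>) k = conj_sum \<mu> k"
  by (induction \<mu>) (simp_all add: conj_sum_def)

lemma ker_len_type_shape:
  "distinct hs \<Longrightarrow> ker_len (type_shape \<tau> hs) h k = (if h \<in> set hs then conj_sum (\<tau> h) k else 0)"
  by (induction hs) (auto simp: type_shape_Cons ker_len_append ker_len_block conj_sum_rev)

text \<open>This is \<open>family_count\<close> for a single irreducible polynomial:
  \<open>Q\<close> stands for \<open>CARD('a) ^ degree h\<close>, \<open>Q ^ s k\<close> for the
  size of the kernel of \<open>h ^ k\<close>, and \<open>Q ^ length ks\<close> for the size of the
  socle already generated.\<close>

fun block_count :: "nat \<Rightarrow> (nat \<Rightarrow> nat) \<Rightarrow> nat list \<Rightarrow> nat" where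
  "block_count Q s [] = 1"
| "block_count Q s (k # ks) = block_count Q s ks * (Q ^ s k - Q ^ length ks * Q ^ s (k - 1))"

text \<open>With the kernel sizes of \<open>\<mu>\<close> itself, generating families correspond to
  automorphisms. This is the order of the automorphism group of a primary module of type
  \<open>\<mu>\<close> whose residue field has \<open>Q\<close> elements.\<close>

definition aut_count :: "nat \<Rightarrow> nat list \<Rightarrow> nat" where
  "aut_count Q \<mu> = block_count Q (conj_sum \<mu>) (rev \<mu>)"

lemma family_count_block:
  fixes h :: "'a::{field,finite} poly"
  assumes "\<forall>j\<in>set ks. 1 \<le> j" "h \<notin> fst ` set L" "\<And>k. a h k = CARD('a) ^ (degree h * s k)"
  shows "family_count a (map (Pair h) ks @ L) =
    block_count (CARD('a) ^ degree h) s ks * family_count a L"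
  using assms(1)
proof (induction ks)
  case (Cons k ks)
  have "ker_len L h 1 = 0"
    using assms(2) by (induction L) (auto simp: ker_len_Cons)
  moreover have "conj_sum ks 1 = length ks" using Cons.prems by (induction ks) (auto simp: conj_sum_def)
  ultimately have "ker_len (map (Pair h) ks @ L) h 1 = length ks"
    by (simp add: ker_len_append ker_len_block)
  with Cons show ?case by (simp add: assms(3) power_mult)
qed simp

lemma family_count_type_shape:
  fixes \<tau> :: "'a::{field,finite} poly \<Rightarrow> nat list"
  assumes "distinct hs" "\<And>h. h \<in> set hs \<Longrightarrow> \<tau> h \<in> partitions"
    and "\<And>h k. h \<in> set hs \<Longrightarrow> a h k = CARD('a) ^ (degree h * conj_sum (\<tau> h) k)"
  shows "family_count a (type_shape \<tau> hs) = (\<Prod>h\<in>set hs. aut_count (CARD('a) ^ degree h) (\<tau> h))"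
  using assms
proof (induction hs)
  case (Cons h hs)
  have "family_count a (type_shape \<tau> (h # hs)) =
      block_count (CARD('a) ^ degree h) (conj_sum (\<tau> h)) (rev (\<tau> h)) * family_count a (type_shape \<tau> hs)"
    unfolding type_shape_Cons
  proof (rule family_count_block)
    show "\<forall>j\<in>set (rev (\<tau> h)). 1 \<le> j" using Cons.prems(2)[of h] by (simp add: partitions_def)
    show "h \<notin> fst ` set (type_shape \<tau> hs)" using Cons.prems(1) by (auto simp: set_type_shape)
  qed (use Cons.prems(3) in simp)
  then show ?case using Cons by (simp add: aut_count_def)
qed simp

section \<open>Primary decomposition\<close>

context finite_poly_module
begin

text \<open>The Bezout identity for \<open>h ^ N\<close> and \<open>g\<close> splits
  \<open>x\<close>: its multiple by \<open>b * g\<close> is killed by \<open>h ^ N\<close>, its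
  multiple by \<open>a * h ^ N\<close> by \<open>g\<close>.\<close>

lemma primary_decomposition:
  assumes h: "h \<in> Irr" and g: "\<not> h dvd g"
  shows "{x \<in> V. (h ^ N * g) *s x = 0} = {y + z | y z. y \<in> ker h N \<and> z \<in> {x \<in> V. g *s x = 0}}"
proof (intro equalityI subsetI)
  fix x assume x: "x \<in> {x \<in> V. (h ^ N * g) *s x = 0}"
  obtain a b where ab: "a * h ^ N + b * g = 1" by (rule bezout_Irr_power[OF h g])
  have "(h ^ N * (b * g)) *s x = 0" "(g * (a * h ^ N)) *s x = 0"
  proof -
    have "(h ^ N * g) *s x = 0" using x by simp
    moreover have "h ^ N * g dvd h ^ N * (b * g)" by (intro mult_dvd_mono) auto
    moreover have "h ^ N * g dvd g * (a * h ^ N)"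
      unfolding mult.commute[of "h ^ N" g] by (intro mult_dvd_mono) auto
    ultimately show "(h ^ N * (b * g)) *s x = 0" "(g * (a * h ^ N)) *s x = 0"
      using scale_eq_0_if_dvd by blast+
  qed
  moreover have "x = (b * g) *s x + (a * h ^ N) *s x"
    by (metis ab add.commute scale_left_distrib scale_one)
  moreover have "p *s x \<in> V" for p using x subspace_V subspace_scale by auto
  ultimately show "x \<in> {y + z | y z. y \<in> ker h N \<and> z \<in> {x \<in> V. g *s x = 0}}"
    by (fastforce simp: ker_def)
next
  fix x assume "x \<in> {y + z | y z. y \<in> ker h N \<and> z \<in> {x \<in> V. g *s x = 0}}"
  then obtain y z where yz: "x = y + z" "y \<in> V" "h ^ N *s y = 0" "z \<in> V" "g *s z = 0"
    by (auto simp: ker_def)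
  then have "(h ^ N * g) *s y = 0" "(h ^ N * g) *s z = 0"
    using scale_eq_0_if_dvd[OF yz(3), of "h ^ N * g"] scale_eq_0_if_dvd[OF yz(5), of "h ^ N * g"]
    by simp_all
  then show "x \<in> {x \<in> V. (h ^ N * g) *s x = 0}"
    using yz subspace_V by (simp add: scale_right_distrib subspace_add)
qed

text \<open>The product of the powers of the later polynomials serves as \<open>m\<close> in
  \<open>good_append\<close>. The common exponent \<open>N\<close> will be the size of the
  matrix.\<close>

lemma good_type_shape:
  assumes "distinct hs" "set hs \<subseteq> Irr"
    and "\<And>h. h \<in> set hs \<Longrightarrow> \<tau> h \<in> partitions"
    and "\<And>h. h \<in> set hs \<Longrightarrow> good (map (Pair h) (rev (\<tau> h))) (vs h)"
    and "\<And>h. h \<in> set hs \<Longrightarrow> span (set (vs h)) = ker h N"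
  shows "good (type_shape \<tau> hs) (concat (map vs hs)) \<and>
    span (set (concat (map vs hs))) = {x \<in> V. (\<Prod>h\<leftarrow>hs. h ^ N) *s x = 0}"
  using assms
proof (induction hs)
  case Nil
  have "{x \<in> V. x = 0} = {0}" using subspace_V subspace_0 by auto
  then show ?case by simp
next
  case (Cons h hs)
  let ?m = "\<Prod>h\<leftarrow>hs. h ^ N" and ?ws = "concat (map vs hs)"
  have h: "h \<in> Irr" using Cons by simp
  have IH: "good (type_shape \<tau> hs) ?ws" "span (set ?ws) = {x \<in> V. ?m *s x = 0}"
    using Cons by simp_all
  have nd: "\<not> h dvd ?m"
  proof
    assume "h dvd ?m"
    then have "\<exists>g\<in>set hs. h dvd g"
      using Irr_prime_elem[OF h] Irr_degree_pos[OF h]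
      by (induction hs) (auto simp: prime_elem_dvd_mult_iff dest: prime_elem_dvd_power)
    then show False using Cons.prems(1,2) Irr_dvd_Irr[OF h] by (metis distinct.simps(2) list.set_intros(2) subsetD)
  qed
  have v: "valid_shape (map (Pair h) (rev (\<tau> h)))"
    using valid_type_shape[of "[h]" \<tau>] Cons.prems h by (simp add: type_shape_Cons)
  have "good (type_shape \<tau> (h # hs)) (vs h @ ?ws)"
    unfolding type_shape_Cons using Cons.prems(4)[of h] v IH nd
    by (intro good_append[where m = ?m]) auto
  moreover have "span (set (vs h) \<union> set ?ws) = {x \<in> V. (h ^ N * ?m) *s x = 0}"
    unfolding span_Un IH(2) primary_decomposition[OF h nd] using Cons.prems(5)[of h] by auto
  ultimately show ?case by simp
qed

end

subsection \<open>The module of a matrix\<close>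

text \<open>These rules would rewrite below eta-expanded arguments of operators on functions, where
  additivity is needed instead.\<close>

declare plus_fun_apply [simp del] zero_fun_apply [simp del]

text \<open>Vectors of length \<open>n\<close> are represented by functions on \<open>nat\<close> vanishing from \<open>n\<close> on, so that
  all sizes share one abelian group type.\<close>

definition fvecs :: "nat \<Rightarrow> (nat \<Rightarrow> 'a::zero) set" where
  "fvecs n = {f. \<forall>i\<ge>n. f i = 0}"

definition mat_op :: "'a::comm_ring_1 mat \<Rightarrow> (nat \<Rightarrow> 'a) \<Rightarrow> nat \<Rightarrow> 'a" where
  "mat_op A f = (\<lambda>i. if i < dim_row A then \<Sum>j<dim_col A. A $$ (i, j) * f j else 0)"

definition poly_act :: "'a::comm_ring_1 mat \<Rightarrow> 'a poly \<Rightarrow> (nat \<Rightarrow> 'a) \<Rightarrow> nat \<Rightarrow> 'a" where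
  "poly_act A p f = (\<lambda>i. \<Sum>k\<le>degree p. coeff p k * ((mat_op A ^^ k) f) i)"

definition unit_fun :: "nat \<Rightarrow> nat \<Rightarrow> 'a::zero_neq_one" where
  "unit_fun j = (\<lambda>i. if i = j then 1 else 0)"

definition vec_fun :: "'a::zero vec \<Rightarrow> nat \<Rightarrow> 'a" where
  "vec_fun v = (\<lambda>i. if i < dim_vec v then v $ i else 0)"

lemma sum_fun_apply: "(\<Sum>a\<in>A. f a) i = (\<Sum>a\<in>A. f a i)"
  for f :: "'c \<Rightarrow> 'd \<Rightarrow> 'e::comm_monoid_add"
  by (induction A rule: infinite_finite_induct) (auto simp: plus_fun_apply zero_fun_apply)

lemma fun_scale_add: "(\<lambda>i. c * (f + g) i) = (\<lambda>i. c * f i) + (\<lambda>i. c * g i)"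
  for c :: "'a::comm_ring_1"
  by (simp add: fun_eq_iff plus_fun_apply distrib_left)

lemma mat_op_add: "mat_op A (f + g) = mat_op A f + mat_op A g"
  by (auto simp: mat_op_def plus_fun_def distrib_left sum.distrib)

lemma mat_op_scale: "mat_op A (\<lambda>i. c * f i) = (\<lambda>i. c * mat_op A f i)"
  by (auto simp: mat_op_def sum_distrib_left mult_ac)

lemma mat_op_mult:
  assumes "A \<in> carrier_mat n m" "B \<in> carrier_mat m k"
  shows "mat_op (A * B) f = mat_op A (mat_op B f)"
proof
  fix i
  have "(\<Sum>j<k. (A * B) $$ (i, j) * f j) = (\<Sum>l<m. A $$ (i, l) * (\<Sum>j<k. B $$ (l, j) * f j))"
    if "i < n"
  proof -
    have "(\<Sum>j<k. (A * B) $$ (i, j) * f j) = (\<Sum>j<k. \<Sum>l<m. A $$ (i, l) * B $$ (l, j) * f j)"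
      using assms that
      by (intro sum.cong refl) (auto simp: scalar_prod_def sum_distrib_right atLeast0LessThan)
    also have "\<dots> = (\<Sum>l<m. \<Sum>j<k. A $$ (i, l) * B $$ (l, j) * f j)" by (rule sum.swap)
    finally show ?thesis by (simp add: sum_distrib_left mult.assoc)
  qed
  then show "mat_op (A * B) f i = mat_op A (mat_op B f) i"
    using assms by (auto simp: mat_op_def)
qed

lemma mat_op_in_fvecs: "A \<in> carrier_mat n m \<Longrightarrow> mat_op A f \<in> fvecs n"
  by (auto simp: fvecs_def mat_op_def)

lemma mat_op_one: "f \<in> fvecs n \<Longrightarrow> mat_op (1\<^sub>m n) f = f"
  by (auto simp: mat_op_def fvecs_def fun_eq_iff if_distrib[of "\<lambda>x. x * _"] cong: if_cong)

lemma mat_op_unit_fun: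
  "A \<in> carrier_mat n m \<Longrightarrow> j < m \<Longrightarrow> mat_op A (unit_fun j) = (\<lambda>i. if i < n then A $$ (i, j) else 0)"
  by (auto simp: mat_op_def unit_fun_def fun_eq_iff if_distrib cong: if_cong)

lemma mat_op_inject:
  assumes "A \<in> carrier_mat n m" "B \<in> carrier_mat n m" "\<And>f. f \<in> fvecs m \<Longrightarrow> mat_op A f = mat_op B f"
  shows "A = B"
proof (rule eq_matI)
  fix i j assume "i < dim_row B" "j < dim_col B"
  moreover have "mat_op A (unit_fun j) i = mat_op B (unit_fun j) i" if "j < m"
    using that by (subst assms(3)) (auto simp: fvecs_def unit_fun_def)
  ultimately show "A $$ (i, j) = B $$ (i, j)"
    using assms(1,2) by (auto simp: mat_op_unit_fun)
qed (use assms in auto)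

lemma unit_fun_in_fvecs: "j < n \<Longrightarrow> unit_fun j \<in> fvecs n"
  by (auto simp: unit_fun_def fvecs_def)

lemma fvecs_expand:
  fixes x :: "nat \<Rightarrow> 'a::comm_ring_1"
  assumes "x \<in> fvecs n"
  shows "x = (\<Sum>j<n. (\<lambda>i. x j * unit_fun j i))"
  using assms
  by (auto simp: fun_eq_iff sum_fun_apply unit_fun_def fvecs_def if_distrib[of "(*) _"] cong: if_cong)

lemma poly_act_altdef:
  assumes "degree p \<le> m"
  shows "poly_act A p f i = (\<Sum>k\<le>m. coeff p k * ((mat_op A ^^ k) f) i)"
  unfolding poly_act_def using assms by (intro sum.mono_neutral_left) (auto simp: coeff_eq_0)

lemma poly_act_0 [simp]: "poly_act A 0 f = 0"
  by (simp add: poly_act_def zero_fun_def)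

lemma mat_op_zero [simp]: "mat_op A 0 = 0"
  by (auto simp: mat_op_def zero_fun_def)

lemma mat_op_sum: "mat_op A (\<Sum>a\<in>S. f a) = (\<Sum>a\<in>S. mat_op A (f a))"
  by (induction S rule: infinite_finite_induct) (auto simp: mat_op_add)

text \<open>The Horner step. It turns the sum over powers into a recursion along
  \<open>pCons\<close>, which drives the inductions for the module laws.\<close>

lemma poly_act_pCons: "poly_act A (pCons a p) f = (\<lambda>i. a * f i) + mat_op A (poly_act A p f)"
proof
  fix i
  have "poly_act A (pCons a p) f i = (\<Sum>k\<le>Suc (degree p). coeff (pCons a p) k * ((mat_op A ^^ k) f) i)"
    by (rule poly_act_altdef) (simp add: degree_pCons_le)
  also have "\<dots> = a * f i + (\<Sum>k\<le>degree p. coeff p k * mat_op A ((mat_op A ^^ k) f) i)"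
    by (subst sum.atMost_Suc_shift) simp
  also have "(\<Sum>k\<le>degree p. coeff p k * mat_op A ((mat_op A ^^ k) f) i)
      = mat_op A (\<Sum>k\<le>degree p. (\<lambda>j. coeff p k * ((mat_op A ^^ k) f) j)) i"
    by (simp add: mat_op_sum mat_op_scale sum_fun_apply)
  also have "(\<Sum>k\<le>degree p. (\<lambda>j. coeff p k * ((mat_op A ^^ k) f) j)) = poly_act A p f"
    by (simp add: poly_act_def fun_eq_iff sum_fun_apply)
  finally show "poly_act A (pCons a p) f i = ((\<lambda>i. a * f i) + mat_op A (poly_act A p f)) i" by (simp add: plus_fun_apply)
qed

lemma poly_act_const: "poly_act A [:c:] f = (\<lambda>i. c * f i)"
  by (simp add: poly_act_pCons)

lemma poly_act_add_left: "poly_act A (p + q) f = poly_act A p f + poly_act A q f"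
proof
  fix i
  let ?m = "max (degree p) (degree q)"
  show "poly_act A (p + q) f i = (poly_act A p f + poly_act A q f) i"
    using poly_act_altdef[of "p + q" ?m A f i] poly_act_altdef[of p ?m A f i]
      poly_act_altdef[of q ?m A f i]
    by (simp add: degree_add_le distrib_right sum.distrib plus_fun_apply)
qed

lemma poly_act_add_right: "poly_act A p (f + g) = poly_act A p f + poly_act A p g"
  by (induction p) (simp_all add: poly_act_pCons mat_op_add fun_scale_add add_ac)

lemma poly_act_smult: "poly_act A (Polynomial.smult c p) f = (\<lambda>i. c * poly_act A p f i)"
  by (induction p) (simp_all add: poly_act_pCons mat_op_scale fun_scale_add mult.assoc zero_fun_apply zero_fun_def[symmetric])

lemma poly_act_mult: "poly_act A (p * q) f = poly_act A p (poly_act A q f)"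
  by (induction p) (simp_all add: poly_act_pCons poly_act_add_left poly_act_smult mult_pCons_left zero_fun_def[symmetric])

lemma poly_act_in_fvecs:
  assumes "A \<in> carrier_mat n n" "f \<in> fvecs n"
  shows "poly_act A p f \<in> fvecs n"
  using assms mat_op_in_fvecs[OF assms(1)]
  by (induction p) (auto simp: poly_act_pCons fvecs_def plus_fun_apply zero_fun_apply)

lemma finite_card_fvecs:
  "finite (fvecs n :: (nat \<Rightarrow> 'a::{zero,finite}) set) \<and> card (fvecs n :: (nat \<Rightarrow> 'a) set) = CARD('a) ^ n"
proof -
  have "f \<in> coeff ` lowdeg n" if "f \<in> fvecs n" for f :: "nat \<Rightarrow> 'a"
  proof
    show "f = coeff (Poly (map f [0..<n]))" "Poly (map f [0..<n]) \<in> lowdeg n"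
      using that by (auto simp: fun_eq_iff fvecs_def lowdeg_def nth_default_def)
  qed
  then have "fvecs n = (coeff :: 'a poly \<Rightarrow> _) ` lowdeg n" by (auto simp: fvecs_def lowdeg_def)
  moreover have "inj (coeff :: 'a poly \<Rightarrow> _)" by (simp add: inj_on_def coeff_inject)
  ultimately show ?thesis
    by (metis card_image card_lowdeg finite_imageI finite_lowdeg inj_on_subset subset_UNIV)
qed

locale matrix_module =
  fixes X :: "'a::{field,finite} mat" and n :: nat
  assumes X: "X \<in> carrier_mat n n"

sublocale matrix_module \<subseteq> finite_poly_module "poly_act X" "fvecs n"
proof unfold_locales
  show "poly_act X p (f + g) = poly_act X p f + poly_act X p g" for p f g
    by (rule poly_act_add_right)
  show "poly_act X (p + q) f = poly_act X p f + poly_act X q f" for p q f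
    by (rule poly_act_add_left)
  show "poly_act X p (poly_act X q f) = poly_act X (p * q) f" for p q f
    by (simp add: poly_act_mult)
  show "poly_act X 1 f = f" for f by (simp add: one_pCons poly_act_const)
  then interpret Modules.module "poly_act X"
    by unfold_locales (auto simp: poly_act_add_right poly_act_add_left poly_act_mult)
  show "finite (fvecs n :: (nat \<Rightarrow> 'a) set)" using finite_card_fvecs by blast
  show "Modules.module.subspace (poly_act X) (fvecs n)"
    unfolding subspace_def using poly_act_in_fvecs[OF X]
    by (auto simp: fvecs_def plus_fun_apply zero_fun_apply)
qed

text \<open>Linearity and compatibility with multiplication by \<open>t\<close> suffice, by
  induction along \<open>pCons\<close>. The sizes may differ, as for the inclusion of a
  block.\<close>

lemma module_hom_intertwine:
  fixes X Y :: "'a::{field,finite} mat"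
  assumes X: "X \<in> carrier_mat n n" and Y: "Y \<in> carrier_mat m m"
    and add: "\<And>f g. T (f + g) = T f + T g" and scale: "\<And>c f. T (\<lambda>i. c * f i) = (\<lambda>i. c * T f i)"
    and comm: "\<And>f. T (mat_op Y f) = mat_op X (T f)"
  shows "Modules.module_hom (poly_act Y) (poly_act X) T"
proof -
  interpret X: matrix_module X n by unfold_locales fact
  interpret Y: matrix_module Y m by unfold_locales fact
  have "T 0 = 0" using add[of 0 0] by simp
  then have "T (poly_act Y p f) = poly_act X p (T f)" for p f
    by (induction p) (simp_all add: poly_act_pCons add scale comm)
  then show ?thesis by unfold_locales (use add in auto)
qed

text \<open>Column \<open>j\<close> is the image of \<open>unit_fun j\<close>. Linearity is asked on
  \<open>fvecs m\<close> only, because an \<open>inv_into\<close> or the isomorphism from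
  \<open>good_iso\<close> is uncontrolled elsewhere.\<close>

lemma linear_fvecs_mat:
  fixes f :: "(nat \<Rightarrow> 'a::comm_ring_1) \<Rightarrow> nat \<Rightarrow> 'a"
  assumes im: "f ` fvecs m \<subseteq> fvecs n"
    and add: "\<And>x y. x \<in> fvecs m \<Longrightarrow> y \<in> fvecs m \<Longrightarrow> f (x + y) = f x + f y"
    and scale: "\<And>c x. x \<in> fvecs m \<Longrightarrow> f (\<lambda>i. c * x i) = (\<lambda>i. c * f x i)"
  obtains A where "A \<in> carrier_mat n m" "\<And>x. x \<in> fvecs m \<Longrightarrow> mat_op A x = f x"
proof -
  define A where "A = mat n m (\<lambda>(i, j). f (unit_fun j) i)"
  have A: "A \<in> carrier_mat n m" by (simp add: A_def)
  have z: "(0 :: nat \<Rightarrow> 'a) \<in> fvecs m" by (simp add: fvecs_def zero_fun_apply)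
  have f0: "f 0 = 0" using add[OF z z] by simp
  have sum: "f (\<Sum>j\<in>S. (\<lambda>i. x j * unit_fun j i)) = (\<Sum>j\<in>S. f (\<lambda>i. x j * unit_fun j i))"
    if "S \<subseteq> {..<m}" "finite S" for x S
    using that(2,1)
  proof (induction S rule: finite_induct)
    case (insert j S)
    have "(\<lambda>i. x j * unit_fun j i) \<in> fvecs m" "(\<Sum>j\<in>S. (\<lambda>i. x j * unit_fun j i)) \<in> fvecs m"
      using insert.prems by (auto simp: fvecs_def unit_fun_def sum_fun_apply intro!: sum.neutral)
    then show ?case using insert by (simp add: add)
  qed (simp add: f0)
  have "mat_op A x = f x" if x: "x \<in> fvecs m" for x
  proof
    fix i
    have e: "f (unit_fun j) \<in> fvecs n" if "j < m" for j
      using im unit_fun_in_fvecs[OF that] by auto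
    have "f x i = (\<Sum>j<m. x j * f (unit_fun j) i)"
      by (subst fvecs_expand[OF x]) (simp add: sum scale unit_fun_in_fvecs sum_fun_apply)
    also have "\<dots> = mat_op A x i"
      using e by (auto simp: mat_op_def A_def fvecs_def mult.commute)
    finally show "mat_op A x i = f x i" ..
  qed
  with A show thesis by (rule that)
qed

section \<open>Invertible matrices as bijections\<close>

lemma GL_inverse:
  assumes "g \<in> GL n"
  obtains g' where "g' \<in> carrier_mat n n" "g * g' = 1\<^sub>m n" "g' * g = 1\<^sub>m n" "g \<in> carrier_mat n n"
proof -
  from assms obtain g' where g: "g \<in> carrier_mat n n" and inv: "g * g' = 1\<^sub>m (dim_row g)" "g' * g = 1\<^sub>m (dim_row g')"
    by (auto simp: GL_def invertible_mat_def inverts_mat_def)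
  have g': "g' \<in> carrier_mat n n"
    using g inv by (metis carrier_matD carrier_matI index_mult_mat(2,3) index_one_mat(2,3))
  then show thesis using that g inv by simp
qed

lemma GL_mat_op_bij:
  assumes "g \<in> GL n"
  shows "bij_betw (mat_op g) (fvecs n) (fvecs n)"
proof -
  obtain g' where g': "g' \<in> carrier_mat n n" and inv: "g * g' = 1\<^sub>m n" "g' * g = 1\<^sub>m n"
    and g: "g \<in> carrier_mat n n"
    using GL_inverse[OF assms] .
  have "mat_op g' (mat_op g f) = f" "mat_op g (mat_op g' f) = f" if "f \<in> fvecs n" for f
    using that g g' inv by (simp_all flip: mat_op_mult[of g' n n g n] mat_op_mult[of g n n g' n] add: mat_op_one)
  then show ?thesis
    using mat_op_in_fvecs[OF g] mat_op_in_fvecs[OF g']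
    by (intro bij_betw_byWitness[where f' = "mat_op g'"]) auto
qed

lemma mat_op_bij_GL:
  fixes g :: "'a::field mat"
  assumes g: "g \<in> carrier_mat n n" and bij: "bij_betw (mat_op g) (fvecs n) (fvecs n)"
  shows "g \<in> GL n"
proof -
  let ?f = "inv_into (fvecs n) (mat_op g)"
  have inj: "inj_on (mat_op g) (fvecs n)" and surj: "mat_op g ` fvecs n = fvecs n"
    using bij by (auto simp: bij_betw_def)
  have right: "mat_op g (?f x) = x" and mem: "?f x \<in> fvecs n" if "x \<in> fvecs n" for x
    using that surj f_inv_into_f[of x "mat_op g" "fvecs n"] inv_into_into[of x "mat_op g" "fvecs n"] by auto
  have left: "?f (mat_op g x) = x" if "x \<in> fvecs n" for x using inv_into_f_f[OF inj that] .
  obtain g' where g': "g' \<in> carrier_mat n n" "\<And>x. x \<in> fvecs n \<Longrightarrow> mat_op g' x = ?f x"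
  proof (rule linear_fvecs_mat[of ?f n n])
    show "?f ` fvecs n \<subseteq> fvecs n" using mem by auto
    show "?f (x + y) = ?f x + ?f y" if "x \<in> fvecs n" "y \<in> fvecs n" for x y
    proof -
      have "?f x + ?f y \<in> fvecs n" using mem[OF that(1)] mem[OF that(2)] by (auto simp: fvecs_def plus_fun_apply)
      then have "?f (mat_op g (?f x + ?f y)) = ?f x + ?f y" by (rule left)
      then show ?thesis using that by (simp add: mat_op_add right)
    qed
    show "?f (\<lambda>i. c * x i) = (\<lambda>i. c * ?f x i)" if "x \<in> fvecs n" for c x
    proof -
      have "(\<lambda>i. c * ?f x i) \<in> fvecs n" using mem[OF that] by (auto simp: fvecs_def)
      then have "?f (mat_op g (\<lambda>i. c * ?f x i)) = (\<lambda>i. c * ?f x i)" by (rule left)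
      then show ?thesis using that by (simp add: mat_op_scale right)
    qed
  qed blast
  have "g * g' = 1\<^sub>m n" "g' * g = 1\<^sub>m n"
    using g g' mat_op_in_fvecs[OF g]
    by (auto intro!: mat_op_inject[of _ n n] simp: mat_op_mult[of _ n n _ n] mat_op_one right left)
  then show ?thesis
    using g g' by (auto simp: GL_def invertible_mat_def inverts_mat_def square_mat.simps)
qed

text \<open>With \<open>e\<^sub>i\<close> the unit vectors, \<open>\<Sum>i. (tI - X)\<^sub>i\<^sub>j e\<^sub>i = 0\<close> in the module; multiply by the
  adjugate.\<close>

lemma Cayley_Hamilton_act:
  assumes X: "X \<in> carrier_mat n n" and f: "f \<in> fvecs n"
  shows "poly_act X (char_poly X) f = 0"
proof -
  let ?M = "char_poly_matrix X"
  have M: "?M \<in> carrier_mat n n" using X by simp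
  note adj = adj_mat[OF M, folded char_poly_def]
  have additive: "poly_act X (\<Sum>a\<in>S. p a) g = (\<Sum>a\<in>S. poly_act X (p a) g)" for S g and p :: "nat \<Rightarrow> _"
    by (induction S rule: infinite_finite_induct) (auto simp: poly_act_add_left)
  have additive': "poly_act X p (\<Sum>a\<in>S. g a) = (\<Sum>a\<in>S. poly_act X p (g a))" for S p and g :: "nat \<Rightarrow> _"
  proof -
    have z: "poly_act X p 0 = 0" using poly_act_add_right[of X p 0 0] by simp
    show ?thesis by (induction S rule: infinite_finite_induct) (auto simp: poly_act_add_right z)
  qed
  have col: "(\<Sum>i<n. poly_act X (?M $$ (i, j)) (unit_fun i)) = 0" if j: "j < n" for j
  proof -
    have "poly_act X (?M $$ (i, j)) (unit_fun i) =
        (if i = j then mat_op X (unit_fun j) else 0) + (\<lambda>l. - X $$ (i, j) * unit_fun i l)" if "i < n" for i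
    proof -
      have "?M $$ (i, j) = (if i = j then [:0, 1:] else 0) + [:- X $$ (i, j):]"
        using X that j by (auto simp: char_poly_matrix_def)
      then show ?thesis by (simp add: poly_act_add_left poly_act_const poly_act_pCons zero_fun_def[symmetric])
    qed
    then have "(\<Sum>i<n. poly_act X (?M $$ (i, j)) (unit_fun i)) =
        mat_op X (unit_fun j) + (\<Sum>i<n. (\<lambda>l. - X $$ (i, j) * unit_fun i l))"
      using j by (simp add: sum.distrib)
    also have "\<dots> = 0"
      unfolding mat_op_unit_fun[OF X j] using j
      by (auto simp: fun_eq_iff sum_fun_apply unit_fun_def plus_fun_apply
          zero_fun_apply if_distrib[of "(*) _"] cong: if_cong)
    finally show ?thesis .
  qed
  have unit: "poly_act X (char_poly X) (unit_fun k) = 0" if k: "k < n" for k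
  proof -
    let ?c = "\<lambda>j. adj_mat ?M $$ (j, k)"
    have entry: "(\<Sum>j<n. ?c j * ?M $$ (i, j)) = (if i = k then char_poly X else 0)" if "i < n" for i
    proof -
      have "(?M * adj_mat ?M) $$ (i, k) = (if i = k then char_poly X else 0)"
        using that k by (simp add: adj(2))
      then show ?thesis using that k M adj(1) by (simp add: scalar_prod_def atLeast0LessThan mult.commute)
    qed
    have "poly_act X (char_poly X) (unit_fun k) =
        (\<Sum>i<n. poly_act X (if i = k then char_poly X else 0) (unit_fun i))"
      using k by (subst sum.remove[of _ k]) (auto intro!: sum.neutral)
    also have "\<dots> = (\<Sum>i<n. poly_act X (\<Sum>j<n. ?c j * ?M $$ (i, j)) (unit_fun i))"
      by (intro sum.cong) (auto simp: entry)
    also have "\<dots> = (\<Sum>j<n. \<Sum>i<n. poly_act X (?c j * ?M $$ (i, j)) (unit_fun i))"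
      by (subst sum.swap) (simp add: additive)
    also have "\<dots> = (\<Sum>j<n. poly_act X (?c j) (\<Sum>i<n. poly_act X (?M $$ (i, j)) (unit_fun i)))"
      by (simp add: additive' poly_act_mult)
    also have "\<dots> = 0" using poly_act_add_right[of X _ 0 0] by (simp add: col)
    finally show ?thesis .
  qed
  have "poly_act X (char_poly X) f = (\<Sum>j<n. poly_act X (char_poly X) (poly_act X [:f j:] (unit_fun j)))"
    by (subst fvecs_expand[OF f]) (simp add: additive' poly_act_const)
  also have "\<dots> = (\<Sum>j<n. poly_act X [:f j:] (poly_act X (char_poly X) (unit_fun j)))"
    by (simp only: poly_act_mult[symmetric] mult.commute)
  also have "\<dots> = 0" by (simp add: unit poly_act_const zero_fun_apply zero_fun_def[symmetric])
  finally show ?thesis .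
qed

section \<open>Column vectors as functions\<close>

lemma vec_fun_in_fvecs: "v \<in> carrier_vec n \<Longrightarrow> vec_fun v \<in> fvecs n"
  by (auto simp: vec_fun_def fvecs_def)

lemma vec_fun_inj: "inj_on vec_fun (carrier_vec n)"
  by (rule inj_onI, rule eq_vecI) (auto simp: vec_fun_def fun_eq_iff split: if_splits)

lemma vec_fun_vec: "f \<in> fvecs n \<Longrightarrow> vec_fun (vec n f) = f"
  by (auto simp: vec_fun_def fvecs_def)

lemma vec_fun_surj: "(vec_fun :: 'a::zero vec \<Rightarrow> _) ` carrier_vec n = fvecs n"
proof (intro equalityI subsetI)
  fix f :: "nat \<Rightarrow> 'a" assume "f \<in> fvecs n"
  then have "f = vec_fun (vec n f)" by (rule vec_fun_vec[symmetric])
  then show "f \<in> vec_fun ` carrier_vec n" by (rule image_eqI) simp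
qed (auto simp: vec_fun_in_fvecs)

lemma vec_fun_zero: "vec_fun (0\<^sub>v n) = 0"
  by (auto simp: vec_fun_def zero_fun_def)

lemma vec_fun_eq_0: "v \<in> carrier_vec n \<Longrightarrow> vec_fun v = 0 \<longleftrightarrow> v = 0\<^sub>v n"
  using inj_onD[OF vec_fun_inj, of v "0\<^sub>v n"] vec_fun_zero by fastforce

lemma vec_fun_mult_mat_vec:
  "A \<in> carrier_mat n m \<Longrightarrow> v \<in> carrier_vec m \<Longrightarrow> vec_fun (A *\<^sub>v v) = mat_op A (vec_fun v)"
  by (auto simp: vec_fun_def mat_op_def scalar_prod_def atLeast0LessThan)

lemma mat_op_pow:
  assumes "X \<in> carrier_mat n n" "f \<in> fvecs n"
  shows "mat_op (X ^\<^sub>m k) f = (mat_op X ^^ k) f"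
  using assms(2)
proof (induction k arbitrary: f)
  case 0
  then show ?case using assms(1) by (simp add: mat_op_one)
next
  case (Suc k)
  have "mat_op (X ^\<^sub>m Suc k) f = mat_op (X ^\<^sub>m k) (mat_op X f)"
    using assms(1) by (simp add: mat_op_mult[of _ n n])
  then show ?case using Suc.IH[OF mat_op_in_fvecs[OF assms(1)]] by (simp add: funpow_swap1)
qed

lemma poly_mat_carrier: "X \<in> carrier_mat n n \<Longrightarrow> poly_mat p X \<in> carrier_mat n n"
  by (simp add: poly_mat_def)

lemma mat_op_poly_mat:
  assumes "X \<in> carrier_mat n n" "f \<in> fvecs n"
  shows "mat_op (poly_mat p X) f = poly_act X p f"
proof
  fix i
  have d: "dim_row X = n" "dim_col X = n" using assms(1) by auto
  then have dk: "dim_row (X ^\<^sub>m k) = n" "dim_col (X ^\<^sub>m k) = n" for k by auto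
  have "mat_op (poly_mat p X) f i = (\<Sum>k\<le>degree p. coeff p k * mat_op (X ^\<^sub>m k) f i)"
    using d dk
    by (auto simp: mat_op_def poly_mat_def sum_distrib_right sum_distrib_left mult.assoc
        simp del: pow_mat_dim intro: sum.swap)
  then show "mat_op (poly_mat p X) f i = poly_act X p f i"
    by (simp add: poly_act_def mat_op_pow[OF assms])
qed

lemma vec_fun_poly_mat:
  assumes "X \<in> carrier_mat n n" "v \<in> carrier_vec n"
  shows "vec_fun (poly_mat p X *\<^sub>v v) = poly_act X p (vec_fun v)"
  using assms
  by (simp add: vec_fun_mult_mat_vec[OF poly_mat_carrier] mat_op_poly_mat[OF _ vec_fun_in_fvecs])

lemma vec_fun_finsum:
  assumes "finite S" "w ` S \<subseteq> carrier_vec n"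
  shows "vec_fun (finsum_vec TYPE('a::comm_ring_1) n w S) = (\<Sum>i\<in>S. vec_fun (w i))"
proof
  fix j
  have w: "w \<in> S \<rightarrow> carrier_vec n" using assms(2) by auto
  then have "dim_vec (finsum_vec TYPE('a) n w S) = n" using carrier_vecD[OF finsum_vec_closed] by blast
  moreover have "dim_vec (w i) = n" if "i \<in> S" for i using assms(2) that by auto
  ultimately show "vec_fun (finsum_vec TYPE('a) n w S) j = (\<Sum>i\<in>S. vec_fun (w i)) j"
    using index_finsum_vec[OF assms(1) _ w, of j] by (auto simp: vec_fun_def sum_fun_apply)
qed

context matrix_module
begin

lemma vec_fun_primary_component: "vec_fun ` primary_component X h = ker h n"
proof -
  have P: "poly_mat h X \<in> carrier_mat n n" using X by (rule poly_mat_carrier)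
  have dim: "dim_row (poly_mat h X) = n" "dim_col (poly_mat h X) = n" "dim_row X = n" using P X by auto
  have pow: "mat_op (poly_mat h X ^\<^sub>m k) f = poly_act X (h ^ k) f" if "f \<in> fvecs n" for f k
  proof -
    have "(mat_op (poly_mat h X) ^^ k) f = poly_act X (h ^ k) f \<and> (mat_op (poly_mat h X) ^^ k) f \<in> fvecs n"
      by (induction k) (use that X in \<open>auto simp: mat_op_poly_mat poly_act_in_fvecs\<close>)
    then show ?thesis using that P by (simp add: mat_op_pow)
  qed
  have Pn: "poly_mat h X ^\<^sub>m n \<in> carrier_mat n n" using P by simp
  have "poly_mat h X ^\<^sub>m n *\<^sub>v v = 0\<^sub>v n \<longleftrightarrow> poly_act X (h ^ n) (vec_fun v) = 0"
    if "v \<in> carrier_vec n" for v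
    using vec_fun_eq_0[OF mult_mat_vec_carrier[OF Pn that]] vec_fun_mult_mat_vec[OF Pn that]
      pow[OF vec_fun_in_fvecs[OF that], of n] by simp
  then have "primary_component X h = {v \<in> carrier_vec n. poly_act X (h ^ n) (vec_fun v) = 0}"
    unfolding primary_component_def mat_kernel_def dim(3) carrier_matD[OF Pn] by blast
  then have "vec_fun ` primary_component X h = {f \<in> vec_fun ` carrier_vec n. poly_act X (h ^ n) f = 0}"
    by auto
  then show ?thesis by (simp add: vec_fun_surj ker_def)
qed

end

subsection \<open>Primary types as independent families\<close>

context finite_poly_module
begin

lemma span_image_lessThan: "span (u ` {..<r}) = range (\<lambda>p. \<Sum>j<r. p j *s u j)" for r :: nat
proof (induction r)
  case (Suc r)
  have "x \<in> range (\<lambda>p. \<Sum>j<Suc r. p j *s u j)" if x: "x \<in> span (u ` {..<Suc r})" for x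
  proof -
    obtain k where "x - k *s u r \<in> span (u ` {..<r})"
      using x by (auto simp: lessThan_Suc span_breakdown_eq)
    then obtain p where p: "x - k *s u r = (\<Sum>j<r. p j *s u j)" using Suc by auto
    have "x = (\<Sum>j<r. p j *s u j) + k *s u r" using p[symmetric] by simp
    then show ?thesis by (intro image_eqI[of _ _ "p(r := k)"]) auto
  qed
  moreover have "range (\<lambda>p. \<Sum>j<Suc r. p j *s u j) \<subseteq> span (u ` {..<Suc r})"
    by (intro image_subsetI span_sum span_scale span_base) auto
  ultimately show ?case by blast
qed auto

lemma good_nth:
  assumes "good L vs" "i < length L" "L ! i = (h, k)"
  shows "vs ! i \<in> V" "h ^ k *s (vs ! i) = 0" "h ^ (k - 1) *s (vs ! i) \<noteq> 0"
  using assms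
  by (induction L vs arbitrary: i rule: good.induct) (auto simp: nth_Cons span_zero split: nat.splits)

lemma subspace_ker: "subspace (ker h k)"
  unfolding subspace_def ker_def using subspace_V
  by (auto simp: subspace_0 subspace_add subspace_scale scale_right_distrib mult.commute
      simp flip: scale_scale scale_left_commute)

end

lemma valid_shape_primary: "h \<in> Irr \<Longrightarrow> \<mu> \<in> partitions \<Longrightarrow> valid_shape (map (Pair h) (rev \<mu>))"
  using valid_type_shape[of "[h]" "\<lambda>_. \<mu>"] by (simp add: type_shape_Cons)

lemma card_field_gt_1: "1 < CARD('a::{field,finite})"
  using card_mono[of UNIV "{0, 1 :: 'a}"] by simp

context matrix_module
begin

text \<open>Translates the tuples of \<open>is_direct_sum\<close> into the module of functions: the
  image of the sum map is the span of the generators, whether or not the sum is direct.\<close>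

lemma cyclic_sums:
  fixes r :: nat
  assumes v: "\<And>i. i < r \<Longrightarrow> v i \<in> carrier_vec n"
    and W: "\<And>i. i < r \<Longrightarrow> W i = {poly_mat p X *\<^sub>v v i | p. True}"
  defines "\<phi> \<equiv> \<lambda>w. finsum_vec TYPE('a) n w {..<r}"
  shows "\<And>w. w \<in> Pi\<^sub>E {..<r} W \<Longrightarrow> w ` {..<r} \<subseteq> carrier_vec n"
    "\<phi> ` Pi\<^sub>E {..<r} W \<subseteq> carrier_vec n"
    "vec_fun ` \<phi> ` Pi\<^sub>E {..<r} W = span ((\<lambda>i. vec_fun (v i)) ` {..<r})"
proof -
  have Wc: "W i \<subseteq> carrier_vec n" if "i < r" for i
    using W[OF that] mult_mat_vec_carrier[OF poly_mat_carrier[OF X] v[OF that]] by auto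
  show w: "w ` {..<r} \<subseteq> carrier_vec n" if "w \<in> Pi\<^sub>E {..<r} W" for w
    using that Wc by (fastforce simp: PiE_def Pi_def)
  show "\<phi> ` Pi\<^sub>E {..<r} W \<subseteq> carrier_vec n"
    unfolding \<phi>_def using w by (auto intro!: finsum_vec_closed)
  have "vec_fun (\<phi> w) \<in> range (\<lambda>p. \<Sum>j<r. poly_act X (p j) (vec_fun (v j)))"
    if wP: "w \<in> Pi\<^sub>E {..<r} W" for w
  proof -
    have "\<forall>j\<in>{..<r}. \<exists>p. w j = poly_mat p X *\<^sub>v v j" using wP W by (fastforce simp: PiE_def Pi_def)
    then obtain p where p: "\<And>j. j < r \<Longrightarrow> w j = poly_mat (p j) X *\<^sub>v v j" by (metis lessThan_iff)
    have "vec_fun (\<phi> w) = (\<Sum>j<r. vec_fun (w j))" unfolding \<phi>_def using w[OF wP] by (rule vec_fun_finsum[OF finite_lessThan])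
    also have "\<dots> = (\<Sum>j<r. poly_act X (p j) (vec_fun (v j)))"
      using p v X by (intro sum.cong) (auto simp: vec_fun_poly_mat)
    finally show ?thesis by auto
  qed
  moreover have "(\<Sum>j<r. poly_act X (p j) (vec_fun (v j))) \<in> vec_fun ` \<phi> ` Pi\<^sub>E {..<r} W" for p
  proof -
    define w where "w = (\<lambda>j\<in>{..<r}. poly_mat (p j) X *\<^sub>v v j)"
    have wP: "w \<in> Pi\<^sub>E {..<r} W" using W by (auto simp: w_def)
    have "vec_fun (\<phi> w) = (\<Sum>j<r. vec_fun (w j))" unfolding \<phi>_def using w[OF wP] by (rule vec_fun_finsum[OF finite_lessThan])
    also have "\<dots> = (\<Sum>j<r. poly_act X (p j) (vec_fun (v j)))"
      using v X by (intro sum.cong) (auto simp: vec_fun_poly_mat w_def)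
    finally show ?thesis using wP by (metis imageI)
  qed
  ultimately show "vec_fun ` \<phi> ` Pi\<^sub>E {..<r} W = span ((\<lambda>i. vec_fun (v i)) ` {..<r})"
    unfolding span_image_lessThan by auto
qed

lemma primary_component_subset: "primary_component X h \<subseteq> carrier_vec n"
proof -
  have "dim_col (poly_mat h X ^\<^sub>m n) = n" using pow_carrier_mat[OF poly_mat_carrier[OF X]] by blast
  then show ?thesis using X by (auto simp: primary_component_def mat_kernel_def simp del: pow_mat_dim)
qed

text \<open>The generators of the cyclic summands, in reverse order, form the family. If
  \<open>h ^ (\<mu> ! i - 1)\<close> took a generator into the span of those before it, one vector
  would have two decompositions, as minimality of \<open>h ^ (\<mu> ! i)\<close> makes that multiple
  nonzero.\<close>

lemma has_primary_type_imp_good: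
  assumes type: "has_primary_type X h \<mu>" and h: "h \<in> Irr"
  obtains vs where "good (map (Pair h) (rev \<mu>)) vs" "span (set vs) = ker h n"
proof -
  let ?r = "length \<mu>"
  have n: "dim_row X = n" using X by simp
  from type n obtain W where cyc: "\<And>i. i < ?r \<Longrightarrow> cyclic_submodule X (W i)"
    and mp: "\<And>i. i < ?r \<Longrightarrow> is_min_poly_on X (W i) (h ^ (\<mu> ! i))"
    and ds: "is_direct_sum n ?r W (primary_component X h)"
    unfolding has_primary_type_def by auto
  have "\<exists>v. v \<in> carrier_vec n \<and> W i = {poly_mat p X *\<^sub>v v | p. True}" if "i < ?r" for i
    using cyc[OF that] n by (auto simp: cyclic_submodule_def)
  then obtain v where v: "\<And>i. i < ?r \<Longrightarrow> v i \<in> carrier_vec n"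
    and W: "\<And>i. i < ?r \<Longrightarrow> W i = {poly_mat p X *\<^sub>v v i | p. True}"
    by metis
  define u where "u i = vec_fun (v i)" for i
  let ?\<phi> = "\<lambda>w. finsum_vec TYPE('a) n w {..<?r}"
  have cs: "\<And>w. w \<in> Pi\<^sub>E {..<?r} W \<Longrightarrow> w ` {..<?r} \<subseteq> carrier_vec n"
    "?\<phi> ` Pi\<^sub>E {..<?r} W \<subseteq> carrier_vec n"
    "vec_fun ` ?\<phi> ` Pi\<^sub>E {..<?r} W = span ((\<lambda>i. vec_fun (v i)) ` {..<?r})"
    by (rule cyclic_sums[OF v W]; assumption)+
  have inj: "inj_on ?\<phi> (Pi\<^sub>E {..<?r} W)" and surj: "?\<phi> ` Pi\<^sub>E {..<?r} W = primary_component X h"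
    using ds by (auto simp: is_direct_sum_def bij_betw_def)
  have act: "vec_fun (poly_mat p X *\<^sub>v v i) = poly_act X p (u i)" if "i < ?r" for p i
    using vec_fun_poly_mat[OF X v[OF that]] by (simp add: u_def)
  have span: "span (u ` {..<?r}) = ker h n"
    using cs(3) surj vec_fun_primary_component by (simp add: u_def)
  have uniq: "poly_act X (p i) (u i) = poly_act X (p' i) (u i)"
    if eq: "(\<Sum>j<?r. poly_act X (p j) (u j)) = (\<Sum>j<?r. poly_act X (p' j) (u j))" and i: "i < ?r" for p p' i
  proof -
    define w where "w p = (\<lambda>j\<in>{..<?r}. poly_mat (p j) X *\<^sub>v v j)" for p
    have wP: "w p \<in> Pi\<^sub>E {..<?r} W" for p using W by (auto simp: w_def)
    have sum: "vec_fun (?\<phi> (w p)) = (\<Sum>j<?r. poly_act X (p j) (u j))" for p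
    proof -
      have "vec_fun (?\<phi> (w p)) = (\<Sum>j<?r. vec_fun (w p j))" using cs(1)[OF wP] by (rule vec_fun_finsum[OF finite_lessThan])
      then show ?thesis by (simp add: w_def act)
    qed
    have "?\<phi> (w p) \<in> carrier_vec n" for p using cs(2) wP by blast
    then have "?\<phi> (w p) = ?\<phi> (w p')" using eq sum by (intro inj_onD[OF vec_fun_inj[of n]]) auto
    then have "w p = w p'" using inj wP by (auto dest: inj_onD)
    then have "w p i = w p' i" by simp
    then have "vec_fun (poly_mat (p i) X *\<^sub>v v i) = vec_fun (poly_mat (p' i) X *\<^sub>v v i)"
      using i by (simp add: w_def)
    then show ?thesis using act[OF i] by simp
  qed
  have kills: "poly_act X p (u i) = 0 \<longleftrightarrow> (\<forall>w\<in>W i. poly_mat p X *\<^sub>v w = 0\<^sub>v n)" if i: "i < ?r" for p i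
  proof -
    have *: "poly_mat p X *\<^sub>v (poly_mat q X *\<^sub>v v i) = 0\<^sub>v n \<longleftrightarrow> poly_act X (p * q) (u i) = 0" for q
    proof -
      have c: "poly_mat q X *\<^sub>v v i \<in> carrier_vec n"
        using mult_mat_vec_carrier[OF poly_mat_carrier[OF X] v[OF i]] .
      then have c2: "poly_mat p X *\<^sub>v (poly_mat q X *\<^sub>v v i) \<in> carrier_vec n"
        using mult_mat_vec_carrier[OF poly_mat_carrier[OF X]] by blast
      then show ?thesis
        using vec_fun_eq_0[OF c2] vec_fun_poly_mat[OF X c, of p] act[OF i] by simp
    qed
    have "poly_act X (p * q) (u i) = 0" if "poly_act X p (u i) = 0" for q
      by (rule scale_eq_0_if_dvd[OF that]) simp
    moreover have "poly_act X p (u i) = 0" if "\<And>q. poly_act X (p * q) (u i) = 0"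
      using that[of 1] by simp
    moreover have "(\<forall>w\<in>W i. poly_mat p X *\<^sub>v w = 0\<^sub>v n) \<longleftrightarrow> (\<forall>q. poly_act X (p * q) (u i) = 0)"
      unfolding W[OF i] *[symmetric] by auto
    ultimately show ?thesis by metis
  qed
  have zero: "poly_act X (h ^ (\<mu> ! i)) (u i) = 0" if "i < ?r" for i
    using mp[OF that] kills[OF that] n by (simp add: is_min_poly_on_def)
  have nonzero: "poly_act X (h ^ (\<mu> ! i - 1)) (u i) \<noteq> 0" if i: "i < ?r" for i
  proof
    assume "poly_act X (h ^ (\<mu> ! i - 1)) (u i) = 0"
    then have "h ^ (\<mu> ! i) dvd h ^ (\<mu> ! i - 1)"
      using mp[OF i] kills[OF i] n by (simp add: is_min_poly_on_def)
    then have "\<mu> ! i * degree h \<le> (\<mu> ! i - 1) * degree h"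
      using h by (metis degree_Irr_power dvd_imp_degree_le Irr_nonzero power_not_zero)
    moreover have "1 \<le> \<mu> ! i" using type i by (auto simp: has_primary_type_def partitions_def)
    ultimately show False using Irr_degree_pos[OF h] by simp
  qed
  have "good (map (Pair h) (rev (take i \<mu>))) (rev (map u [0..<i]))" if "i \<le> ?r" for i
    using that
  proof (induction i)
    case (Suc i)
    then have i: "i < ?r" by simp
    have "poly_act X (h ^ (\<mu> ! i - 1)) (u i) \<notin> span (u ` {..<i})"
    proof
      assume "poly_act X (h ^ (\<mu> ! i - 1)) (u i) \<in> span (u ` {..<i})"
      then obtain p where p: "poly_act X (h ^ (\<mu> ! i - 1)) (u i) = (\<Sum>j<i. poly_act X (p j) (u j))"
        unfolding span_image_lessThan by auto
      \<comment> \<open>Two coefficient families with the same sum: one lives on index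
        \<open>i\<close> only, the other below \<open>i\<close>. Uniqueness of the component at
        \<open>i\<close> equates a nonzero vector with 0.\<close>
      let ?p = "\<lambda>j. if j = i then h ^ (\<mu> ! i - 1) else 0" and ?p' = "\<lambda>j. if j < i then p j else 0"
      have "(\<Sum>j<?r. poly_act X (?p j) (u j)) = poly_act X (h ^ (\<mu> ! i - 1)) (u i)"
        using i by (subst sum.remove[of _ i]) (auto intro!: sum.neutral)
      moreover have "(\<Sum>j<?r. poly_act X (?p' j) (u j)) = (\<Sum>j<i. poly_act X (p j) (u j))"
        using i by (intro sum.mono_neutral_cong_right) auto
      ultimately have "poly_act X (?p i) (u i) = poly_act X (?p' i) (u i)"
        using p i by (intro uniq) simp_all
      then show False using nonzero[OF i] by simp
    qed
    moreover have "set (rev (map u [0..<i])) = u ` {..<i}" by auto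
    ultimately show ?case
      using Suc i zero[OF i] vec_fun_in_fvecs[OF v[OF i]]
      by (simp add: take_Suc_conv_app_nth u_def)
  qed simp
  from this[of ?r] have "good (map (Pair h) (rev \<mu>)) (rev (map u [0..<?r]))" by simp
  moreover have "span (set (rev (map u [0..<?r]))) = ker h n" using span by (simp add: atLeast0LessThan)
  ultimately show thesis by (rule that)
qed

text \<open>Directness comes from counting: the sum map is onto the primary component, and both
  sides have \<open>CARD('a) ^ (sum_list \<mu> * degree h)\<close> elements.\<close>

lemma good_imp_has_primary_type:
  assumes \<mu>: "\<mu> \<in> partitions" and h: "h \<in> Irr"
    and good: "good (map (Pair h) (rev \<mu>)) vs" and span: "span (set vs) = ker h n"
  shows "has_primary_type X h \<mu>"
proof -
  let ?r = "length \<mu>"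
  have n: "dim_row X = n" using X by simp
  have len: "length vs = ?r" using good_length[OF good] by simp
  \<comment> \<open>Families grow at the head, so part \<open>i\<close> of \<open>\<mu>\<close>
    belongs to position \<open>?r - 1 - i\<close> of \<open>vs\<close>.\<close>
  define u where "u i = rev vs ! i" for i
  have nth: "u i \<in> fvecs n" "poly_act X (h ^ (\<mu> ! i)) (u i) = 0" "poly_act X (h ^ (\<mu> ! i - 1)) (u i) \<noteq> 0"
    if "i < ?r" for i
  proof -
    have "map (Pair h) (rev \<mu>) ! (?r - 1 - i) = (h, \<mu> ! i)" using that by (simp add: rev_nth)
    moreover have "u i = vs ! (?r - 1 - i)" using that len by (simp add: u_def rev_nth)
    ultimately show "u i \<in> fvecs n" "poly_act X (h ^ (\<mu> ! i)) (u i) = 0" "poly_act X (h ^ (\<mu> ! i - 1)) (u i) \<noteq> 0"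
      using good_nth[OF good, of "?r - 1 - i" h "\<mu> ! i"] that by simp_all
  qed
  define v where "v i = vec n (u i)" for i
  define W where "W i = {poly_mat p X *\<^sub>v v i | p. True}" for i
  have v: "v i \<in> carrier_vec n" for i by (simp add: v_def)
  have vu: "vec_fun (v i) = u i" if "i < ?r" for i using vec_fun_vec[OF nth(1)[OF that]] by (simp add: v_def)
  note cs = cyclic_sums[of ?r v W, OF v W_def]
  have act: "vec_fun (poly_mat p X *\<^sub>v v i) = poly_act X p (u i)" if "i < ?r" for p i
    using vec_fun_poly_mat[OF X v] vu[OF that] by simp
  have Wc: "W i \<subseteq> carrier_vec n" for i
    using mult_mat_vec_carrier[OF poly_mat_carrier[OF X] v] by (auto simp: W_def)
  have Wspan: "vec_fun ` W i = span {u i}" if "i < ?r" for i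
  proof -
    have "vec_fun ` W i = range (\<lambda>p. vec_fun (poly_mat p X *\<^sub>v v i))" by (auto simp: W_def)
    then show ?thesis by (simp add: act[OF that] span_singleton)
  qed
  have kills: "(\<forall>w\<in>W i. poly_mat p X *\<^sub>v w = 0\<^sub>v n) \<longleftrightarrow> poly_act X p (u i) = 0" if i: "i < ?r" for p i
  proof -
    have "(\<forall>w\<in>W i. poly_mat p X *\<^sub>v w = 0\<^sub>v n) \<longleftrightarrow> (\<forall>w\<in>W i. poly_act X p (vec_fun w) = 0)"
    proof (intro ball_cong refl)
      fix w assume "w \<in> W i"
      then have w: "w \<in> carrier_vec n" using Wc by blast
      show "poly_mat p X *\<^sub>v w = 0\<^sub>v n \<longleftrightarrow> poly_act X p (vec_fun w) = 0"
        using vec_fun_eq_0[OF mult_mat_vec_carrier[OF poly_mat_carrier[OF X] w]] vec_fun_poly_mat[OF X w] by simp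
    qed
    also have "\<dots> \<longleftrightarrow> (\<forall>x\<in>span {u i}. poly_act X p x = 0)" unfolding Wspan[OF i, symmetric] by simp
    also have "\<dots> \<longleftrightarrow> poly_act X p (u i) = 0"
    proof
      assume z: "poly_act X p (u i) = 0"
      have "poly_act X (p * q) (u i) = 0" for q by (rule scale_eq_0_if_dvd[OF z]) simp
      then show "\<forall>x\<in>span {u i}. poly_act X p x = 0" by (auto simp: span_singleton)
    qed (auto intro: span_base)
    finally show ?thesis .
  qed
  have mp: "is_min_poly_on X (W i) (h ^ (\<mu> ! i))" if i: "i < ?r" for i
    unfolding is_min_poly_on_def n kills[OF i]
  proof (intro conjI allI impI)
    show "monic (h ^ (\<mu> ! i))" using h by (simp add: Irr_def monic_power)
    fix p assume p: "poly_act X p (u i) = 0"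
    \<comment> \<open>For the zero submodule: a \<open>p\<close> that kills \<open>u i\<close>
      without being a multiple of \<open>h ^ (\<mu> ! i)\<close> would make
      \<open>h ^ (\<mu> ! i - 1)\<close> kill \<open>u i\<close>.\<close>
    then show "h ^ (\<mu> ! i) dvd p"
      using power_scale_mem[OF h subspace_single_0, of "\<mu> ! i" "u i" p] nth(2,3)[OF i] by auto
  qed (use nth[OF i] in simp)
  let ?\<phi> = "\<lambda>w. finsum_vec TYPE('a) n w {..<?r}"
  have set: "u ` {..<?r} = set vs"
    unfolding u_def using len nth_image[of ?r "rev vs"] by (simp add: atLeast0LessThan)
  have "(\<lambda>i. vec_fun (v i)) ` {..<?r} = u ` {..<?r}" using vu by auto
  then have "vec_fun ` ?\<phi> ` Pi\<^sub>E {..<?r} W = vec_fun ` primary_component X h"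
    using cs(3) span set vec_fun_primary_component by simp
  then have surj: "?\<phi> ` Pi\<^sub>E {..<?r} W = primary_component X h"
    using inj_on_image_eq_iff[OF vec_fun_inj cs(2) primary_component_subset] by simp
  have cardW: "card (W i) = CARD('a) ^ (\<mu> ! i * degree h)" if i: "i < ?r" for i
  proof -
    have "1 \<le> \<mu> ! i" using \<mu> i by (auto simp: partitions_def)
    then have "card (span (set [u i])) = CARD('a) ^ shape_degree [(h, \<mu> ! i)]"
      using nth[OF i] h by (intro card_span_good) auto
    moreover have "card (W i) = card (span {u i})"
      using Wspan[OF i] card_image[OF inj_on_subset[OF vec_fun_inj Wc]] by metis
    ultimately show ?thesis by (simp add: shape_degree_Cons)
  qed
  have "card (Pi\<^sub>E {..<?r} W) = (\<Prod>i<?r. CARD('a) ^ (\<mu> ! i * degree h))"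
    using cardW by (simp add: card_PiE)
  also have "\<dots> = CARD('a) ^ (sum_list \<mu> * degree h)"
    by (simp add: power_sum sum_distrib_right sum_list_sum_nth atLeast0LessThan)
  also have "\<dots> = card (span (set vs))"
    using card_span_good[OF good valid_shape_primary[OF h \<mu>]] by (simp add: shape_degree_block)
  also have "\<dots> = card (primary_component X h)"
    using span vec_fun_primary_component card_image[OF inj_on_subset[OF vec_fun_inj primary_component_subset]]
    by metis
  finally have "card (Pi\<^sub>E {..<?r} W) = card (?\<phi> ` Pi\<^sub>E {..<?r} W)" using surj by simp
  moreover have "finite (Pi\<^sub>E {..<?r} W)"
  proof (rule finite_PiE)
    have "card (W i) \<noteq> 0" if "i < ?r" for i using cardW[OF that] by simp
    then show "finite (W i)" if "i \<in> {..<?r}" for i using that by (metis card.infinite lessThan_iff)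
  qed simp
  ultimately have "bij_betw ?\<phi> (Pi\<^sub>E {..<?r} W) (primary_component X h)"
    using surj by (auto simp: bij_betw_def intro: eq_card_imp_inj_on)
  moreover have "cyclic_submodule X (W i)" for i
    unfolding cyclic_submodule_def n using v by (auto simp: W_def)
  ultimately show ?thesis
    unfolding has_primary_type_def is_direct_sum_def n using \<mu> mp by (intro conjI exI[of _ W]) auto
qed

section \<open>Primary types and kernel sizes\<close>

lemma power_card_inject:
  assumes "h \<in> Irr" "CARD('a) ^ (degree h * a) = CARD('a) ^ (degree h * b)"
  shows "a = b"
  using assms Irr_degree_pos[OF assms(1)] card_field_gt_1[where 'a = 'a] by simp

lemma has_primary_type_unique:
  assumes "has_primary_type X h \<mu>" "has_primary_type X h \<nu>" and h: "h \<in> Irr"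
  shows "\<mu> = \<nu>"
proof (rule partition_eqI)
  show \<mu>: "\<mu> \<in> partitions" and \<nu>: "\<nu> \<in> partitions" using assms by (auto simp: has_primary_type_def)
  have c: "card {x \<in> ker h n. poly_act X (h ^ k) x = 0} = CARD('a) ^ (degree h * conj_sum \<nu>' k)"
    if "has_primary_type X h \<nu>'" "\<nu>' \<in> partitions" for \<nu>' k
  proof -
    note type = that
    obtain vs where "good (map (Pair h) (rev \<nu>')) vs" "span (set vs) = ker h n"
      using has_primary_type_imp_good[OF type(1) h] .
    then show ?thesis
      using card_span_ker[OF _ valid_shape_primary[OF h type(2)] h, of vs k]
      by (simp add: ker_len_block conj_sum_rev)
  qed
  show "conj_sum \<mu> k = conj_sum \<nu> k" for k
    by (rule power_card_inject[OF h]) (use c[OF assms(1) \<mu>, of k] c[OF assms(2) \<nu>, of k] in simp)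
qed

lemma has_primary_type_primary_type:
  assumes h: "h \<in> Irr"
  shows "has_primary_type X h (primary_type X h)"
proof -
  have "\<And>x. x \<in> ker h n \<Longrightarrow> poly_act X (h ^ n) x = 0" "ker h n \<subseteq> fvecs n" by (auto simp: ker_def)
  then obtain \<mu> vs where "sorted \<mu>" "\<forall>j\<in>set \<mu>. 1 \<le> j" "good (map (Pair h) \<mu>) vs" "span (set vs) = ker h n"
    using primary_good_exists[OF h subspace_ker] by metis
  then have "has_primary_type X h (rev \<mu>)"
    using rev_sorted_in_partitions by (intro good_imp_has_primary_type[OF _ h]) auto
  then have "\<exists>!\<mu>. has_primary_type X h \<mu>" using has_primary_type_unique[OF _ _ h] by blast
  then show ?thesis unfolding primary_type_def by (rule theI')
qed

lemma primary_type_in_partitions: "h \<in> Irr \<Longrightarrow> primary_type X h \<in> partitions"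
  using has_primary_type_primary_type by (auto simp: has_primary_type_def)

text \<open>By Cayley-Hamilton the order of a vector killed by some power of \<open>h\<close>
  divides the characteristic polynomial, and comparing degrees bounds its exponent by
  \<open>n\<close>. So \<open>ker h n\<close> is the whole primary component.\<close>

lemma ker_stable:
  assumes h: "h \<in> Irr"
  shows "ker h k \<subseteq> ker h n"
proof
  fix x assume x: "x \<in> ker h k"
  then have xV: "x \<in> fvecs n" by (simp add: ker_def)
  define m where "m = (LEAST m. poly_act X (h ^ m) x = 0)"
  have m: "poly_act X (h ^ m) x = 0"
    unfolding m_def by (rule LeastI[of _ k]) (use x in \<open>simp add: ker_def\<close>)
  have "h ^ m dvd char_poly X"
  proof (rule ccontr)
    assume nd: "\<not> h ^ m dvd char_poly X"
    then have "m \<noteq> 0" by (intro notI) simp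
    moreover have "poly_act X (h ^ (m - 1)) x = 0"
      using power_scale_mem[OF h subspace_single_0, of m x "char_poly X"] m nd
        Cayley_Hamilton_act[OF X xV] by auto
    ultimately show False
      using not_less_Least[of "m - 1" "\<lambda>m. poly_act X (h ^ m) x = 0"] by (simp flip: m_def)
  qed
  then have "m * degree h \<le> n"
    using degree_monic_char_poly[OF X] h
    by (metis degree_Irr_power dvd_imp_degree_le leading_coeff_0_iff zero_neq_one)
  then have "m \<le> n" using Irr_degree_pos[OF h] by (metis Suc_leI le_trans mult_le_mono2 mult.right_neutral One_nat_def)
  then have "poly_act X (h ^ n) x = 0" using scale_eq_0_if_dvd[OF m] by (simp add: le_imp_power_dvd)
  then show "x \<in> ker h n" using xV by (simp add: ker_def)
qed

lemma card_ker_primary_type: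
  assumes h: "h \<in> Irr"
  shows "card (ker h k) = CARD('a) ^ (degree h * conj_sum (primary_type X h) k)"
proof -
  obtain vs where vs: "good (map (Pair h) (rev (primary_type X h))) vs" "span (set vs) = ker h n"
    using has_primary_type_imp_good[OF has_primary_type_primary_type[OF h] h] .
  have "ker h k = {x \<in> ker h n. poly_act X (h ^ k) x = 0}" using ker_stable[OF h] by (auto simp: ker_def)
  then show ?thesis
    using card_span_ker[OF vs(1) valid_shape_primary[OF h primary_type_in_partitions[OF h]] h, of k] vs(2)
    by (simp add: ker_len_block conj_sum_rev)
qed

lemma primary_type_eqI:
  assumes "h \<in> Irr" "\<mu> \<in> partitions" "\<And>k. card (ker h k) = CARD('a) ^ (degree h * conj_sum \<mu> k)"
  shows "primary_type X h = \<mu>"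
  using assms card_ker_primary_type[OF assms(1)] power_card_inject[OF assms(1)]
  by (intro partition_eqI primary_type_in_partitions) metis+

text \<open>Each irreducible factor of the characteristic polynomial occurs in \<open>hs\<close> and
  has multiplicity at most \<open>n\<close>. By Cayley-Hamilton the product of all
  \<open>h ^ n\<close> therefore kills every vector, and the primary families glued by
  \<open>good_type_shape\<close> generate everything.\<close>

lemma full_family_exists:
  assumes hs: "distinct hs" "set hs \<subseteq> Irr" "Div X \<subseteq> set hs"
  obtains vs where "good (type_shape (primary_type X) hs) vs" "span (set vs) = fvecs n"
proof -
  have "\<exists>vs. good (map (Pair h) (rev (primary_type X h))) vs \<and> span (set vs) = ker h n" if "h \<in> Irr" for h
    using has_primary_type_imp_good[OF has_primary_type_primary_type[OF that] that] by metis
  then obtain vs where vs: "\<And>h. h \<in> Irr \<Longrightarrow> good (map (Pair h) (rev (primary_type X h))) (vs h)"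
    "\<And>h. h \<in> Irr \<Longrightarrow> span (set (vs h)) = ker h n"
    by metis
  obtain as f where as: "finite as" "char_poly X = (\<Prod>a\<in>as. a ^ Suc (f a))" "as \<subseteq> Irr"
    using monic_irreducible_factorization[of "char_poly X"] degree_monic_char_poly[OF X]
    by (auto simp: Irr_def)
  have a: "a \<in> set hs" "Suc (f a) \<le> n" if "a \<in> as" for a
  proof -
    have d: "a ^ Suc (f a) dvd char_poly X" unfolding as(2) using as(1) that by (rule dvd_prodI)
    moreover have "a dvd a ^ Suc (f a)" by simp
    ultimately have "a \<in> Div X" using that as(3) by (auto simp: Div_def intro: dvd_trans)
    then show "a \<in> set hs" using hs(3) by blast
    have aI: "a \<in> Irr" using that as(3) by blast
    have "Suc (f a) * degree a \<le> n"
      using d degree_monic_char_poly[OF X] degree_Irr_power[OF aI, of "Suc (f a)"]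
      by (metis dvd_imp_degree_le leading_coeff_0_iff zero_neq_one)
    then show "Suc (f a) \<le> n" using Irr_degree_pos[OF aI]
      by (metis Suc_leI le_trans mult_le_mono2 mult.right_neutral One_nat_def)
  qed
  have "char_poly X dvd (\<Prod>a\<in>as. a ^ n)"
    unfolding as(2) using a(2) by (intro prod_dvd_prod le_imp_power_dvd)
  also have "\<dots> dvd (\<Prod>a\<in>set hs. a ^ n)" using a(1) by (intro prod_dvd_prod_subset) auto
  also have "\<dots> = (\<Prod>h\<leftarrow>hs. h ^ n)" using hs(1) by (simp add: prod.distinct_set_conv_list)
  finally have "{x \<in> fvecs n. poly_act X (\<Prod>h\<leftarrow>hs. h ^ n) x = 0} = fvecs n"
    using Cayley_Hamilton_act[OF X] scale_eq_0_if_dvd by blast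
  moreover have "good (type_shape (primary_type X) hs) (concat (map vs hs)) \<and>
      span (set (concat (map vs hs))) = {x \<in> fvecs n. poly_act X (\<Prod>h\<leftarrow>hs. h ^ n) x = 0}"
    using hs vs primary_type_in_partitions by (intro good_type_shape) auto
  ultimately show thesis using that[of "concat (map vs hs)"] by metis
qed

end

text \<open>An intertwiner is determined by its values on the generators \<open>ws\<close>.
  Conversely a good family of shape \<open>L\<close> for \<open>X\<close> generates everything by
  cardinality; the isomorphism from \<open>good_iso\<close> is linear because it respects constants,
  and intertwines because it respects \<open>t\<close>.\<close>

lemma intertwiners_bij:
  fixes X Y :: "'a::{field,finite} mat"
  assumes X: "X \<in> carrier_mat n n" and Y: "Y \<in> carrier_mat n n" and L: "valid_shape L"
    and ws: "finite_poly_module.good (poly_act Y) (fvecs n) L ws"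
    and span: "Modules.module.span (poly_act Y) (set ws) = fvecs n"
  shows "bij_betw (\<lambda>g. map (mat_op g) ws) {g \<in> GL n. X * g = g * Y}
    {vs. finite_poly_module.good (poly_act X) (fvecs n) L vs}"
proof -
  interpret X: matrix_module X n by unfold_locales fact
  interpret Y: matrix_module Y n by unfold_locales fact
  have hom: "Modules.module_hom (poly_act Y) (poly_act X) (mat_op g)"
    if "g \<in> carrier_mat n n" "X * g = g * Y" for g
    using X Y that by (intro module_hom_intertwine) (auto simp: mat_op_add mat_op_scale simp flip: mat_op_mult)
  have wsV: "set ws \<subseteq> fvecs n" using Y.good_subset[OF ws] .
  show ?thesis
    unfolding bij_betw_def
  proof (intro conjI inj_onI equalityI subsetI)
    fix g g' assume g: "g \<in> {g \<in> GL n. X * g = g * Y}" "g' \<in> {g \<in> GL n. X * g = g * Y}"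
      and eq: "map (mat_op g) ws = map (mat_op g') ws"
    have gc: "g \<in> carrier_mat n n" "g' \<in> carrier_mat n n" using g by (auto simp: GL_def)
    interpret g: Modules.module_hom "poly_act Y" "poly_act X" "mat_op g" using hom gc g by blast
    interpret g': Modules.module_hom "poly_act Y" "poly_act X" "mat_op g'" using hom gc g by blast
    have "Y.subspace {x. mat_op g x = mat_op g' x}"
      unfolding Y.subspace_def by (auto simp: mat_op_add g.scale g'.scale)
    moreover have "set ws \<subseteq> {x. mat_op g x = mat_op g' x}" using eq by auto
    ultimately have "fvecs n \<subseteq> {x. mat_op g x = mat_op g' x}" unfolding span[symmetric] by (intro Y.span_minimal)
    then show "g = g'" using gc by (intro mat_op_inject[of _ n n]) auto
  next
    fix vs assume "vs \<in> (\<lambda>g. map (mat_op g) ws) ` {g \<in> GL n. X * g = g * Y}"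
    then obtain g where g: "g \<in> GL n" "X * g = g * Y" "vs = map (mat_op g) ws" by auto
    then have "X.good L (map (mat_op g) ws)"
      using GL_mat_op_bij[OF g(1)] hom[of g]
      by (intro good_hom[OF Y.finite_poly_module_axioms X.finite_poly_module_axioms _ _ _ ws])
        (auto simp: bij_betw_def GL_def)
    then show "vs \<in> {vs. X.good L vs}" using g by simp
  next
    fix vs assume "vs \<in> {vs. X.good L vs}"
    then have vs: "X.good L vs" by simp
    have Xspan: "X.span (set vs) = fvecs n"
      using Y.card_span_good[OF ws L] span by (intro X.good_full[OF vs L]) simp
    obtain f where f: "bij_betw f (fvecs n) (fvecs n)"
      "\<And>x y. x \<in> fvecs n \<Longrightarrow> y \<in> fvecs n \<Longrightarrow> f (x + y) = f x + f y"
      "\<And>p x. x \<in> fvecs n \<Longrightarrow> f (poly_act Y p x) = poly_act X p (f x)" "map f ws = vs"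
      using good_iso[OF Y.finite_poly_module_axioms X.finite_poly_module_axioms L ws vs]
      unfolding span Xspan by metis
    obtain g where g: "g \<in> carrier_mat n n" "\<And>x. x \<in> fvecs n \<Longrightarrow> mat_op g x = f x"
    proof (rule linear_fvecs_mat[of f n n])
      show "f ` fvecs n \<subseteq> fvecs n" using f(1) by (simp add: bij_betw_def)
      show "f (\<lambda>i. c * x i) = (\<lambda>i. c * f x i)" if "x \<in> fvecs n" for c x
        using f(3)[OF that, of "[:c:]"] by (simp add: poly_act_const)
    qed (use f(2) in auto)
    have "bij_betw (mat_op g) (fvecs n) (fvecs n)" using f(1) g(2) by (simp cong: bij_betw_cong)
    then have GL: "g \<in> GL n" using g(1) by (intro mat_op_bij_GL)
    have "X * g = g * Y"
    proof (rule mat_op_inject[of _ n n])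
      fix x :: "nat \<Rightarrow> 'a" assume x: "x \<in> fvecs n"
      have t: "poly_act A [:0, 1:] z = mat_op A z" for A :: "'a mat" and z
        by (simp add: poly_act_pCons zero_fun_def[symmetric])
      have "mat_op g (mat_op Y x) = mat_op X (mat_op g x)"
        using f(3)[OF x, of "[:0, 1:]"] g(2)[OF x] g(2)[OF mat_op_in_fvecs[OF Y]] by (simp add: t)
      then show "mat_op (X * g) x = mat_op (g * Y) x"
        using X Y g(1) by (simp add: mat_op_mult[of _ n n _ n])
    qed (use X Y g in auto)
    moreover have "map (mat_op g) ws = vs" unfolding f(4)[symmetric] using wsV g(2) by auto
    ultimately show "vs \<in> (\<lambda>g. map (mat_op g) ws) ` {g \<in> GL n. X * g = g * Y}" using GL by auto
  qed
qed

lemma prime_elem_dvd_prod: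
  assumes "prime_elem p" "p dvd (\<Prod>a\<in>A. f a)"
  shows "\<exists>a\<in>A. p dvd f a"
  using assms(2)
  by (induction A rule: infinite_finite_induct)
    (use assms(1) in \<open>auto simp: prime_elem_dvd_mult_iff dest: prime_elem_not_unit\<close>)

subsection \<open>Matrices with prescribed types\<close>

text \<open>The matrix of multiplication by \<open>t\<close> on \<open>F[t]/(p)\<close>; by Cayley-Hamilton \<open>p\<close> divides its
  characteristic polynomial.\<close>

lemma companion_exists:
  fixes p :: "'a::{field,finite} poly"
  assumes p: "monic p" "0 < degree p"
  obtains C where "C \<in> carrier_mat (degree p) (degree p)"
    "\<And>q. poly_act C q (unit_fun 0) = coeff (q mod p)" "char_poly C = p"
proof -
  let ?m = "degree p"
  define P where "P x = Poly (map x [0..<?m])" for x :: "nat \<Rightarrow> 'a"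
  have P: "coeff (P x) = x" if "x \<in> fvecs ?m" for x
    using that by (auto simp: P_def fun_eq_iff fvecs_def nth_default_def)
  have P': "P (coeff r) = r" if "r \<in> lowdeg ?m" for r
    using P[of "coeff r"] that by (auto simp: fvecs_def lowdeg_def intro: poly_eqI)
  define f where "f x = coeff (pCons 0 (P x) mod p)" for x
  have pnz: "p \<noteq> 0" using p by auto
  obtain C where C: "C \<in> carrier_mat ?m ?m" "\<And>x. x \<in> fvecs ?m \<Longrightarrow> mat_op C x = f x"
  proof (rule linear_fvecs_mat[of f ?m ?m])
    show "f ` fvecs ?m \<subseteq> fvecs ?m"
      using mod_in_lowdeg[OF pnz] by (auto simp: f_def fvecs_def lowdeg_def)
    show "f (x + y) = f x + f y" if "x \<in> fvecs ?m" "y \<in> fvecs ?m" for x y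
    proof -
      have "pCons 0 (P (x + y)) = pCons 0 (P x) + pCons 0 (P y)"
        using that by (auto simp: fvecs_def poly_eq_iff P_def nth_default_def plus_fun_apply coeff_pCons split: nat.splits)
      then have "pCons 0 (P (x + y)) mod p = pCons 0 (P x) mod p + pCons 0 (P y) mod p"
        by (simp only: poly_mod_add_left)
      then show ?thesis by (simp add: f_def fun_eq_iff plus_fun_apply)
    qed
    show "f (\<lambda>i. c * x i) = (\<lambda>i. c * f x i)" if "x \<in> fvecs ?m" for c x
    proof -
      have "pCons 0 (P (\<lambda>i. c * x i)) = Polynomial.smult c (pCons 0 (P x))"
        by (auto simp: poly_eq_iff P_def nth_default_def coeff_pCons split: nat.splits)
      then have "pCons 0 (P (\<lambda>i. c * x i)) mod p = Polynomial.smult c (pCons 0 (P x) mod p)"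
        by (simp only: mod_smult_left)
      then show ?thesis by (simp add: f_def fun_eq_iff)
    qed
  qed blast
  have act: "poly_act C q (unit_fun 0) = coeff (q mod p)" for q
  proof (induction q)
    case 0
    then show ?case by (simp add: zero_fun_def)
  next
    case (pCons a q)
    have low: "q mod p \<in> lowdeg ?m" using mod_in_lowdeg[OF pnz] .
    then have "coeff (q mod p) \<in> fvecs ?m" by (simp add: fvecs_def lowdeg_def)
    then have "mat_op C (coeff (q mod p)) = coeff (pCons 0 (q mod p) mod p)"
      using C(2) P'[OF low] by (simp add: f_def)
    moreover have step: "pCons a q mod p = [:a:] + pCons 0 (q mod p) mod p"
    proof -
      have "pCons a q = [:a:] + [:0, 1:] * q" by simp
      then have "pCons a q mod p = [:a:] mod p + ([:0, 1:] * q) mod p" by (simp only: poly_mod_add_left)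
      also have "([:0, 1:] * q) mod p = ([:0, 1:] * (q mod p)) mod p" by (simp only: mod_mult_right_eq)
      also have "[:a:] mod p = [:a:]" using p by (simp add: mod_poly_less)
      finally show ?thesis by simp
    qed
    moreover have "(\<lambda>i. a * unit_fun 0 i) = coeff [:a:]"
      by (auto simp: unit_fun_def fun_eq_iff coeff_pCons split: nat.splits)
    ultimately have "poly_act C (pCons a q) (unit_fun 0) = coeff [:a:] + coeff (pCons 0 (q mod p) mod p)"
      by (simp only: poly_act_pCons pCons.IH)
    then show ?case unfolding step by (simp add: fun_eq_iff plus_fun_apply)
  qed
  have "coeff (char_poly C mod p) = (0 :: nat \<Rightarrow> 'a)"
    using Cayley_Hamilton_act[OF C(1) unit_fun_in_fvecs[OF p(2)]] act by metis
  then have "char_poly C mod p = 0" by (intro poly_eqI) (simp add: zero_fun_apply)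
  then obtain c where c: "char_poly C = p * c" by (metis dvd_def mod_eq_0_iff_dvd)
  have \<chi>: "degree (char_poly C) = ?m" "monic (char_poly C)" using degree_monic_char_poly[OF C(1)] by auto
  then have "c \<noteq> 0" using c p by auto
  then have "degree c = 0" using c \<chi> pnz by (simp add: degree_mult_eq)
  then obtain a where "c = [:a:]" by (rule degree_eq_zeroE)
  moreover have "lead_coeff c = 1" using \<chi>(2) p(1) unfolding c by (simp add: lead_coeff_mult)
  ultimately have "char_poly C = p" using c by simp
  with C(1) act show thesis by (rule that)
qed

section \<open>Block matrices of a given shape\<close>

lemma sum_lessThan_add: "(\<Sum>j<m + n. f j) = (\<Sum>j<m. f j) + (\<Sum>j<n. f (m + j))"
  for m n :: nat and f :: "nat \<Rightarrow> 'b::comm_monoid_add"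
  by (induction n) (simp_all add: add.assoc)

lemma char_poly_block_diag:
  fixes A D :: "'a::field mat"
  assumes A: "A \<in> carrier_mat m m" and D: "D \<in> carrier_mat n n"
  shows "char_poly (four_block_mat A (0\<^sub>m m n) (0\<^sub>m n m) D) = char_poly A * char_poly D"
proof -
  let ?B = "four_block_mat A (0\<^sub>m m n) (0\<^sub>m n m) D"
  have "char_poly_matrix ?B = four_block_mat (char_poly_matrix A) (0\<^sub>m m n) (0\<^sub>m n m) (char_poly_matrix D)"
    using A D by (intro eq_matI) (auto simp: char_poly_matrix_def)
  then show ?thesis
    unfolding char_poly_def using A D by (simp add: det_four_block_mat_lower_left_zero[of _ m _ n])
qed

text \<open>A block diagonal sum of companion matrices, one for each entry. The residue 1 generates
  the new block; the generators of the other blocks are shifted past it.\<close>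

lemma shape_matrix_exists:
  fixes L :: "('a::{field,finite} poly \<times> nat) list"
  assumes "valid_shape L"
  shows "\<exists>C ws. C \<in> carrier_mat (shape_degree L) (shape_degree L) \<and>
    finite_poly_module.good (poly_act C) (fvecs (shape_degree L)) L ws \<and>
    char_poly C = (\<Prod>(h, k)\<leftarrow>L. h ^ k)"
  using assms
proof (induction L)
  case Nil
  interpret matrix_module "0\<^sub>m 0 0 :: 'a mat" 0 by unfold_locales simp
  have "char_poly (0\<^sub>m 0 0 :: 'a mat) = 1" by (simp add: char_poly_def char_poly_matrix_def)
  moreover have "good [] []" by simp
  ultimately show ?case by (intro exI[of _ "0\<^sub>m 0 0"] exI[of _ "[]"]) simp
next
  case (Cons hk L)
  obtain h k where hk: "hk = (h, k)" by force
  have h: "h \<in> Irr" and k: "1 \<le> k" and L: "valid_shape L" using Cons.prems hk by auto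
  let ?m = "k * degree h" and ?n = "shape_degree L"
  have m: "degree (h ^ k) = ?m" using h by (rule degree_Irr_power)
  have mpos: "0 < ?m" using k Irr_degree_pos[OF h] by simp
  have monic: "monic (h ^ j)" for j using h by (simp add: Irr_def monic_power)
  obtain A where A: "A \<in> carrier_mat ?m ?m" "\<And>q. poly_act A q (unit_fun 0) = coeff (q mod h ^ k)"
    "char_poly A = h ^ k"
    using companion_exists[OF monic, of k] mpos unfolding m by metis
  obtain D ws where D: "D \<in> carrier_mat ?n ?n"
    and ws: "finite_poly_module.good (poly_act D) (fvecs ?n) L ws"
    and \<chi>: "char_poly D = (\<Prod>(h, k)\<leftarrow>L. h ^ k)"
    using Cons.IH[OF L] by blast
  let ?C = "four_block_mat A (0\<^sub>m ?m ?n) (0\<^sub>m ?n ?m) D"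
  have C: "?C \<in> carrier_mat (?m + ?n) (?m + ?n)" using A(1) D by simp
  define inc :: "(nat \<Rightarrow> 'a) \<Rightarrow> nat \<Rightarrow> 'a" where "inc f = (\<lambda>i. if i < ?m then f i else 0)" for f
  define shift :: "(nat \<Rightarrow> 'a) \<Rightarrow> nat \<Rightarrow> 'a" where "shift f = (\<lambda>i. if i < ?m then 0 else f (i - ?m))" for f
  interpret A: matrix_module A ?m by unfold_locales fact
  interpret D: matrix_module D ?n by unfold_locales fact
  interpret C: matrix_module ?C "?m + ?n" by unfold_locales fact
  have C_op: "mat_op ?C f = (\<lambda>i. if i < ?m then mat_op A f i else mat_op D (\<lambda>j. f (?m + j)) (i - ?m))" for f
  proof
    fix i
    show "mat_op ?C f i = (if i < ?m then mat_op A f i else mat_op D (\<lambda>j. f (?m + j)) (i - ?m))"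
      using A(1) D by (auto simp: mat_op_def sum_lessThan_add)
  qed
  interpret inc: Modules.module_hom "poly_act A" "poly_act ?C" inc
  proof (rule module_hom_intertwine[OF C A(1)])
    show "inc (mat_op A f) = mat_op ?C (inc f)" for f
    proof -
      have "mat_op A (inc f) = mat_op A f" using A(1) by (auto simp: mat_op_def inc_def)
      moreover have "(\<lambda>j. inc f (?m + j)) = 0" by (auto simp: inc_def zero_fun_def)
      ultimately show ?thesis unfolding C_op by (auto simp: inc_def zero_fun_apply)
    qed
  qed (auto simp: inc_def plus_fun_def)
  have shift: "Modules.module_hom (poly_act D) (poly_act ?C) shift"
  proof (rule module_hom_intertwine[OF C D])
    show "shift (mat_op D f) = mat_op ?C (shift f)" for f
    proof -
      have "(\<lambda>j. shift f (?m + j)) = f" by (auto simp: shift_def)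
      moreover have "mat_op A (shift f) i = 0" for i using A(1) by (auto simp: mat_op_def shift_def)
      ultimately show ?thesis unfolding C_op by (auto simp: shift_def)
    qed
  qed (auto simp: shift_def plus_fun_def)
  then interpret shift: Modules.module_hom "poly_act D" "poly_act ?C" shift .
  have "inj shift"
  proof (rule injI)
    fix f g assume "shift f = shift g"
    then have "shift f (?m + i) = shift g (?m + i)" for i by simp
    then show "f = g" by (auto simp: shift_def)
  qed
  then have tail: "C.good L (map shift ws)"
    by (intro good_hom[OF D.finite_poly_module_axioms C.finite_poly_module_axioms shift _ _ ws])
      (auto simp: inj_on_def shift_def fvecs_def)
  let ?v = "inc (unit_fun 0)"
  have act: "poly_act ?C q ?v = inc (coeff (q mod h ^ k))" for q
    using A(2) by (simp flip: inc.scale)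
  have "?v \<in> fvecs (?m + ?n)" by (auto simp: inc_def fvecs_def)
  moreover have "poly_act ?C (h ^ k) ?v = 0" unfolding act by (auto simp: act inc_def zero_fun_def)
  moreover have "poly_act ?C (h ^ (k - 1)) ?v \<notin> C.span (set (map shift ws))"
  proof
    assume "poly_act ?C (h ^ (k - 1)) ?v \<in> C.span (set (map shift ws))"
    then obtain f where f: "poly_act ?C (h ^ (k - 1)) ?v = shift f" by (auto simp: shift.span_image)
    \<comment> \<open>The position of the leading coefficient of \<open>h ^ (k - 1)\<close>. It lies
      in the new block, where every shifted vector vanishes, while the coefficient there is
      1.\<close>
    let ?i = "(k - 1) * degree h"
    have i: "degree (h ^ (k - 1)) = ?i" using h by (rule degree_Irr_power)
    have less: "?i < ?m" using k Irr_degree_pos[OF h] by simp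
    then have "h ^ (k - 1) mod h ^ k = h ^ (k - 1)" using i m by (intro mod_poly_less) simp
    then have "inc (coeff (h ^ (k - 1))) ?i = shift f ?i" using f act by metis
    then show False using less monic[of "k - 1"] i by (simp add: inc_def shift_def)
  qed
  ultimately have "C.good ((h, k) # L) (?v # map shift ws)" using tail by simp
  moreover have "char_poly ?C = (\<Prod>(h, k)\<leftarrow>hk # L. h ^ k)"
    using char_poly_block_diag[OF A(1) D] A(3) \<chi> by (simp add: hk)
  ultimately show ?case
    using C unfolding hk shape_degree_Cons by blast
qed

lemma char_poly_conj:
  assumes g: "g \<in> GL n" and X: "X \<in> carrier_mat n n" and C: "C \<in> carrier_mat n n" and eq: "X * g = g * C"
  shows "char_poly X = char_poly C"
proof -
  obtain g' where g': "g' \<in> carrier_mat n n" "g * g' = 1\<^sub>m n" "g' * g = 1\<^sub>m n" "g \<in> carrier_mat n n"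
    using GL_inverse[OF g] .
  have "g * C * g' = X * (g * g')" using g' X by (simp add: eq[symmetric])
  then have "X = g * C * g'" using g' X by simp
  then have "similar_mat X C" using g' X C by (intro similar_matI[of _ _ g g' n]) auto
  then show ?thesis by (rule char_poly_similar)
qed

lemma prod_type_shape:
  "distinct hs \<Longrightarrow> (\<Prod>(h, k)\<leftarrow>type_shape \<tau> hs. h ^ k) = (\<Prod>h\<in>set hs. h ^ sum_list (\<tau> h))"
proof (induction hs)
  case (Cons h hs)
  have "(\<Prod>(h, k)\<leftarrow>map (Pair h) \<mu>. h ^ k) = h ^ sum_list \<mu>" for \<mu>
    by (induction \<mu>) (simp_all add: power_add)
  then show ?case using Cons by (simp add: type_shape_Cons sum_list_rev)
qed simp

context matrix_module
begin

text \<open>A family of full degree makes \<open>X\<close> conjugate to the explicit block matrix of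
  the same shape, whose characteristic polynomial is known.\<close>

lemma char_poly_shape:
  assumes good: "good L vs" and L: "valid_shape L" and n: "shape_degree L = n"
  shows "char_poly X = (\<Prod>(h, k)\<leftarrow>L. h ^ k)"
proof -
  obtain C ws where C: "C \<in> carrier_mat n n" and ws: "finite_poly_module.good (poly_act C) (fvecs n) L ws"
    and \<chi>: "char_poly C = (\<Prod>(h, k)\<leftarrow>L. h ^ k)"
    using shape_matrix_exists[OF L] unfolding n by blast
  interpret C: matrix_module C n by unfold_locales fact
  have "C.span (set ws) = fvecs n" using C.good_full[OF ws L] n finite_card_fvecs by metis
  then have "vs \<in> (\<lambda>g. map (mat_op g) ws) ` {g \<in> GL n. X * g = g * C}"
    using intertwiners_bij[OF X C L ws] good by (auto simp: bij_betw_def)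
  then obtain g where "g \<in> GL n" "X * g = g * C" by auto
  then show ?thesis using char_poly_conj[OF _ X C] \<chi> by metis
qed

lemma degree_sum_types:
  assumes hs: "distinct hs" "set hs \<subseteq> Irr" "Div X \<subseteq> set hs"
  shows "(\<Sum>h\<in>set hs. sum_list (primary_type X h) * degree h) = n"
    and "char_poly X = (\<Prod>h\<in>set hs. h ^ sum_list (primary_type X h))"
proof -
  let ?L = "type_shape (primary_type X) hs"
  have L: "valid_shape ?L" using hs primary_type_in_partitions by (intro valid_type_shape) auto
  obtain vs where vs: "good ?L vs" "span (set vs) = fvecs n" using full_family_exists[OF hs] .
  have "CARD('a) ^ shape_degree ?L = CARD('a) ^ n"
    using card_span_good[OF vs(1) L] vs(2) finite_card_fvecs by metis
  then have n: "shape_degree ?L = n" using card_field_gt_1[where 'a = 'a] by simp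
  then show "(\<Sum>h\<in>set hs. sum_list (primary_type X h) * degree h) = n"
    using shape_degree_type_shape[OF hs(1)] by metis
  show "char_poly X = (\<Prod>h\<in>set hs. h ^ sum_list (primary_type X h))"
    using char_poly_shape[OF vs(1) L n] prod_type_shape[OF hs(1)] by metis
qed

lemma finite_Div: "finite (Div X)"
proof -
  have "degree h \<le> n" if "h \<in> Div X" for h
    using that degree_monic_char_poly[OF X] unfolding Div_def
    by (metis (no_types, lifting) dvd_imp_degree_le leading_coeff_0_iff mem_Collect_eq zero_neq_one)
  then have "Div X \<subseteq> lowdeg (Suc n)" by (auto simp: lowdeg_iff less_Suc_eq_le)
  then show ?thesis using finite_lowdeg by (rule finite_subset)
qed

lemma Div_iff_primary_type:
  assumes h: "h \<in> Irr"
  shows "h \<in> Div X \<longleftrightarrow> primary_type X h \<noteq> []"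
proof -
  \<comment> \<open>\<open>h\<close> joins the list so that its exponent shows in the factorization
    whether or not it divides.\<close>
  obtain hs where hs: "set hs = insert h (Div X)" "distinct hs"
    using finite_distinct_list[of "insert h (Div X)"] finite_Div by auto
  have Irr: "set hs \<subseteq> Irr" using hs h by (auto simp: Div_def)
  have \<chi>: "char_poly X = (\<Prod>h\<in>set hs. h ^ sum_list (primary_type X h))"
    using degree_sum_types(2)[OF hs(2) Irr] hs(1) by auto
  show ?thesis
  proof
    assume "h \<in> Div X"
    then have "h dvd (\<Prod>h\<in>set hs. h ^ sum_list (primary_type X h))" by (simp add: Div_def flip: \<chi>)
    then obtain g where g: "g \<in> set hs" "h dvd g ^ sum_list (primary_type X g)"
      using prime_elem_dvd_prod[OF Irr_prime_elem[OF h]] by blast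
    then have "h = g" using Irr Irr_dvd_Irr[OF h] prime_elem_dvd_power[OF Irr_prime_elem[OF h]] by blast
    then show "primary_type X h \<noteq> []"
      using g(2) Irr_degree_pos[OF h] by (auto simp: is_unit_iff_degree Irr_nonzero[OF h])
  next
    assume "primary_type X h \<noteq> []"
    then have "sum_list (primary_type X h) \<noteq> 0"
      using primary_type_in_partitions[OF h] by (cases "primary_type X h") (auto simp: partitions_def)
    then have "h dvd h ^ sum_list (primary_type X h)" by (intro dvd_power disjI1) (simp only: neq0_conv)
    also have "\<dots> dvd char_poly X" unfolding \<chi> using hs(1) by (intro dvd_prodI) (simp_all add: finite_Div)
    finally show "h \<in> Div X" using h by (simp add: Div_def)
  qed
qed

end

subsection \<open>Sizes of classes and centralizer orders\<close>

lemma one_in_GL: "1\<^sub>m n \<in> GL n"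
  unfolding GL_def invertible_mat_def inverts_mat_def by (auto intro!: exI[of _ "1\<^sub>m n"])

lemma finite_carrier_mat: "finite (carrier_mat n m :: 'a::finite mat set)"
proof -
  have "carrier_mat n m \<subseteq> (\<lambda>f. mat n m f :: 'a mat) ` (Pi\<^sub>E ({..<n} \<times> {..<m}) (\<lambda>_. UNIV))"
  proof
    fix A :: "'a mat" assume A: "A \<in> carrier_mat n m"
    then have eq: "A = mat n m (restrict (($$) A) ({..<n} \<times> {..<m}))" by (intro eq_matI) auto
    show "A \<in> (\<lambda>f. mat n m f) ` (Pi\<^sub>E ({..<n} \<times> {..<m}) (\<lambda>_. UNIV))"
      by (rule image_eqI[where x = "restrict (($$) A) ({..<n} \<times> {..<m})"], rule eq) auto
  qed
  then show ?thesis by (rule finite_subset) (auto intro!: finite_PiE)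
qed

lemma finite_GL: "finite (GL n :: 'a::{field,finite} mat set)"
  by (rule finite_subset[OF _ finite_carrier_mat]) (auto simp: GL_def)

lemma card_GL_pos: "0 < card (GL n :: 'a::{field,finite} mat set)"
  using finite_GL one_in_GL by (metis card_gt_0_iff empty_iff)

text \<open>The list only has to cover \<open>Div X\<close>, and empty types are allowed, so that
  one list serves all matrices of size \<open>n\<close>.\<close>

definition matrices_of_type :: "nat \<Rightarrow> 'a::{field,finite} poly list \<Rightarrow> ('a poly \<Rightarrow> nat list) \<Rightarrow> 'a mat set" where
  "matrices_of_type n hs \<tau> =
     {X \<in> carrier_mat n n. Div X \<subseteq> set hs \<and> (\<forall>h\<in>set hs. primary_type X h = \<tau> h)}"

context
  fixes hs :: "'a::{field,finite} poly list" and \<tau> :: "'a poly \<Rightarrow> nat list" and n :: nat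
  assumes hs: "distinct hs" "set hs \<subseteq> Irr" and \<tau>: "\<And>h. h \<in> set hs \<Longrightarrow> \<tau> h \<in> partitions"
    and n: "(\<Sum>h\<in>set hs. sum_list (\<tau> h) * degree h) = n"
begin

lemma shape_facts: "valid_shape (type_shape \<tau> hs)" "shape_degree (type_shape \<tau> hs) = n"
  using valid_type_shape[OF hs \<tau>] shape_degree_type_shape[OF hs(1)] n by auto

lemma good_card_ker:
  assumes X: "X \<in> carrier_mat n n" and good: "finite_poly_module.good (poly_act X) (fvecs n) (type_shape \<tau> hs) vs"
    and h: "h \<in> Irr"
  shows "card (finite_poly_module.ker (poly_act X) (fvecs n) h k) =
    CARD('a) ^ (degree h * (if h \<in> set hs then conj_sum (\<tau> h) k else 0))"
proof -
  interpret matrix_module X n by unfold_locales fact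
  have "span (set vs) = fvecs n" using good_full[OF good shape_facts(1)] shape_facts(2) finite_card_fvecs by metis
  then show ?thesis
    using card_ker_full[OF good shape_facts(1) _ h, of k] ker_len_type_shape[OF hs(1), of \<tau> h k] by metis
qed

text \<open>A family of full degree fixes all kernel sizes and hence all types. Outside
  \<open>hs\<close> the kernels are trivial, so the types there are empty and no further divisors
  occur.\<close>

lemma matrices_of_type_iff:
  assumes X: "X \<in> carrier_mat n n"
  shows "X \<in> matrices_of_type n hs \<tau> \<longleftrightarrow>
    (\<exists>vs. finite_poly_module.good (poly_act X) (fvecs n) (type_shape \<tau> hs) vs)"
proof -
  interpret matrix_module X n by unfold_locales fact
  show ?thesis
  proof
    assume T: "X \<in> matrices_of_type n hs \<tau>"
    then have "type_shape (primary_type X) hs = type_shape \<tau> hs"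
      by (auto simp: type_shape_def matrices_of_type_def intro!: arg_cong[of _ _ concat])
    then show "\<exists>vs. good (type_shape \<tau> hs) vs"
      using full_family_exists[OF hs] T unfolding matrices_of_type_def by (metis (no_types, lifting) mem_Collect_eq)
  next
    assume "\<exists>vs. good (type_shape \<tau> hs) vs"
    then obtain vs where vs: "good (type_shape \<tau> hs) vs" ..
    have "primary_type X h = \<tau> h" if "h \<in> set hs" for h
      using that hs \<tau> good_card_ker[OF X vs] by (intro primary_type_eqI) auto
    moreover have "primary_type X h = []" if "h \<in> Irr" "h \<notin> set hs" for h
      using that good_card_ker[OF X vs that(1)]
      by (intro primary_type_eqI) (auto simp: partitions_def conj_sum_def)
    ultimately show "X \<in> matrices_of_type n hs \<tau>"
      using X Div_iff_primary_type unfolding matrices_of_type_def by (auto simp: Div_def)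
  qed
qed

text \<open>The count does not see which \<open>X\<close> and \<open>Y\<close> are taken from the
  class: \<open>X = Y\<close> gives centralizers, a fixed \<open>Y\<close> gives the weights for
  counting the class.\<close>

lemma card_intertwiners:
  assumes X: "X \<in> matrices_of_type n hs \<tau>" and Y: "Y \<in> matrices_of_type n hs \<tau>"
  shows "card {g \<in> GL n. X * g = g * Y} = (\<Prod>h\<in>set hs. aut_count (CARD('a) ^ degree h) (\<tau> h))"
proof -
  have XY: "X \<in> carrier_mat n n" "Y \<in> carrier_mat n n" using X Y by (auto simp: matrices_of_type_def)
  interpret X: matrix_module X n by unfold_locales fact
  interpret Y: matrix_module Y n by unfold_locales fact
  obtain ws where ws: "Y.good (type_shape \<tau> hs) ws" using matrices_of_type_iff[OF XY(2)] Y by blast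
  have span: "Y.span (set ws) = fvecs n"
    using Y.good_full[OF ws shape_facts(1)] shape_facts(2) finite_card_fvecs by metis
  obtain vs where vs: "X.good (type_shape \<tau> hs) vs" using matrices_of_type_iff[OF XY(1)] X by blast
  have "card {g \<in> GL n. X * g = g * Y} = card {vs. X.good (type_shape \<tau> hs) vs}"
    using intertwiners_bij[OF XY shape_facts(1) ws span] by (rule bij_betw_same_card)
  also have "\<dots> = family_count (\<lambda>h k. card (X.ker h k)) (type_shape \<tau> hs)"
    using X.card_good[OF shape_facts(1)] by blast
  also have "\<dots> = (\<Prod>h\<in>set hs. aut_count (CARD('a) ^ degree h) (\<tau> h))"
    using hs good_card_ker[OF XY(1) vs] by (intro family_count_type_shape[OF hs(1) \<tau>]) auto
  finally show ?thesis .
qed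

lemma matrices_of_type_nonempty:
  obtains C where "C \<in> matrices_of_type n hs \<tau>" "char_poly C = (\<Prod>h\<in>set hs. h ^ sum_list (\<tau> h))"
proof -
  obtain C ws where C: "C \<in> carrier_mat n n" "char_poly C = (\<Prod>(h, k)\<leftarrow>type_shape \<tau> hs. h ^ k)"
    and ws: "finite_poly_module.good (poly_act C) (fvecs n) (type_shape \<tau> hs) ws"
    using shape_matrix_exists[OF shape_facts(1)] unfolding shape_facts(2) by blast
  interpret matrix_module C n by unfold_locales fact
  show thesis
    using that[of C] matrices_of_type_iff[OF C(1)] ws C(2) prod_type_shape[OF hs(1)] by auto
qed

text \<open>Fix \<open>C\<close> in the class.  Every invertible \<open>g\<close> satisfies \<open>X * g = g * C\<close> for exactly one \<open>X\<close> in
  the class, namely the conjugate of \<open>C\<close> by \<open>g\<close>.\<close>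

lemma card_matrices_of_type:
  "card (matrices_of_type n hs \<tau>) * (\<Prod>h\<in>set hs. aut_count (CARD('a) ^ degree h) (\<tau> h)) =
   card (GL n :: 'a mat set)"
proof -
  obtain C where CT: "C \<in> matrices_of_type n hs \<tau>" by (rule matrices_of_type_nonempty)
  then have C: "C \<in> carrier_mat n n" by (simp add: matrices_of_type_def)
  let ?S = "SIGMA X:matrices_of_type n hs \<tau>. {g \<in> GL n. X * g = g * C}"
  have finT: "finite (matrices_of_type n hs \<tau>)"
    by (rule finite_subset[OF _ finite_carrier_mat[of n n]]) (auto simp: matrices_of_type_def)
  have fin: "finite {g \<in> GL n. X * g = g * C}" for X
    by (rule finite_subset[OF _ finite_GL[of n]]) auto
  have "inj_on snd ?S"
  proof (rule inj_onI)
    fix a b assume a: "a \<in> ?S" and b: "b \<in> ?S" and eq: "snd a = snd b"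
    from a have g: "snd a \<in> GL n" by auto
    obtain g' where g': "g' \<in> carrier_mat n n" "snd a * g' = 1\<^sub>m n" "snd a \<in> carrier_mat n n"
      using GL_inverse[OF g] .
    have c: "fst a \<in> carrier_mat n n" "fst b \<in> carrier_mat n n" using a b by (auto simp: matrices_of_type_def)
    have "fst a * snd a = fst b * snd a" using a b eq by auto
    then have "fst a * (snd a * g') = fst b * (snd a * g')"
      using assoc_mult_mat[OF c(1) g'(3,1)] assoc_mult_mat[OF c(2) g'(3,1)] by simp
    then show "a = b" using c g' eq by (simp add: prod_eq_iff)
  qed
  then have "card (snd ` ?S) = card ?S" by (rule card_image)
  moreover have "snd ` ?S = GL n"
  proof (intro equalityI subsetI)
    fix g :: "'a mat" assume gGL: "g \<in> GL n"
    obtain g' where g': "g' \<in> carrier_mat n n" "g * g' = 1\<^sub>m n" "g' * g = 1\<^sub>m n" "g \<in> carrier_mat n n"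
      using GL_inverse[OF gGL] .
    define X where "X = g * C * g'"
    have X: "X \<in> carrier_mat n n" using g' C by (simp add: X_def)
    have "X * g = g * C * (g' * g)" unfolding X_def using g' C by (intro assoc_mult_mat) auto
    then have eq: "X * g = g * C" using g' C by simp
    interpret X: matrix_module X n by unfold_locales fact
    interpret C: matrix_module C n by unfold_locales fact
    obtain ws where ws: "C.good (type_shape \<tau> hs) ws" using matrices_of_type_iff[OF C] CT by blast
    have "Modules.module_hom (poly_act C) (poly_act X) (mat_op g)"
      using X C g' eq
      by (intro module_hom_intertwine) (auto simp: mat_op_add mat_op_scale simp flip: mat_op_mult)
    then have "X.good (type_shape \<tau> hs) (map (mat_op g) ws)"
      using GL_mat_op_bij[OF gGL]
      by (intro good_hom[OF C.finite_poly_module_axioms X.finite_poly_module_axioms _ _ _ ws])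
        (auto simp: bij_betw_def)
    then have "X \<in> matrices_of_type n hs \<tau>" using matrices_of_type_iff[OF X] by blast
    then show "g \<in> snd ` ?S" using eq gGL by (intro image_eqI[of _ _ "(X, g)"]) auto
  qed auto
  ultimately have "card (GL n :: 'a mat set) = card ?S" by simp
  also have "\<dots> = (\<Sum>X\<in>matrices_of_type n hs \<tau>. card {g \<in> GL n. X * g = g * C})"
    using finT fin by (simp add: card_SigmaI)
  also have "\<dots> = card (matrices_of_type n hs \<tau>) * (\<Prod>h\<in>set hs. aut_count (CARD('a) ^ degree h) (\<tau> h))"
    using card_intertwiners[OF _ CT] by simp
  finally show ?thesis ..
qed

end

text \<open>The count in \<open>card_intertwiners\<close> depends on the polynomial through its
  degree only, so all candidates in the definite description agree;
  \<open>matrices_of_type_nonempty\<close> supplies one.\<close>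

lemma cent_order_eq:
  fixes h :: "'a::{field,finite} poly"
  assumes h: "h \<in> Irr" and \<mu>: "\<mu> \<in> partitions"
  shows "cent_order TYPE('a) \<mu> (degree h) = aut_count (CARD('a) ^ degree h) \<mu>"
proof (cases "\<mu> = []")
  case True
  then show ?thesis by (simp add: cent_order_def aut_count_def)
next
  case False
  let ?n = "sum_list \<mu> * degree h" and ?N = "aut_count (CARD('a) ^ degree h) \<mu>"
  have cls: "X \<in> matrices_of_type ?n [g] (\<lambda>_. \<mu>)"
    if "g \<in> Irr" "X \<in> carrier_mat ?n ?n" "char_poly X = g ^ sum_list \<mu>" "primary_type X g = \<mu>" for X g
  proof -
    have "f = g" if "f \<in> Div X" for f
      using that \<open>g \<in> Irr\<close> \<open>char_poly X = g ^ sum_list \<mu>\<close>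
      by (auto simp: Div_def intro: Irr_dvd_Irr dest: prime_elem_dvd_power[OF Irr_prime_elem])
    then show ?thesis using that by (auto simp: matrices_of_type_def)
  qed
  have count: "card (centralizer_GL ?n X) = ?N"
    if "g \<in> Irr" "degree g = degree h" "X \<in> matrices_of_type ?n [g] (\<lambda>_. \<mu>)" for X and g :: "'a poly"
  proof -
    have "centralizer_GL ?n X = {A \<in> GL ?n. X * A = A * X}" by (auto simp: centralizer_GL_def)
    then show ?thesis
      using card_intertwiners[of "[g]" "\<lambda>_. \<mu>" ?n X X] that \<mu> by simp
  qed
  obtain C where C: "C \<in> matrices_of_type ?n [h] (\<lambda>_. \<mu>)" "char_poly C = (\<Prod>h\<in>set [h]. h ^ sum_list \<mu>)"
    by (rule matrices_of_type_nonempty[of "[h]" "\<lambda>_. \<mu>" ?n]) (use h \<mu> in auto)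
  have "(THE c. \<exists>g\<in>(Irr :: 'a poly set). \<exists>X\<in>carrier_mat ?n ?n.
      degree g = degree h \<and> char_poly X = g ^ sum_list \<mu> \<and> primary_type X g = \<mu> \<and>
      c = card (centralizer_GL ?n X)) = ?N"
  proof (rule the_equality)
    show "\<exists>g\<in>(Irr :: 'a poly set). \<exists>X\<in>carrier_mat ?n ?n. degree g = degree h \<and> char_poly X = g ^ sum_list \<mu> \<and>
        primary_type X g = \<mu> \<and> ?N = card (centralizer_GL ?n X)"
    proof -
      have "C \<in> carrier_mat ?n ?n \<and> char_poly C = h ^ sum_list \<mu> \<and> primary_type C h = \<mu> \<and>
          ?N = card (centralizer_GL ?n C)"
        using C count[OF h refl C(1)] by (auto simp: matrices_of_type_def)
      then show ?thesis using h by blast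
    qed
  next
    fix c
    assume "\<exists>g\<in>(Irr :: 'a poly set). \<exists>X\<in>carrier_mat ?n ?n. degree g = degree h \<and> char_poly X = g ^ sum_list \<mu> \<and>
        primary_type X g = \<mu> \<and> c = card (centralizer_GL ?n X)"
    then show "c = ?N" using cls count by blast
  qed
  then show ?thesis using False by (simp add: cent_order_def)
qed

subsection \<open>Generating functions\<close>

lemma xconst_mult: "xconst (a * b) = xconst a * xconst b"
  by (simp add: xconst_def mult_single)

lemma xconst_1 [simp]: "xconst 1 = 1"
  by (simp add: xconst_def)

lemma xconst_of_nat: "xconst (of_nat k) = of_nat k"
  by (induction k) (simp_all add: xconst_def single_add single_zero)

lemma xconst_prod: "xconst (\<Prod>a\<in>A. f a) = (\<Prod>a\<in>A. xconst (f a))"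
  by (induction A rule: infinite_finite_induct) (simp_all add: xconst_mult)

section \<open>Coefficients of products of power series\<close>

lemma fps_prod_nth_cong:
  fixes f g :: "'i \<Rightarrow> 'b::comm_ring_1 fps"
  assumes "\<And>i k. i \<in> S \<Longrightarrow> k \<le> n \<Longrightarrow> fps_nth (f i) k = fps_nth (g i) k"
  shows "k \<le> n \<Longrightarrow> fps_nth (\<Prod>i\<in>S. f i) k = fps_nth (\<Prod>i\<in>S. g i) k"
  using assms
proof (induction S arbitrary: k rule: infinite_finite_induct)
  case (insert i S)
  then show ?case by (auto simp: fps_mult_nth intro!: sum.cong)
qed auto

lemma fps_mult_nth_cong:
  fixes f g :: "'b::comm_ring_1 fps"
  assumes "\<And>k. k \<le> n \<Longrightarrow> fps_nth f k = fps_nth f' k" "\<And>k. k \<le> n \<Longrightarrow> fps_nth g k = fps_nth g' k"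
  shows "fps_nth (f * g) n = fps_nth (f' * g') n"
  using assms by (auto simp: fps_mult_nth intro!: sum.cong)

text \<open>Factor \<open>i\<close> is 1 up to terms of order \<open>d i\<close>, so coefficient
  \<open>k\<close> of a finite product stops changing once all factors with
  \<open>d i \<le> k\<close> are present.\<close>

lemma fps_has_prod_stable:
  fixes f :: "'i \<Rightarrow> 'b::comm_ring_1 fps" and d :: "'i \<Rightarrow> nat"
  assumes fin: "\<And>n. finite {i \<in> A. d i \<le> n}"
    and trivial: "\<And>i k. i \<in> A \<Longrightarrow> k < d i \<Longrightarrow> fps_nth (f i) k = (if k = 0 then 1 else 0)"
  obtains P where "fps_has_prod f A P"
    "\<And>n k. k \<le> n \<Longrightarrow> fps_nth P k = fps_nth (\<Prod>i\<in>{i \<in> A. d i \<le> n}. f i) k"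
proof -
  let ?B = "\<lambda>n. {i \<in> A. d i \<le> n}"
  have stable: "fps_nth (\<Prod>i\<in>B. f i) k = fps_nth (\<Prod>i\<in>?B k. f i) k"
    if B: "finite B" "?B k \<subseteq> B" "B \<subseteq> A" for B k
  proof -
    have "fps_nth (\<Prod>i\<in>B. f i) k = fps_nth (\<Prod>i\<in>B. if i \<in> ?B k then f i else 1) k"
      using B trivial by (intro fps_prod_nth_cong[of B k]) (auto simp: subset_iff)
    also have "(\<Prod>i\<in>B. if i \<in> ?B k then f i else 1) = (\<Prod>i\<in>?B k. f i)"
      using B by (intro prod.mono_neutral_cong_right) auto
    finally show ?thesis .
  qed
  define P where "P = Abs_fps (\<lambda>k. fps_nth (\<Prod>i\<in>?B k. f i) k)"
  show thesis
  proof (rule that)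
    show "fps_nth P k = fps_nth (\<Prod>i\<in>?B n. f i) k" if "k \<le> n" for n k
      using that fin by (subst stable) (auto simp: P_def)
    show "fps_has_prod f A P"
      unfolding fps_has_prod_def tendsto_fps_iff
    proof
      fix n
      have "eventually (\<lambda>B. finite B \<and> ?B n \<subseteq> B \<and> B \<subseteq> A) (finite_subsets_at_top A)"
        using fin[of n] by (auto simp: eventually_finite_subsets_at_top)
      then show "eventually (\<lambda>B. fps_nth (prod f B) n = fps_nth P n) (finite_subsets_at_top A)"
        by eventually_elim (use stable in \<open>auto simp: P_def\<close>)
    qed
  qed
qed

text \<open>Degrees being positive, no larger partition can occur in coefficient \<open>n\<close>.
  The bound makes the sums finite, so that a product of sums can be expanded.\<close>

definition bounded_partitions :: "nat \<Rightarrow> nat list set" where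
  "bounded_partitions n = {\<mu> \<in> partitions. sum_list \<mu> \<le> n}"

lemma finite_bounded_partitions: "finite (bounded_partitions n)"
proof -
  have "bounded_partitions n = (\<Union>m\<le>n. {\<mu> \<in> partitions. sum_list \<mu> = m})"
    by (auto simp: bounded_partitions_def)
  then show ?thesis by (simp add: finite_partitions)
qed

text \<open>The series are replaced by finite sums that agree with them up to order
  \<open>n\<close>; in the expanded product each choice of partitions contributes to one power of
  \<open>u\<close>.\<close>

lemma fps_prod_partition_series:
  fixes b :: "'i \<Rightarrow> nat list \<Rightarrow> 'b::comm_ring_1" and d :: "'i \<Rightarrow> nat"
  assumes S: "finite S" and d: "\<And>i. i \<in> S \<Longrightarrow> 0 < d i"
    and F: "\<And>i k. i \<in> S \<Longrightarrow>
      fps_nth (F i) k = (\<Sum>\<mu>\<in>{\<mu> \<in> partitions. sum_list \<mu> * d i = k}. b i \<mu>)"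
  shows "fps_nth (\<Prod>i\<in>S. F i) n =
    (\<Sum>\<tau>\<in>{\<tau> \<in> Pi\<^sub>E S (\<lambda>_. bounded_partitions n). (\<Sum>i\<in>S. sum_list (\<tau> i) * d i) = n}. \<Prod>i\<in>S. b i (\<tau> i))"
proof -
  let ?B = "bounded_partitions n"
  define G where "G i = (\<Sum>\<mu>\<in>?B. fps_const (b i \<mu>) * fps_X ^ (sum_list \<mu> * d i))" for i
  have nth: "fps_nth (fps_const c * fps_X ^ e) k = (if e = k then c else 0)" for c :: 'b and e k
    by (simp add: fps_X_power_iff)
  have FG: "fps_nth (F i) k = fps_nth (G i) k" if i: "i \<in> S" and k: "k \<le> n" for i k
  proof -
    have "sum_list \<mu> \<le> n" if "sum_list \<mu> * d i = k" for \<mu>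
      using that k d[OF i] by (metis Suc_leI le_trans mult_le_mono2 mult.right_neutral One_nat_def)
    then have "{\<mu> \<in> partitions. sum_list \<mu> * d i = k} = {\<mu> \<in> ?B. sum_list \<mu> * d i = k}"
      by (auto simp: bounded_partitions_def)
    moreover have "fps_nth (G i) k = (\<Sum>\<mu>\<in>?B. if sum_list \<mu> * d i = k then b i \<mu> else 0)"
      by (simp only: G_def fps_sum_nth nth)
    ultimately show ?thesis
      using finite_bounded_partitions by (simp add: F[OF i] sum.inter_filter)
  qed
  have prod_monom: "(\<Prod>i\<in>S. fps_const (b i (\<tau> i)) * fps_X ^ (sum_list (\<tau> i) * d i)) =
      fps_const (\<Prod>i\<in>S. b i (\<tau> i)) * fps_X ^ (\<Sum>i\<in>S. sum_list (\<tau> i) * d i)" for \<tau>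
    using S by (induction S rule: finite_induct) (simp_all add: power_add mult_ac flip: fps_const_mult)
  have "fps_nth (\<Prod>i\<in>S. F i) n = fps_nth (\<Prod>i\<in>S. G i) n"
    using FG by (intro fps_prod_nth_cong[of S n]) auto
  also have "(\<Prod>i\<in>S. G i) = (\<Sum>\<tau>\<in>Pi\<^sub>E S (\<lambda>_. ?B). fps_const (\<Prod>i\<in>S. b i (\<tau> i)) *
      fps_X ^ (\<Sum>i\<in>S. sum_list (\<tau> i) * d i))"
    unfolding G_def using S finite_bounded_partitions by (subst prod_sum_PiE) (auto simp: prod_monom)
  also have "fps_nth \<dots> n = (\<Sum>\<tau>\<in>{\<tau> \<in> Pi\<^sub>E S (\<lambda>_. ?B). (\<Sum>i\<in>S. sum_list (\<tau> i) * d i) = n}.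
      \<Prod>i\<in>S. b i (\<tau> i))"
    using S finite_bounded_partitions by (simp only: fps_sum_nth nth) (simp add: sum.inter_filter finite_PiE)
  finally show ?thesis .
qed

lemma finite_Irr_degree_le: "finite {h \<in> (Irr :: 'a::{field,finite} poly set). degree h \<le> n}"
  by (rule finite_subset[OF _ finite_lowdeg[of "Suc n"]]) (auto simp: lowdeg_iff)

text \<open>Treats both kinds of factors alike: the empty partition contributes 1 for
  \<open>h \<notin> I\<close> and \<open>xvar h []\<close> for \<open>h \<in> I\<close>, as its
  \<open>cent_order\<close> is 1.\<close>

definition type_coeff :: "'a::{field,finite} poly set \<Rightarrow> 'a poly \<Rightarrow> nat list \<Rightarrow> 'a xpoly" where
  "type_coeff I h \<mu> = (if \<mu> = [] \<and> h \<notin> I then 1 else xvar h \<mu>) *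
     xconst (1 / of_nat (cent_order TYPE('a) \<mu> (degree h)))"

lemma type_series_nth:
  fixes h :: "'a::{field,finite} poly"
  assumes h: "h \<in> Irr"
  shows "fps_nth ((if h \<in> I then fps_const (xvar h []) else 1) + type_series h) n =
    (\<Sum>\<mu>\<in>{\<mu> \<in> partitions. sum_list \<mu> * degree h = n}. type_coeff I h \<mu>)"
proof -
  let ?a = "\<lambda>\<mu>. xvar h \<mu> * xconst (1 / of_nat (cent_order TYPE('a) \<mu> (degree h)))"
  have d: "0 < degree h" using Irr_degree_pos[OF h] .
  have finP: "finite {\<mu> \<in> partitions. sum_list \<mu> * degree h = n}" for n
    by (rule finite_subset[OF _ finite_partitions[of "n div degree h"]]) (use d in auto)
  have fin: "finite {\<mu> \<in> partitions - {[]}. sum_list \<mu> * degree h = n}" for n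
    by (rule finite_subset[OF _ finP[of n]]) auto
  have ts: "fps_nth (type_series h) n = (\<Sum>\<mu>\<in>{\<mu> \<in> partitions - {[]}. sum_list \<mu> * degree h = n}. ?a \<mu>)"
    unfolding type_series_def
    by (subst infsumI[OF has_sum_fps_monomials[OF fin]]) simp
  have nil: "[] \<in> partitions" by (simp add: partitions_def)
  have coeff_nil: "type_coeff I h [] = (if h \<in> I then xvar h [] else 1)"
    by (simp add: type_coeff_def cent_order_def)
  have coeff: "type_coeff I h \<mu> = ?a \<mu>" if "\<mu> \<noteq> []" for \<mu> using that by (simp add: type_coeff_def)
  show ?thesis
  proof (cases "n = 0")
    case True
    have z: "\<mu> = []" if "\<mu> \<in> partitions" "sum_list \<mu> * degree h = 0" for \<mu>
      using that d by (cases \<mu>) (auto simp: partitions_def)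
    have all: "{\<mu> \<in> partitions. sum_list \<mu> * degree h = n} = {[]}"
    proof (intro equalityI subsetI)
      fix \<mu> assume "\<mu> \<in> {\<mu> \<in> partitions. sum_list \<mu> * degree h = n}"
      then show "\<mu> \<in> {[]}" using z[of \<mu>] True by simp
    qed (use nil True in simp)
    then have nonempty: "{\<mu> \<in> partitions - {[]}. sum_list \<mu> * degree h = n} = {}" by blast
    show ?thesis
      unfolding fps_add_nth ts all nonempty using True by (simp add: coeff_nil)
  next
    case False
    then have "{\<mu> \<in> partitions. sum_list \<mu> * degree h = n} = {\<mu> \<in> partitions - {[]}. sum_list \<mu> * degree h = n}"
      by auto
    moreover have "(\<Sum>\<mu>\<in>{\<mu> \<in> partitions - {[]}. sum_list \<mu> * degree h = n}. type_coeff I h \<mu>) =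
        (\<Sum>\<mu>\<in>{\<mu> \<in> partitions - {[]}. sum_list \<mu> * degree h = n}. ?a \<mu>)"
      by (intro sum.cong) (auto simp: coeff)
    ultimately show ?thesis using False ts by simp
  qed
qed

text \<open>Matrices are grouped by their types on \<open>S\<close>, which contains all their
  divisors by the degree condition. The size of a class is the order of \<open>GL n\<close> divided
  by the product of the centralizer orders, so the prefactor of the cycle index cancels.\<close>

lemma cycle_index_eq_sum:
  fixes I S :: "'a::{field,finite} poly set"
  assumes S: "finite S" "S \<subseteq> Irr" and I: "I \<subseteq> S" and deg: "\<And>h. h \<in> Irr \<Longrightarrow> degree h \<le> n \<Longrightarrow> h \<in> S"
  shows "cycle_index I n =
    (\<Sum>\<tau>\<in>{\<tau> \<in> Pi\<^sub>E S (\<lambda>_. bounded_partitions n). (\<Sum>h\<in>S. sum_list (\<tau> h) * degree h) = n}.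
      \<Prod>h\<in>S. type_coeff I h (\<tau> h))"
proof -
  let ?T = "{\<tau> \<in> Pi\<^sub>E S (\<lambda>_. bounded_partitions n). (\<Sum>h\<in>S. sum_list (\<tau> h) * degree h) = n}"
  let ?q = "of_nat (card (GL n :: 'a mat set)) :: rat"
  let ?m = "\<lambda>X. \<Prod>h\<in>Div X \<union> I. xvar h (primary_type X h)"
  \<comment> \<open>The monomial shared by a class: the \<open>h \<in> S\<close> outside
    \<open>Div X \<union> I\<close> are those with empty type and \<open>h \<notin> I\<close>, and
    they contribute 1.\<close>
  define M where "M \<tau> = (\<Prod>h\<in>S. if \<tau> h = [] \<and> h \<notin> I then 1 else xvar h (\<tau> h))" for \<tau>
  define ty where "ty X = restrict (primary_type X) S" for X :: "'a mat"
  obtain hs where hs: "set hs = S" "distinct hs" using finite_distinct_list[OF S(1)] by auto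
  have Div: "Div X \<subseteq> S" if "X \<in> carrier_mat n n" for X :: "'a mat"
  proof
    fix h assume h: "h \<in> Div X"
    then have "degree h \<le> n"
      using degree_monic_char_poly[OF that] unfolding Div_def
      by (metis (no_types, lifting) dvd_imp_degree_le leading_coeff_0_iff mem_Collect_eq zero_neq_one)
    then show "h \<in> S" using deg h by (auto simp: Div_def)
  qed
  have ty: "ty X \<in> ?T" and mM: "?m X = M (ty X)" if X: "X \<in> carrier_mat n n" for X :: "'a mat"
  proof -
    interpret matrix_module X n by unfold_locales fact
    have sum: "(\<Sum>h\<in>S. sum_list (primary_type X h) * degree h) = n"
      using degree_sum_types(1)[OF hs(2)] hs(1) S(2) Div[OF X] by simp
    have "sum_list (primary_type X h) \<le> n" if h: "h \<in> S" for h
    proof -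
      have "sum_list (primary_type X h) \<le> sum_list (primary_type X h) * degree h"
        using Irr_degree_pos h S(2) by (metis Suc_leI mult_le_mono2 mult.right_neutral One_nat_def subsetD)
      also have "\<dots> \<le> n" unfolding sum[symmetric] using S(1) h by (intro member_le_sum) auto
      finally show ?thesis .
    qed
    then show "ty X \<in> ?T"
      using primary_type_in_partitions S(2) sum by (auto simp: ty_def bounded_partitions_def)
    have "M (ty X) = (\<Prod>h\<in>S. if primary_type X h = [] \<and> h \<notin> I then 1 else xvar h (primary_type X h))"
      unfolding M_def ty_def by (intro prod.cong) auto
    also have "\<dots> = ?m X"
      using S Div[OF X] I Div_iff_primary_type by (intro prod.mono_neutral_cong_right) auto
    finally show "?m X = M (ty X)" ..
  qed
  have finT: "finite ?T"
    by (rule finite_subset[of _ "Pi\<^sub>E S (\<lambda>_. bounded_partitions n)"])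
      (auto intro!: finite_PiE S(1) finite_bounded_partitions)
  have "(\<Sum>X\<in>carrier_mat n n. ?m X) = (\<Sum>X\<in>carrier_mat n n. M (ty X))"
    by (intro sum.cong refl mM)
  also have "\<dots> = (\<Sum>\<tau>\<in>?T. \<Sum>X\<in>{X \<in> carrier_mat n n. ty X = \<tau>}. M (ty X))"
    using ty finT by (intro sum.group[symmetric] finite_carrier_mat) auto
  also have "\<dots> = (\<Sum>\<tau>\<in>?T. of_nat (card (matrices_of_type n hs \<tau>)) * M \<tau>)"
  proof (intro sum.cong refl)
    fix \<tau> assume \<tau>: "\<tau> \<in> ?T"
    have "{X \<in> carrier_mat n n. ty X = \<tau>} = matrices_of_type n hs \<tau>"
      using \<tau> Div unfolding matrices_of_type_def hs(1) ty_def
      by (auto simp: fun_eq_iff restrict_def PiE_def extensional_def)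
    then show "(\<Sum>X\<in>{X \<in> carrier_mat n n. ty X = \<tau>}. M (ty X)) = of_nat (card (matrices_of_type n hs \<tau>)) * M \<tau>"
      by (simp flip: \<open>{X \<in> carrier_mat n n. ty X = \<tau>} = _\<close>)
  qed
  finally have "cycle_index I n =
      (\<Sum>\<tau>\<in>?T. xconst (1 / ?q) * of_nat (card (matrices_of_type n hs \<tau>)) * M \<tau>)"
    by (simp add: cycle_index_def sum_distrib_left mult.assoc)
  also have "\<dots> = (\<Sum>\<tau>\<in>?T. \<Prod>h\<in>S. type_coeff I h (\<tau> h))"
  proof (intro sum.cong refl)
    fix \<tau> assume \<tau>: "\<tau> \<in> ?T"
    have part: "\<tau> h \<in> partitions" if "h \<in> S" for h using \<tau> that by (auto simp: bounded_partitions_def)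
    let ?A = "\<Prod>h\<in>S. aut_count (CARD('a) ^ degree h) (\<tau> h)"
    have card: "card (matrices_of_type n hs \<tau>) * ?A = card (GL n :: 'a mat set)"
      using card_matrices_of_type[of hs \<tau> n] hs S(2) part \<tau> by simp
    have "1 / of_nat G * of_nat c = (1 / of_nat A :: rat)" if "c * A = G" "0 < G" for c A G :: nat
      using that by (auto simp: field_simps)
    from this[OF card card_GL_pos]
    have "1 / ?q * of_nat (card (matrices_of_type n hs \<tau>)) = 1 / of_nat ?A" .
    then have "xconst (1 / ?q) * of_nat (card (matrices_of_type n hs \<tau>)) = (xconst (1 / of_nat ?A) :: 'a xpoly)"
      by (metis xconst_mult xconst_of_nat)
    also have "\<dots> = (\<Prod>h\<in>S. xconst (1 / of_nat (cent_order TYPE('a) (\<tau> h) (degree h))))"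
    proof -
      have "1 / of_nat ?A = (\<Prod>h\<in>S. 1 / of_nat (cent_order TYPE('a) (\<tau> h) (degree h)) :: rat)"
        using part S(2) by (simp add: prod_dividef subset_iff cent_order_eq cong: prod.cong)
      then show ?thesis by (simp only: xconst_prod)
    qed
    finally show "xconst (1 / ?q) * of_nat (card (matrices_of_type n hs \<tau>)) * M \<tau> =
        (\<Prod>h\<in>S. type_coeff I h (\<tau> h))"
      by (simp add: M_def type_coeff_def prod.distrib mult.commute)
  qed
  finally show ?thesis .
qed

text \<open>The only 0 by 0 matrix is invertible and has characteristic polynomial 1. So the
  separate constant term of the theorem is the cycle index for \<open>n = 0\<close>, and all
  coefficients can be compared uniformly.\<close>

lemma cycle_index_0:
  fixes I :: "'a::{field,finite} poly set"
  assumes I: "I \<subseteq> Irr"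
  shows "cycle_index I 0 = (\<Prod>h\<in>I. xvar h [])"
proof -
  let ?X = "0\<^sub>m 0 0 :: 'a mat"
  have c: "carrier_mat 0 0 = {?X}" by (auto intro: eq_matI)
  interpret matrix_module ?X 0 by unfold_locales simp
  have "1\<^sub>m 0 = ?X" by (rule eq_matI) auto
  then have "GL 0 = {?X}" using one_in_GL[where 'a = 'a, of 0] c by (auto simp: GL_def)
  moreover have Div: "Div ?X = {}"
  proof -
    have "char_poly ?X = 1" by (simp add: char_poly_def char_poly_matrix_def)
    then show ?thesis using Irr_degree_pos by (auto simp: Div_def is_unit_iff_degree Irr_nonzero)
  qed
  moreover have "primary_type ?X h = []" if "h \<in> I" for h
    using Div Div_iff_primary_type[of h] that I by auto
  ultimately show ?thesis by (simp add: cycle_index_def c)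
qed

theorem theorem3p6:
  fixes I :: "'a::{field,finite} poly set"
  assumes "finite I" and "I \<subseteq> Irr"
  shows "\<exists>P. fps_has_prod (\<lambda>h. 1 + type_series h) (Irr - I) P \<and>
    fps_const (\<Prod>h\<in>I. xvar h []) + (\<Sum>\<^sub>\<infinity>n\<in>{1..}. fps_const (cycle_index I n) * fps_X ^ n)
      = P * (\<Prod>h\<in>I. fps_const (xvar h []) + type_series h)"
proof -
  let ?f = "\<lambda>h :: 'a poly. 1 + type_series h"
  let ?B = "\<lambda>n. {h \<in> Irr - I. degree h \<le> n}"
  let ?F = "\<lambda>h. (if h \<in> I then fps_const (xvar h []) else 1) + type_series h"
  have finB: "finite (?B n)" for n
    by (rule finite_subset[OF _ finite_Irr_degree_le[of n]]) auto
  have "fps_nth (?f h) k = (if k = 0 then 1 else 0)" if h: "h \<in> Irr - I" and k: "k < degree h" for h k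
  proof -
    \<comment> \<open>Below \<open>degree h\<close> only the empty partition contributes, so the
      factor is 1 up to that order.\<close>
    have "{\<mu> \<in> partitions. sum_list \<mu> * degree h = k} = (if k = 0 then {[]} else {})"
    proof -
      have z: "\<mu> = [] \<and> k = 0" if \<mu>: "\<mu> \<in> partitions" "sum_list \<mu> * degree h = k" for \<mu>
      proof -
        have "sum_list \<mu> = 0" using \<mu>(2) k by (cases "sum_list \<mu>") auto
        then have "\<mu> = []" using \<mu>(1) by (cases \<mu>) (auto simp: partitions_def)
        then show ?thesis using \<mu>(2) by simp
      qed
      show ?thesis
      proof (intro equalityI subsetI)
        fix \<mu> assume "\<mu> \<in> {\<mu> \<in> partitions. sum_list \<mu> * degree h = k}"
        then show "\<mu> \<in> (if k = 0 then {[]} else {})" using z[of \<mu>] by simp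
      qed (auto simp: partitions_def split: if_splits)
    qed
    then show ?thesis
      using type_series_nth[of h I k] h by (simp add: type_coeff_def cent_order_def)
  qed
  then obtain P where P: "fps_has_prod ?f (Irr - I) P"
    "\<And>n k. k \<le> n \<Longrightarrow> fps_nth P k = fps_nth (\<Prod>h\<in>?B n. ?f h) k"
    using fps_has_prod_stable[of "Irr - I" degree ?f] finB by blast
  have lhs: "fps_nth (fps_const (\<Prod>h\<in>I. xvar h []) +
      (\<Sum>\<^sub>\<infinity>n\<in>{1..}. fps_const (cycle_index I n) * fps_X ^ n)) n = cycle_index I n" for n
  proof -
    have fin: "finite {i \<in> {1..}. i = m}" for m :: nat by simp
    have "fps_nth (\<Sum>\<^sub>\<infinity>n\<in>{1..}. fps_const (cycle_index I n) * fps_X ^ n) n =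
        (\<Sum>i\<in>{i \<in> {1..}. i = n}. cycle_index I i)"
      by (subst infsumI[OF has_sum_fps_monomials[OF fin]]) simp
    also have "{i \<in> {1..}. i = n} = (if n = 0 then {} else {n})" by auto
    finally show ?thesis using cycle_index_0[OF assms(2)] by auto
  qed
  have "fps_const (\<Prod>h\<in>I. xvar h []) + (\<Sum>\<^sub>\<infinity>n\<in>{1..}. fps_const (cycle_index I n) * fps_X ^ n)
      = P * (\<Prod>h\<in>I. fps_const (xvar h []) + type_series h)"
  proof (rule fps_ext)
    fix n
    \<comment> \<open>\<open>?S\<close> contains \<open>I\<close> and every polynomial that can
      divide the characteristic polynomial of a matrix of size \<open>n\<close>; the other factors
      of \<open>P\<close> affect only coefficients beyond \<open>n\<close>.\<close>
    let ?S = "?B n \<union> I"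
    have "cycle_index I n = fps_nth (\<Prod>h\<in>?S. ?F h) n"
    proof -
      have "cycle_index I n = (\<Sum>\<tau>\<in>{\<tau> \<in> Pi\<^sub>E ?S (\<lambda>_. bounded_partitions n).
          (\<Sum>h\<in>?S. sum_list (\<tau> h) * degree h) = n}. \<Prod>h\<in>?S. type_coeff I h (\<tau> h))"
        using assms finB by (intro cycle_index_eq_sum) auto
      also have "\<dots> = fps_nth (\<Prod>h\<in>?S. ?F h) n"
      proof (rule fps_prod_partition_series[symmetric])
        show "finite ?S" using assms finB by simp
        show "0 < degree h" if "h \<in> ?S" for h using that assms Irr_degree_pos by auto
        show "fps_nth (?F h) k = (\<Sum>\<mu>\<in>{\<mu> \<in> partitions. sum_list \<mu> * degree h = k}. type_coeff I h \<mu>)"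
          if "h \<in> ?S" for h k
          by (rule type_series_nth) (use that assms in auto)
      qed
      finally show ?thesis .
    qed
    also have "(\<Prod>h\<in>?S. ?F h) = (\<Prod>h\<in>?B n. ?F h) * (\<Prod>h\<in>I. ?F h)"
      using finB assms(1) by (intro prod.union_disjoint) auto
    also have "\<dots> = (\<Prod>h\<in>?B n. ?f h) * (\<Prod>h\<in>I. fps_const (xvar h []) + type_series h)"
      by (intro arg_cong2[of _ _ _ _ "(*)"] prod.cong) auto
    also have "fps_nth \<dots> n = fps_nth (P * (\<Prod>h\<in>I. fps_const (xvar h []) + type_series h)) n"
      using P(2) by (intro fps_mult_nth_cong) auto
    finally show "fps_nth (fps_const (\<Prod>h\<in>I. xvar h []) +
        (\<Sum>\<^sub>\<infinity>n\<in>{1..}. fps_const (cycle_index I n) * fps_X ^ n)) n =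
        fps_nth (P * (\<Prod>h\<in>I. fps_const (xvar h []) + type_series h)) n"
      unfolding lhs .
  qed
  with P(1) show ?thesis by blast
qed

end
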